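(* Let $H$ be a complex Hilbert space and let $A\subseteq\mathcal B(H)$ be a $\sigma$-weakly closed subalgebra with the complete reduction property such that $A\cap\mathcal K(H)$ acts nondegenerately on $H$. Then $A$ is similar to a C*-algebra, i.e. there is a bounded invertible $S\in\mathcal B(H)$ such that $SAS^{-1}$ is self-adjoint. In fact, there is a family $\{V_\lambda:\lambda\in\Lambda\}$ of Hilbert spaces and a family $\{n_\lambda:\lambda\in\Lambda\}$ of positive integers such that $A\cong\sum^{\ell^\infty}_{\lambda\in\Lambda}\mathcal B(V_\lambda)\otimes 1_{n_\lambda}$.
   Context: $\mathcal K(H)$ is the algebra of compact operators on $H$. A set $B\subseteq\mathcal B(H)$ acts nondegenerately on $H$ if the closed linear span of $\{b\xi:b\in B,\xi\in H\}$ is $H$. Let $H^{(\infty)}=H\otimes_2\ell^2(\mathbb N)$ be the Hilbert space of square-summable sequences in $H$, with $A$ acting by $a\cdot(\xi_i)_i=(a\xi_i)_i$. A submodule is a norm-closed $A$-invariant subspace. $A$ has the complete reduction property if for every submodule $V\subseteq H^{(\infty)}$ there is a submodule $W\subseteq H^{(\infty)}$ with $H^{(\infty)}=V\oplus W$ (direct sum, not necessarily orthogonal). The algebra $\mathcal B(V)\otimes 1_n$ is $\{T\otimes 1_n:T\in\mathcal B(V)\}\subseteq\mathcal B(V\otimes_2\mathbb C^n)$. $\sum^{\ell^\infty}_\lambda A_\lambda$ is the algebra of bounded families $(a_\lambda)$, $a_\lambda\in A_\lambda$, with supremum norm and pointwise operations. $\cong$ denotes isomorphism of Banach algebras (bicontinuous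 algebra isomorphism). *)

theory Defs
  imports "HOL-Analysis.Analysis"
begin

class complex_vector = real_vector +
  fixes scaleC :: "complex \<Rightarrow> 'a \<Rightarrow> 'a"  (infixr \<open>*\<^sub>C\<close> 75)
  assumes scaleC_add_right: "c *\<^sub>C (x + y) = c *\<^sub>C x + c *\<^sub>C y"
    and scaleC_add_left: "(c + d) *\<^sub>C x = c *\<^sub>C x + d *\<^sub>C x"
    and scaleC_scaleC: "c *\<^sub>C d *\<^sub>C x = (c * d) *\<^sub>C x"
    and scaleC_one: "1 *\<^sub>C x = x"
    and scaleR_scaleC: "r *\<^sub>R x = complex_of_real r *\<^sub>C x"

global_interpretation complex_vector: vector_space "scaleC :: complex \<Rightarrow> 'a \<Rightarrow> 'a::complex_vector"
  defines csubspace = complex_vector.subspace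
    and cspan = complex_vector.span
  by unfold_locales (rule scaleC_add_right scaleC_add_left scaleC_scaleC scaleC_one)+

text \<open>The inner product is linear in its first argument. Norm and topology are those of the
  underlying real inner product space, whose inner product is the real part.\<close>

class complex_inner = complex_vector + real_inner +
  fixes cinner :: "'a \<Rightarrow> 'a \<Rightarrow> complex"
  assumes cinner_commute: "cinner x y = cnj (cinner y x)"
    and cinner_add_left: "cinner (x + y) z = cinner x z + cinner y z"
    and cinner_scaleC_left: "cinner (c *\<^sub>C x) y = c * cinner x y"
    and Re_cinner: "Re (cinner x y) = inner x y"

class chilbert_space = complex_inner + complete_space

lemma norm_scaleC: "norm (c *\<^sub>C x) = cmod c * norm (x :: 'a::complex_inner)"
proof -
  have "cinner (c *\<^sub>C x) (c *\<^sub>C x) = c * cnj c * cinner x x"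
    by (subst cinner_scaleC_left, subst cinner_commute, subst cinner_scaleC_left)
      (simp add: cinner_commute[of x x, symmetric])
  also have "c * cnj c = complex_of_real ((cmod c)\<^sup>2)"
    by (rule complex_norm_square[symmetric])
  finally have "Re (cinner (c *\<^sub>C x) (c *\<^sub>C x)) = (cmod c)\<^sup>2 * Re (cinner x x)"
    by (simp del: of_real_power)
  then show ?thesis
    by (simp add: Re_cinner norm_eq_sqrt_inner real_sqrt_mult)
qed


lemma norm_cinner_le: "cmod (cinner x y) \<le> (norm x)\<^sup>2 + (norm y)\<^sup>2"
proof -
  have "Re (cinner ((- \<i>) *\<^sub>C x) y) = Im (cinner x y)"
    by (simp only: cinner_scaleC_left) simp
  then have "Im (cinner x y) = inner ((- \<i>) *\<^sub>C x) y"
    by (simp only: Re_cinner)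
  then have "\<bar>Im (cinner x y)\<bar> \<le> norm x * norm y"
    using Cauchy_Schwarz_ineq2[of "(- \<i>) *\<^sub>C x" y] by (simp add: norm_scaleC)
  moreover have "\<bar>Re (cinner x y)\<bar> \<le> norm x * norm y"
    by (simp add: Re_cinner Cauchy_Schwarz_ineq2)
  moreover have "2 * (norm x * norm y) \<le> (norm x)\<^sup>2 + (norm y)\<^sup>2"
    using sum_squares_bound[of "norm x" "norm y"] by simp
  ultimately show ?thesis
    using cmod_le[of "cinner x y"] by linarith
qed

typedef (overloaded) 'a ell2 = "{f :: nat \<Rightarrow> 'a::complex_inner. summable (\<lambda>i. (norm (f i))\<^sup>2)}"
  morphisms ell2_nth Abs_ell2
  by (rule exI[of _ "\<lambda>_. 0"]) simp

setup_lifting type_definition_ell2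

lemma summable_ell2_add:
  fixes f g :: "nat \<Rightarrow> 'a::complex_inner"
  assumes "summable (\<lambda>i. (norm (f i))\<^sup>2)" "summable (\<lambda>i. (norm (g i))\<^sup>2)"
  shows "summable (\<lambda>i. (norm (f i + g i))\<^sup>2)"
proof (rule summable_comparison_test')
  show "summable (\<lambda>i. 2 * (norm (f i))\<^sup>2 + 2 * (norm (g i))\<^sup>2)"
    by (intro summable_add summable_mult assms)
  fix i
  have "(norm (f i + g i))\<^sup>2 \<le> (norm (f i) + norm (g i))\<^sup>2"
    by (simp add: norm_triangle_ineq power_mono)
  also have "\<dots> \<le> 2 * (norm (f i))\<^sup>2 + 2 * (norm (g i))\<^sup>2"
    using sum_squares_bound[of "norm (f i)" "norm (g i)"] by (simp add: power2_sum)
  finally show "norm ((norm (f i + g i))\<^sup>2) \<le> 2 * (norm (f i))\<^sup>2 + 2 * (norm (g i))\<^sup>2"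
    by simp
qed

lemma summable_ell2_scaleC:
  fixes f :: "nat \<Rightarrow> 'a::complex_inner"
  assumes "summable (\<lambda>i. (norm (f i))\<^sup>2)"
  shows "summable (\<lambda>i. (norm (c *\<^sub>C f i))\<^sup>2)"
  using assms by (simp add: norm_scaleC power_mult_distrib summable_mult)

lemma summable_ell2_cinner:
  fixes f g :: "nat \<Rightarrow> 'a::complex_inner"
  assumes "summable (\<lambda>i. (norm (f i))\<^sup>2)" "summable (\<lambda>i. (norm (g i))\<^sup>2)"
  shows "summable (\<lambda>i. cinner (f i) (g i))"
  by (rule summable_comparison_test'[OF summable_add[OF assms]]) (rule norm_cinner_le)

lemma summable_ell2_inner:
  fixes f g :: "nat \<Rightarrow> 'a::complex_inner"
  assumes "summable (\<lambda>i. (norm (f i))\<^sup>2)" "summable (\<lambda>i. (norm (g i))\<^sup>2)"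
  shows "summable (\<lambda>i. inner (f i) (g i))"
  using summable_Re[OF summable_ell2_cinner[OF assms]] by (simp add: Re_cinner)

instantiation ell2 :: (complex_inner) complex_inner
begin

lift_definition zero_ell2 :: "'a ell2" is "\<lambda>_. 0" by simp

lift_definition plus_ell2 :: "'a ell2 \<Rightarrow> 'a ell2 \<Rightarrow> 'a ell2" is "\<lambda>f g i. f i + g i"
  by (rule summable_ell2_add)

lift_definition uminus_ell2 :: "'a ell2 \<Rightarrow> 'a ell2" is "\<lambda>f i. - f i" by simp

lift_definition minus_ell2 :: "'a ell2 \<Rightarrow> 'a ell2 \<Rightarrow> 'a ell2" is "\<lambda>f g i. f i - g i"
  using summable_ell2_add[of _ "\<lambda>i. - _ i"] by simp

lift_definition scaleC_ell2 :: "complex \<Rightarrow> 'a ell2 \<Rightarrow> 'a ell2" is "\<lambda>c f i. c *\<^sub>C f i"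
  by (rule summable_ell2_scaleC)

lift_definition scaleR_ell2 :: "real \<Rightarrow> 'a ell2 \<Rightarrow> 'a ell2" is "\<lambda>r f i. r *\<^sub>R f i"
  by (simp add: power_mult_distrib summable_mult)

definition cinner_ell2 :: "'a ell2 \<Rightarrow> 'a ell2 \<Rightarrow> complex"
  where "cinner_ell2 x y = (\<Sum>i. cinner (ell2_nth x i) (ell2_nth y i))"

definition inner_ell2 :: "'a ell2 \<Rightarrow> 'a ell2 \<Rightarrow> real"
  where "inner_ell2 x y = (\<Sum>i. inner (ell2_nth x i) (ell2_nth y i))"

definition norm_ell2 :: "'a ell2 \<Rightarrow> real"
  where "norm_ell2 x = sqrt (inner x x)"

definition sgn_ell2 :: "'a ell2 \<Rightarrow> 'a ell2"
  where "sgn_ell2 x = scaleR (inverse (norm x)) x"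

definition dist_ell2 :: "'a ell2 \<Rightarrow> 'a ell2 \<Rightarrow> real"
  where "dist_ell2 x y = norm (x - y)"

definition [code del]:
  "(uniformity :: ('a ell2 \<times> 'a ell2) filter) = (INF e\<in>{0 <..}. principal {(x, y). dist x y < e})"

definition open_ell2 :: "'a ell2 set \<Rightarrow> bool"
  where [code del]: "open_ell2 S = (\<forall>x\<in>S. \<forall>\<^sub>F (x', y) in uniformity. x' = x \<longrightarrow> y \<in> S)"

instance
proof
  have sm: "summable (\<lambda>i. (norm (ell2_nth x i))\<^sup>2)" for x :: "'a ell2"
    using ell2_nth by auto
  note si = summable_ell2_inner[OF sm sm] and sc = summable_ell2_cinner[OF sm sm]
  fix x y z :: "'a ell2" and a b :: real and c d :: complex
  show "x + y + z = x + (y + z)" "x + y = y + x" "0 + x = x" "- x + x = 0" "x - y = x + - y"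
    by (transfer; simp add: fun_eq_iff algebra_simps)+
  show "a *\<^sub>R (x + y) = a *\<^sub>R x + a *\<^sub>R y" "(a + b) *\<^sub>R x = a *\<^sub>R x + b *\<^sub>R x"
    "a *\<^sub>R b *\<^sub>R x = (a * b) *\<^sub>R x" "1 *\<^sub>R x = x"
    by (transfer; simp add: fun_eq_iff algebra_simps)+
  show "c *\<^sub>C (x + y) = c *\<^sub>C x + c *\<^sub>C y" "(c + d) *\<^sub>C x = c *\<^sub>C x + d *\<^sub>C x"
    "c *\<^sub>C d *\<^sub>C x = (c * d) *\<^sub>C x" "1 *\<^sub>C x = x" "a *\<^sub>R x = complex_of_real a *\<^sub>C x"
    by (transfer; simp add: fun_eq_iff scaleC_add_right scaleC_add_left scaleC_scaleC scaleC_one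
        scaleR_scaleC)+
  show "sgn x = scaleR (inverse (norm x)) x" "dist x y = norm (x - y)" "norm x = sqrt (inner x x)"
    by (simp_all add: sgn_ell2_def dist_ell2_def norm_ell2_def)
  show "(uniformity :: ('a ell2 \<times> 'a ell2) filter) = (INF e\<in>{0 <..}. principal {(x, y). dist x y < e})"
    by (fact uniformity_ell2_def)
  show "open U = (\<forall>x\<in>U. \<forall>\<^sub>F (x', y) in uniformity. x' = x \<longrightarrow> y \<in> U)" for U :: "'a ell2 set"
    by (fact open_ell2_def)
  show "inner x y = inner y x"
    by (simp add: inner_ell2_def inner_commute)
  show "inner (x + y) z = inner x z + inner y z"
    by (simp add: inner_ell2_def plus_ell2.rep_eq inner_add_left suminf_add[OF si si])
  show "inner (a *\<^sub>R x) y = a * inner x y"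
    by (simp add: inner_ell2_def scaleR_ell2.rep_eq suminf_mult[OF si])
  show "0 \<le> inner x x"
    by (simp add: inner_ell2_def suminf_nonneg[OF si])
  show "inner x x = 0 \<longleftrightarrow> x = 0"
    by (simp add: inner_ell2_def suminf_eq_zero_iff[OF si] zero_ell2.rep_eq fun_eq_iff
        flip: ell2_nth_inject)
  show "cinner x y = cnj (cinner y x)"
  proof -
    have "(\<lambda>i. cnj (cinner (ell2_nth y i) (ell2_nth x i))) sums cnj (cinner y x)"
      unfolding cinner_ell2_def sums_cnj by (rule summable_sums[OF sc])
    then show ?thesis
      unfolding cinner_ell2_def[of x y] by (simp add: sums_iff flip: cinner_commute)
  qed
  show "cinner (x + y) z = cinner x z + cinner y z"
    by (simp add: cinner_ell2_def plus_ell2.rep_eq cinner_add_left suminf_add[OF sc sc])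
  show "cinner (c *\<^sub>C x) y = c * cinner x y"
    by (simp add: cinner_ell2_def scaleC_ell2.rep_eq cinner_scaleC_left suminf_mult[OF sc])
  show "Re (cinner x y) = inner x y"
    by (simp add: cinner_ell2_def inner_ell2_def Re_suminf[OF sc] Re_cinner)
qed

end

lemma summable_ell2_nth: "summable (\<lambda>i. (norm (ell2_nth x i))\<^sup>2)"
  using ell2_nth by auto

lemma norm_ell2_eq: "norm x = sqrt (\<Sum>i. (norm (ell2_nth x i))\<^sup>2)"
  by (simp add: norm_ell2_def inner_ell2_def power2_norm_eq_inner)

lemma sum_norm_ell2_le: "(\<Sum>i<k. (norm (ell2_nth x i))\<^sup>2) \<le> (norm x)\<^sup>2"
  by (simp add: norm_ell2_eq suminf_nonneg summable_ell2_nth sum_le_suminf)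

lemma norm_ell2_nth_le: "norm (ell2_nth x i) \<le> norm x"
proof (rule power2_le_imp_le)
  have "(norm (ell2_nth x i))\<^sup>2 \<le> (\<Sum>j<Suc i. (norm (ell2_nth x j))\<^sup>2)"
    by (simp add: sum_nonneg)
  then show "(norm (ell2_nth x i))\<^sup>2 \<le> (norm x)\<^sup>2"
    using sum_norm_ell2_le[of x "Suc i"] by linarith
qed simp

instance ell2 :: (chilbert_space) chilbert_space
proof
  fix X :: "nat \<Rightarrow> 'a ell2"
  assume X: "Cauchy X"
  have "Cauchy (\<lambda>n. ell2_nth (X n) i)" for i
  proof (rule metric_CauchyI)
    fix e :: real
    assume "0 < e"
    then obtain N where N: "\<And>m n. m \<ge> N \<Longrightarrow> n \<ge> N \<Longrightarrow> norm (X m - X n) < e"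
      using metric_CauchyD[OF X] unfolding dist_norm by meson
    have "dist (ell2_nth (X m) i) (ell2_nth (X n) i) < e" if "m \<ge> N" "n \<ge> N" for m n
      using le_less_trans[OF norm_ell2_nth_le[of "X m - X n" i] N[OF that]]
      by (simp add: dist_norm minus_ell2.rep_eq)
    then show "\<exists>N. \<forall>m\<ge>N. \<forall>n\<ge>N. dist (ell2_nth (X m) i) (ell2_nth (X n) i) < e" by blast
  qed
  then have "\<forall>i. \<exists>l. (\<lambda>n. ell2_nth (X n) i) \<longlonglongrightarrow> l"
    using Cauchy_convergent convergent_def by blast
  then obtain l where l: "\<And>i. (\<lambda>n. ell2_nth (X n) i) \<longlonglongrightarrow> l i"
    by metis
  have bound: "\<exists>N. \<forall>m\<ge>N. \<forall>k. (\<Sum>i<k. (norm (ell2_nth (X m) i - l i))\<^sup>2) \<le> e\<^sup>2"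
    if e: "0 < e" for e :: real
  proof -
    obtain N where N: "\<And>m n. m \<ge> N \<Longrightarrow> n \<ge> N \<Longrightarrow> norm (X m - X n) < e"
      using metric_CauchyD[OF X e] unfolding dist_norm by meson
    have "(\<Sum>i<k. (norm (ell2_nth (X m) i - l i))\<^sup>2) \<le> e\<^sup>2" if m: "m \<ge> N" for m k
    proof (rule tendsto_upperbound)
      show "(\<lambda>n. \<Sum>i<k. (norm (ell2_nth (X m) i - ell2_nth (X n) i))\<^sup>2)
          \<longlonglongrightarrow> (\<Sum>i<k. (norm (ell2_nth (X m) i - l i))\<^sup>2)"
        by (intro tendsto_intros l)
      have "(\<Sum>i<k. (norm (ell2_nth (X m) i - ell2_nth (X n) i))\<^sup>2) \<le> e\<^sup>2" if "n \<ge> N" for n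
      proof -
        have "(norm (X m - X n))\<^sup>2 \<le> e\<^sup>2"
          using N[OF m that] by (simp add: power_mono)
        then show ?thesis
          using sum_norm_ell2_le[of "X m - X n" k] by (simp add: minus_ell2.rep_eq)
      qed
      then show "\<forall>\<^sub>F n in sequentially. (\<Sum>i<k. (norm (ell2_nth (X m) i - ell2_nth (X n) i))\<^sup>2) \<le> e\<^sup>2"
        using eventually_sequentially by blast
    qed simp
    then show ?thesis by blast
  qed
  have diff: "summable (\<lambda>i. (norm (ell2_nth (X m) i - l i))\<^sup>2)"
    if "\<forall>k. (\<Sum>i<k. (norm (ell2_nth (X m) i - l i))\<^sup>2) \<le> e\<^sup>2" for m and e :: real
    using that by (intro summableI_nonneg_bounded[where x = "e\<^sup>2"]) auto
  obtain N1 where "\<forall>k. (\<Sum>i<k. (norm (ell2_nth (X N1) i - l i))\<^sup>2) \<le> 1\<^sup>2"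
    using bound[of 1] by auto
  from diff[OF this] have "summable (\<lambda>i. (norm (- (ell2_nth (X N1) i - l i)))\<^sup>2)"
    by (simp only: norm_minus_cancel)
  from summable_ell2_add[OF summable_ell2_nth[of "X N1"] this]
  have "summable (\<lambda>i. (norm (l i))\<^sup>2)" by simp
  then obtain L where L: "ell2_nth L = l"
    using Abs_ell2_inverse by blast
  have "X \<longlonglongrightarrow> L"
  proof (rule metric_LIMSEQ_I)
    fix e :: real
    assume "0 < e"
    then obtain N where N: "\<forall>m\<ge>N. \<forall>k. (\<Sum>i<k. (norm (ell2_nth (X m) i - l i))\<^sup>2) \<le> (e / 2)\<^sup>2"
      using bound[of "e / 2"] by auto
    have "dist (X m) L < e" if "m \<ge> N" for m
    proof -
      have "(\<Sum>i. (norm (ell2_nth (X m - L) i))\<^sup>2) \<le> (e / 2)\<^sup>2"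
        using N that by (intro suminf_le_const summable_ell2_nth) (simp add: minus_ell2.rep_eq L)
      then have "norm (X m - L) \<le> e / 2"
        using \<open>0 < e\<close> unfolding norm_ell2_eq by (intro real_le_lsqrt) (auto simp: real_sqrt_le_iff)
      then show ?thesis using \<open>0 < e\<close> by (simp add: dist_norm)
    qed
    then show "\<exists>N. \<forall>m\<ge>N. dist (X m) L < e" by blast
  qed
  then show "convergent X" by (rule convergentI)
qed

lemma bounded_linear_scaleC_right: "bounded_linear (\<lambda>x :: 'a::complex_inner. c *\<^sub>C x)"
  by (rule bounded_linear_intro[where K = "cmod c"])
    (simp_all add: scaleC_add_right scaleR_scaleC scaleC_scaleC norm_scaleC mult.commute)

instantiation blinfun :: (real_normed_vector, complex_inner) complex_vector
begin

lift_definition scaleC_blinfun :: "complex \<Rightarrow> 'a \<Rightarrow>\<^sub>L 'b \<Rightarrow> 'a \<Rightarrow>\<^sub>L 'b" is "\<lambda>c f x. c *\<^sub>C f x"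
  by (rule bounded_linear_compose[OF bounded_linear_scaleC_right])

instance
  by standard (transfer; simp add: fun_eq_iff scaleC_add_right scaleC_add_left scaleC_scaleC
      scaleC_one scaleR_scaleC)+

end

text \<open>The type \<open>'a \<Rightarrow>\<^sub>L 'a\<close> consists of the bounded real-linear maps, with the operator norm;
  \<open>bounded_ops\<close> is its subset of complex-linear maps, that is, \<open>\<B>(H)\<close>.\<close>

definition bounded_ops :: "('a::complex_inner \<Rightarrow>\<^sub>L 'a) set"
  where "bounded_ops = {T. \<forall>c x. blinfun_apply T (c *\<^sub>C x) = c *\<^sub>C blinfun_apply T x}"

definition compact_ops :: "('a::complex_inner \<Rightarrow>\<^sub>L 'a) set"
  where "compact_ops = {T \<in> bounded_ops. compact (closure (blinfun_apply T ` cball 0 1))}"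

definition subalgebra :: "('a::complex_inner \<Rightarrow>\<^sub>L 'a) set \<Rightarrow> bool"
  where "subalgebra A \<longleftrightarrow> A \<subseteq> bounded_ops \<and> csubspace A \<and> (\<forall>a\<in>A. \<forall>b\<in>A. a o\<^sub>L b \<in> A)"

definition is_adjoint :: "('a::complex_inner \<Rightarrow>\<^sub>L 'a) \<Rightarrow> ('a \<Rightarrow>\<^sub>L 'a) \<Rightarrow> bool"
  where "is_adjoint T T' \<longleftrightarrow> (\<forall>x y. cinner (T x) y = cinner x (T' y))"

definition self_adjoint :: "('a::complex_inner \<Rightarrow>\<^sub>L 'a) set \<Rightarrow> bool"
  where "self_adjoint B \<longleftrightarrow> (\<forall>T\<in>B. \<exists>T'\<in>B. is_adjoint T T')"

definition nondegenerate :: "('a::complex_inner \<Rightarrow>\<^sub>L 'a) set \<Rightarrow> bool"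
  where "nondegenerate B \<longleftrightarrow> closure (cspan {blinfun_apply b x | b x. b \<in> B}) = UNIV"

text \<open>The \<open>\<sigma>\<close>-weak topology on \<open>\<B>(H)\<close> is the coarsest one for which all functionals
  \<open>T \<mapsto> \<Sum>i. \<langle>T x\<^sub>i, y\<^sub>i\<rangle>\<close> with square-summable \<open>x\<close> and \<open>y\<close> are continuous.\<close>

definition sigma_weak_functional :: "'a::complex_inner ell2 \<Rightarrow> 'a ell2 \<Rightarrow> ('a \<Rightarrow>\<^sub>L 'a) \<Rightarrow> complex"
  where "sigma_weak_functional x y T = (\<Sum>i. cinner (T (ell2_nth x i)) (ell2_nth y i))"

definition sigma_weak_topology :: "('a::complex_inner \<Rightarrow>\<^sub>L 'a) topology"
  where "sigma_weak_topology = topology_generated_by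
    {{T \<in> bounded_ops. sigma_weak_functional x y T \<in> U} | x y U. open U}"

lift_definition ampliation :: "('a::complex_inner \<Rightarrow>\<^sub>L 'a) \<Rightarrow> 'a ell2 \<Rightarrow> 'a ell2"
  is "\<lambda>T f i. blinfun_apply T (f i)"
proof -
  fix T :: "'a \<Rightarrow>\<^sub>L 'a" and f :: "nat \<Rightarrow> 'a"
  assume f: "summable (\<lambda>i. (norm (f i))\<^sup>2)"
  show "summable (\<lambda>i. (norm (blinfun_apply T (f i)))\<^sup>2)"
  proof (rule summable_comparison_test'[OF summable_mult[OF f, of "(norm T)\<^sup>2"]])
    show "norm ((norm (blinfun_apply T (f i)))\<^sup>2) \<le> (norm T)\<^sup>2 * (norm (f i))\<^sup>2" for i
      using power_mono[OF norm_blinfun[of T "f i"], of 2] by (simp add: power_mult_distrib)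
  qed
qed

definition submodule :: "('a::complex_inner \<Rightarrow>\<^sub>L 'a) set \<Rightarrow> 'a ell2 set \<Rightarrow> bool"
  where "submodule A V \<longleftrightarrow> csubspace V \<and> closed V \<and> (\<forall>a\<in>A. \<forall>x\<in>V. ampliation a x \<in> V)"

definition complete_reduction_property :: "('a::complex_inner \<Rightarrow>\<^sub>L 'a) set \<Rightarrow> bool"
  where "complete_reduction_property A \<longleftrightarrow>
    (\<forall>V. submodule A V \<longrightarrow> (\<exists>W. submodule A W \<and> V \<inter> W = {0} \<and> {v + w | v w. v \<in> V \<and> w \<in> W} = UNIV))"

text \<open>HOL has no existential quantification over types, so a family of Hilbert spaces is
  represented by a family of closed subspaces of a given one, with the induced structure.
  Operators on a subspace \<open>X\<close> are represented by functions on the ambient type that take the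
  value \<open>undefined\<close> outside \<open>X\<close>, so that equality of functions is equality on \<open>X\<close>.\<close>

definition bounded_ops_on :: "'a::complex_inner set \<Rightarrow> ('a \<Rightarrow> 'a) set"
  where "bounded_ops_on X = {T \<in> X \<rightarrow>\<^sub>E X.
    (\<forall>x\<in>X. \<forall>y\<in>X. T (x + y) = T x + T y) \<and> (\<forall>c. \<forall>x\<in>X. T (c *\<^sub>C x) = c *\<^sub>C T x) \<and>
    (\<exists>K. \<forall>x\<in>X. norm (T x) \<le> K * norm x)}"

definition op_norm_on :: "'a::complex_inner set \<Rightarrow> ('a \<Rightarrow> 'a) \<Rightarrow> real"
  where "op_norm_on X T = (SUP x\<in>{x \<in> X. norm x \<le> 1}. norm (T x))"

text \<open>\<open>V \<otimes>\<^sub>2 \<complex>\<^sup>n\<close> is the space of \<open>n\<close>-tuples in \<open>V\<close>, realised as sequences that vanish from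
  index \<open>n\<close> on; \<open>T \<otimes> 1\<^sub>n\<close> acts on it entrywise.\<close>

definition tensor_space :: "'a::complex_inner set \<Rightarrow> nat \<Rightarrow> 'a ell2 set"
  where "tensor_space V n = {x. (\<forall>i<n. ell2_nth x i \<in> V) \<and> (\<forall>i\<ge>n. ell2_nth x i = 0)}"

definition tensor_id :: "'a::complex_inner set \<Rightarrow> nat \<Rightarrow> ('a \<Rightarrow> 'a) \<Rightarrow> 'a ell2 \<Rightarrow> 'a ell2"
  where "tensor_id V n T =
    restrict (\<lambda>x. Abs_ell2 (\<lambda>i. if i < n then T (ell2_nth x i) else 0)) (tensor_space V n)"

definition tensor_algebra :: "'a::complex_inner set \<Rightarrow> nat \<Rightarrow> ('a ell2 \<Rightarrow> 'a ell2) set"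
  where "tensor_algebra V n = tensor_id V n ` bounded_ops_on V"

text \<open>The \<open>\<ell>\<^sup>\<infinity>\<close>-sum of algebras \<open>B l\<close> of operators on the spaces \<open>X l\<close>. Inserting \<open>0\<close> in the
  supremum only matters for the empty index set.\<close>

definition linf_sum ::
    "'i set \<Rightarrow> ('i \<Rightarrow> 'b::complex_inner set) \<Rightarrow> ('i \<Rightarrow> ('b \<Rightarrow> 'b) set) \<Rightarrow> ('i \<Rightarrow> 'b \<Rightarrow> 'b) set"
  where "linf_sum \<Lambda> X B = {a \<in> Pi\<^sub>E \<Lambda> B. bdd_above ((\<lambda>l. op_norm_on (X l) (a l)) ` \<Lambda>)}"

definition linf_norm ::
    "'i set \<Rightarrow> ('i \<Rightarrow> 'b::complex_inner set) \<Rightarrow> ('i \<Rightarrow> 'b \<Rightarrow> 'b) \<Rightarrow> real"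
  where "linf_norm \<Lambda> X a = Sup (insert 0 ((\<lambda>l. op_norm_on (X l) (a l)) ` \<Lambda>))"

text \<open>The operations of the sum are pointwise. The last two conditions express continuity of the
  linear map \<open>\<Phi>\<close> and of its inverse.\<close>

definition linf_sum_isomorphism ::
    "('a::complex_inner \<Rightarrow>\<^sub>L 'a) set \<Rightarrow> 'i set \<Rightarrow> ('i \<Rightarrow> 'b::complex_inner set) \<Rightarrow>
      ('i \<Rightarrow> ('b \<Rightarrow> 'b) set) \<Rightarrow> (('a \<Rightarrow>\<^sub>L 'a) \<Rightarrow> 'i \<Rightarrow> 'b \<Rightarrow> 'b) \<Rightarrow> bool"
  where "linf_sum_isomorphism A \<Lambda> X B \<Phi> \<longleftrightarrow>
    bij_betw \<Phi> A (linf_sum \<Lambda> X B) \<and>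
    (\<forall>a\<in>A. \<forall>b\<in>A. \<forall>l\<in>\<Lambda>. \<forall>x\<in>X l. \<Phi> (a + b) l x = \<Phi> a l x + \<Phi> b l x) \<and>
    (\<forall>c. \<forall>a\<in>A. \<forall>l\<in>\<Lambda>. \<forall>x\<in>X l. \<Phi> (c *\<^sub>C a) l x = c *\<^sub>C \<Phi> a l x) \<and>
    (\<forall>a\<in>A. \<forall>b\<in>A. \<forall>l\<in>\<Lambda>. \<forall>x\<in>X l. \<Phi> (a o\<^sub>L b) l x = \<Phi> a l (\<Phi> b l x)) \<and>
    (\<exists>K. \<forall>a\<in>A. linf_norm \<Lambda> X (\<Phi> a) \<le> K * norm a) \<and>
    (\<exists>K. \<forall>a\<in>A. norm a \<le> K * linf_norm \<Lambda> X (\<Phi> a))"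

end

theory Submission
  imports Defs "HOL-Computational_Algebra.Fundamental_Theorem_Algebra"
begin

text \<open>Direct sums of submodules of \<open>H\<^sup>\<infinity>\<close> are again submodules of \<open>H\<^sup>\<infinity>\<close>, so that the complete reduction
  property yields projections onto all submodules, commuting with \<open>A\<close> and bounded by one constant
  \<open>K\<close>. Applied to cyclic submodules this gives \<open>A = A''\<close>, and applied to graphs of \<open>t b\<close> with \<open>b\<close> in
  the commutant \<open>B\<close> it gives that projections onto \<open>A \<union> B\<close>-invariant subspaces are central. Compactness
  produces minimal \<open>A \<union> B\<close>-invariant subspaces \<open>N\<close>, whose algebraic sum is dense. Each of them contains an
  irreducible submodule \<open>V\<close>: otherwise every finite set of compact elements of \<open>A\<close> would have joint
  spectral radius zero on \<open>N\<close>, contrary to Lomonosov's theorem. By Schur's lemma \<open>N\<close> is isomorphic to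
  \<open>V\<^sup>n\<close> with \<open>n\<close> finite, and projections onto graphs of \<open>t R\<close>, for \<open>R : V\<^sup>n \<rightarrow> N\<close> and suitable \<open>t\<close>, bound
  \<open>R\<close> and its inverse in terms of \<open>K\<close>. Hence the inner products of the \<open>V\<^sup>n\<close> add up to an equivalent inner
  product on \<open>H\<close>, for which \<open>A\<close> consists of all bounded families of operators \<open>\<tau> \<otimes> 1\<close> and so is
  self-adjoint; the square root of its Gram operator is the similarity.\<close>

section \<open>Complex inner product spaces\<close>

text \<open>Scaling drives the estimates: the graph of \<open>t b\<close> can be stretched at will,
  while the norm of a projection onto it stays below \<open>K\<close>. Letting \<open>t\<close> grow
  forces a corner p b (1 - p) to vanish; a fixed \<open>t\<close> gives numerical bounds. Infinitely
  many isotypic components are treated at once, so no constant may depend on a component; a separate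
  bound for each projection would not do. Uniqueness of a central projection with given range makes
  \<open>K\<close> bound every finite sum of such projections too, and a choice of signs turns this
  into estimates between the norm of x and the square sums of its components. The other obstacle is
  that Lomonosov's theorem on N applies to the operators generated by \<open>A\<close> and its
  commutant, not to \<open>A\<close> alone: it yields a fixed vector of a sum of terms a b k. As b
  commutes with a and k, powers of this sum only involve words in the compact elements a k, and the
  joint spectral radius measures their growth. Compactness also bounds multiplicities: the vectors
  fixed by a compact element of \<open>A\<close> form a finite-dimensional space that the commutant
  preserves.\<close>

lemma cinner_add_right: "cinner x (y + z) = cinner x y + cinner x z"
  by (subst (1 2 3) cinner_commute) (simp add: cinner_add_left)

lemma cinner_scaleC_right: "cinner x (c *\<^sub>C y) = cnj c * cinner x y"
  by (subst (1 2) cinner_commute) (simp add: cinner_scaleC_left)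

lemma cinner_minus_left: "cinner (- x) y = - cinner x y"
  using cinner_scaleC_left[of "- 1" x y] by simp

lemma cinner_minus_right: "cinner x (- y) = - cinner x y"
  using cinner_scaleC_right[of x "- 1" y] by simp

lemma cinner_diff_left: "cinner (x - y) z = cinner x z - cinner y z"
  using cinner_add_left[of x "- y" z] by (simp add: cinner_minus_left)

lemma cinner_diff_right: "cinner x (y - z) = cinner x y - cinner x z"
  using cinner_add_right[of x y "- z"] by (simp add: cinner_minus_right)

lemma cinner_zero_left [simp]: "cinner 0 y = 0"
  using cinner_scaleC_left[of 0 0 y] by simp

lemma cinner_zero_right [simp]: "cinner x 0 = 0"
  using cinner_scaleC_right[of x 0 0] by simp

lemma cinner_sum_left: "cinner (\<Sum>i\<in>I. f i) y = (\<Sum>i\<in>I. cinner (f i) y)"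
  by (induction I rule: infinite_finite_induct) (simp_all add: cinner_add_left)

lemma cinner_sum_right: "cinner x (\<Sum>i\<in>I. f i) = (\<Sum>i\<in>I. cinner x (f i))"
  by (induction I rule: infinite_finite_induct) (simp_all add: cinner_add_right)

lemma cinner_same: "cinner x x = complex_of_real ((norm x)\<^sup>2)"
proof (rule complex_eqI)
  show "Re (cinner x x) = Re (complex_of_real ((norm x)\<^sup>2))"
    by (simp add: Re_cinner power2_norm_eq_inner)
  have "Im (cinner x x) = - Im (cinner x x)"
    by (subst cinner_commute) simp
  then show "Im (cinner x x) = Im (complex_of_real ((norm x)\<^sup>2))"
    by simp
qed

lemma Im_cinner: "Im (cinner x y) = inner x (\<i> *\<^sub>C y)"
  by (simp add: cinner_scaleC_right flip: Re_cinner)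

lemma inner_i_left: "inner (\<i> *\<^sub>C x) y = - inner x (\<i> *\<^sub>C (y :: 'a::complex_inner))"
  unfolding Re_cinner[symmetric] by (simp only: cinner_scaleC_right cinner_scaleC_left) simp

lemma norm_cinner: "cmod (cinner x y) \<le> norm x * norm y"
proof (cases "cinner x y = 0")
  case False
  define c where "c = cnj (cinner x y) / cmod (cinner x y)"
  have c: "cmod c = 1"
    using False by (simp add: c_def norm_divide)
  have "cinner (c *\<^sub>C x) y = complex_of_real (cmod (cinner x y))"
    using False by (simp add: cinner_scaleC_left c_def mult.commute[of "cnj _"] power2_eq_square
        flip: complex_norm_square)
  then have "cmod (cinner x y) = inner (c *\<^sub>C x) y"
    by (simp flip: Re_cinner)
  also have "\<dots> \<le> norm (c *\<^sub>C x) * norm y"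
    by (rule norm_cauchy_schwarz)
  finally show ?thesis
    by (simp add: norm_scaleC c)
qed simp

lemma csubspace_imp_subspace: "csubspace S \<Longrightarrow> subspace S"
  unfolding subspace_def complex_vector.subspace_def
  by (metis scaleR_scaleC)

lemma csubspaceI:
  assumes "0 \<in> S" "\<And>x y. x \<in> S \<Longrightarrow> y \<in> S \<Longrightarrow> x + y \<in> S" "\<And>c x. x \<in> S \<Longrightarrow> c *\<^sub>C x \<in> S"
  shows "csubspace S"
  using assms by (rule complex_vector.subspaceI)

lemmas csubspace_0 = complex_vector.subspace_0
  and csubspace_add = complex_vector.subspace_add
  and csubspace_scale = complex_vector.subspace_scale
  and csubspace_diff = complex_vector.subspace_diff
  and csubspace_sum = complex_vector.subspace_sum

lemma csubspace_closure:
  fixes S :: "'a::complex_inner set"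
  assumes S: "csubspace S"
  shows "csubspace (closure S)"
proof (rule csubspaceI)
  show "0 \<in> closure S"
    using csubspace_0[OF S] closure_subset by blast
  show "x + y \<in> closure S" if xy: "x \<in> closure S" "y \<in> closure S" for x y
  proof -
    obtain X Y where "\<And>n. X n \<in> S" "X \<longlonglongrightarrow> x" "\<And>n. Y n \<in> S" "Y \<longlonglongrightarrow> y"
      using xy unfolding closure_sequential by metis
    then have "\<forall>n. X n + Y n \<in> S" "(\<lambda>n. X n + Y n) \<longlonglongrightarrow> x + y"
      using csubspace_add[OF S] by (auto intro: tendsto_add)
    then show ?thesis
      by (rule closure_sequential[THEN iffD2, OF exI, OF conjI])
  qed
  fix c and x assume "x \<in> closure S"
  have "(*\<^sub>C) c ` S \<subseteq> S"
    using csubspace_scale[OF S] by auto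
  then have "(*\<^sub>C) c ` closure S \<subseteq> closure S"
    using closure_subset by (intro image_closure_subset[OF linear_continuous_on[OF bounded_linear_scaleC_right]]) auto
  then show "c *\<^sub>C x \<in> closure S"
    using \<open>x \<in> closure S\<close> by blast
qed

section \<open>Complex-linear bounded operators\<close>

lemma bounded_opsI: "(\<And>c x. blinfun_apply T (c *\<^sub>C x) = c *\<^sub>C blinfun_apply T x) \<Longrightarrow> T \<in> bounded_ops"
  by (simp add: bounded_ops_def)

lemma bounded_opsD: "T \<in> bounded_ops \<Longrightarrow> blinfun_apply T (c *\<^sub>C x) = c *\<^sub>C blinfun_apply T x"
  by (simp add: bounded_ops_def)

lemma blinfun_scaleC_apply [simp]: "blinfun_apply (c *\<^sub>C T) x = c *\<^sub>C blinfun_apply T x"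
  by (simp add: scaleC_blinfun.rep_eq)

lemma bounded_ops_simps [simp]:
  "0 \<in> bounded_ops" "id_blinfun \<in> bounded_ops"
  "S \<in> bounded_ops \<Longrightarrow> T \<in> bounded_ops \<Longrightarrow> S + T \<in> bounded_ops"
  "S \<in> bounded_ops \<Longrightarrow> T \<in> bounded_ops \<Longrightarrow> S - T \<in> bounded_ops"
  "S \<in> bounded_ops \<Longrightarrow> T \<in> bounded_ops \<Longrightarrow> S o\<^sub>L T \<in> bounded_ops"
  "S \<in> bounded_ops \<Longrightarrow> c *\<^sub>C S \<in> bounded_ops"
  "S \<in> bounded_ops \<Longrightarrow> r *\<^sub>R S \<in> bounded_ops"
  by (auto simp: bounded_ops_def plus_blinfun.rep_eq minus_blinfun.rep_eq scaleC_add_right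
      scaleC_scaleC scaleR_blinfun.rep_eq scaleR_scaleC mult.commute complex_vector.scale_right_diff_distrib)

text \<open>The bounded inverse theorem for the map \<open>(v, w) \<mapsto> v + w\<close> from \<open>V \<times> W\<close>, obtained from the
  Baire category theorem by successive approximation.\<close>

lemma complement_bounded:
  fixes V W :: "'a::banach set"
  assumes V: "subspace V" "closed V" and W: "subspace W" "closed W"
    and disj: "V \<inter> W = {0}" and sum: "{v + w | v w. v \<in> V \<and> w \<in> W} = UNIV"
  shows "\<exists>K>0. \<forall>v\<in>V. \<forall>w\<in>W. norm v \<le> K * norm (v + w)"
proof -
  define C where "C n = {v + w | v w. v \<in> V \<and> w \<in> W \<and> norm v \<le> real n \<and> norm w \<le> real n}" for n
  have "\<exists>n. interior (closure (C n)) \<noteq> {}"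
  proof (rule ccontr)
    assume "\<not> ?thesis"
    then have "Met_TC.mtopology interior_of (\<Union> (range (\<lambda>n. closure (C n)))) = {}"
      by (intro Met_TC.metric_Baire_category_alt) (auto simp: mcomplete_iff_complete complete_UNIV)
    moreover have "x \<in> \<Union> (range (\<lambda>n. closure (C n)))" for x
    proof -
      obtain v w where vw: "v \<in> V" "w \<in> W" "x = v + w"
        using sum by blast
      obtain n where "max (norm v) (norm w) \<le> real n"
        using real_arch_simple by blast
      then have "x \<in> C n"
        using vw by (auto simp: C_def)
      then show ?thesis
        using closure_subset by blast
    qed
    then have "\<Union> (range (\<lambda>n. closure (C n))) = UNIV"
      by blast
    ultimately show False
      by simp
  qed
  then obtain n x0 r where r: "r > 0" "ball x0 r \<subseteq> closure (C n)"
    by (meson ex_in_conv mem_interior)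
  \<comment> \<open>\<open>M\<close> pays for rescaling: parts of members of \<open>C n\<close>
    differ by at most 2 n, and the factor 1 / s below is 2 norm z / r. The extra 1 keeps
    \<open>M\<close> positive for n = 0.\<close>
  define M where "M = (2 * real n + 1) * (2 / r)"
  have M: "M > 0"
    using r by (simp add: M_def)
  have approx: "\<exists>v\<in>V. \<exists>w\<in>W. norm v \<le> M * norm z \<and> norm w \<le> M * norm z \<and> norm (z - v - w) \<le> norm z / 2" for z
  proof (cases "z = 0")
    case True
    then show ?thesis
      using V W by (auto intro!: bexI[of _ 0] simp: subspace_0)
  next
    case False
    define s where "s = r / (2 * norm z)"
    have s: "s > 0" "norm (s *\<^sub>R z) = r / 2"
      using False r by (simp_all add: s_def)
    have "x0 \<in> closure (C n)" "x0 + s *\<^sub>R z \<in> closure (C n)"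
      using r s by (auto simp: dist_norm intro!: subsetD[OF r(2)])
    \<comment> \<open>Two errors of r / 8 add up to r / 4, half the norm r / 2 of
      \<open>s *\<^sub>R z\<close>; after division by s the remainder is at most half of
      \<open>z\<close>.\<close>
    then obtain a b where ab: "a \<in> C n" "dist a x0 < r / 8" "b \<in> C n" "dist b (x0 + s *\<^sub>R z) < r / 8"
      using r by (meson closure_approachable divide_pos_pos zero_less_numeral)
    obtain v1 w1 v2 w2 where vw: "v1 \<in> V" "w1 \<in> W" "v2 \<in> V" "w2 \<in> W" "a = v1 + w1" "b = v2 + w2"
      "norm v1 \<le> n" "norm w1 \<le> n" "norm v2 \<le> n" "norm w2 \<le> n"
      using ab by (auto simp: C_def)
    define v w where "v = (1 / s) *\<^sub>R (v2 - v1)" and "w = (1 / s) *\<^sub>R (w2 - w1)"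
    have mem: "v \<in> V" "w \<in> W"
      using V W vw by (auto simp: v_def w_def intro!: subspace_scale subspace_diff)
    have bnd: "norm ((1 / s) *\<^sub>R (y2 - y1)) \<le> M * norm z" if "norm y1 \<le> n" "norm y2 \<le> n" for y1 y2 :: 'a
    proof -
      have "norm (y2 - y1) \<le> 2 * real n + 1"
        using norm_triangle_ineq4[of y2 y1] that by linarith
      then have "norm ((1 / s) *\<^sub>R (y2 - y1)) \<le> (1 / s) * (2 * real n + 1)"
        using s(1) by (simp add: divide_right_mono)
      also have "\<dots> = M * norm z"
        using False r by (simp add: s_def M_def)
      finally show ?thesis .
    qed
    have "s *\<^sub>R z - (v2 - v1) - (w2 - w1) = (x0 + s *\<^sub>R z - b) - (x0 - a)"
      by (simp add: vw)
    also have "norm \<dots> \<le> r / 8 + r / 8"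
      using ab norm_triangle_ineq4[of "x0 + s *\<^sub>R z - b" "x0 - a"]
      by (simp add: dist_norm norm_minus_commute)
    finally have "norm (s *\<^sub>R z - (v2 - v1) - (w2 - w1)) \<le> r / 4"
      by simp
    then have "(1 / s) * norm (s *\<^sub>R z - (v2 - v1) - (w2 - w1)) \<le> (1 / s) * (r / 4)"
      using s(1) by (intro mult_left_mono) auto
    moreover have eq: "z - v - w = (1 / s) *\<^sub>R (s *\<^sub>R z - (v2 - v1) - (w2 - w1))"
      using s(1) by (simp add: v_def w_def algebra_simps)
    ultimately have "norm (z - v - w) \<le> (1 / s) * (r / 4)"
      unfolding eq norm_scaleR using s(1) by (simp only: abs_of_pos divide_pos_pos zero_less_one)
    also have "\<dots> = norm z / 2"
      using False r by (simp add: s_def)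
    finally show ?thesis
      using mem bnd[OF vw(7,9)] bnd[OF vw(8,10)] unfolding v_def[symmetric] w_def[symmetric] by blast
  qed
  then have "\<forall>z. \<exists>p. fst p \<in> V \<and> snd p \<in> W \<and> norm (fst p) \<le> M * norm z \<and> norm (snd p) \<le> M * norm z \<and>
      norm (z - fst p - snd p) \<le> norm z / 2"
    by fastforce
  then obtain g where g: "\<And>z. fst (g z) \<in> V" "\<And>z. snd (g z) \<in> W" "\<And>z. norm (fst (g z)) \<le> M * norm z"
      "\<And>z. norm (snd (g z)) \<le> M * norm z" "\<And>z. norm (z - fst (g z) - snd (g z)) \<le> norm z / 2"
    by metis
  have "norm v \<le> (2 * M) * norm (v + w)" if vw: "v \<in> V" "w \<in> W" for v w
  proof -
    \<comment> \<open>\<open>z k\<close> is the residual after k rounds. The corrections add up to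
      v' in V and w' in W with v' + w' = v + w; since V and W meet in 0 only, v = v' inherits the
      geometric bound.\<close>
    define z where "z = rec_nat (v + w) (\<lambda>_ z. z - fst (g z) - snd (g z))"
    have z0: "z 0 = v + w" and zS: "z (Suc k) = z k - fst (g (z k)) - snd (g (z k))" for k
      by (simp_all add: z_def)
    have zn: "norm (z k) \<le> norm (v + w) * (1 / 2) ^ k" for k
    proof (induction k)
      case (Suc k)
      then show ?case
        using g(5)[of "z k"] by (simp add: zS)
    qed (simp add: z0)
    have geo: "(\<lambda>k. M * norm (v + w) * (1 / 2) ^ k) sums (M * norm (v + w) * 2)"
      using sums_mult[OF geometric_sums[of "1 / 2 :: real"], of "M * norm (v + w)"] by simp
    have bd: "norm (fst (g (z k))) \<le> M * norm (v + w) * (1 / 2) ^ k"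
      "norm (snd (g (z k))) \<le> M * norm (v + w) * (1 / 2) ^ k" for k
      using order_trans[OF g(3) mult_left_mono[OF zn]] order_trans[OF g(4) mult_left_mono[OF zn]] M
      by (simp_all add: mult.assoc)
    have sv: "summable (\<lambda>k. fst (g (z k)))" and sw: "summable (\<lambda>k. snd (g (z k)))"
      using bd by (auto intro: summable_comparison_test'[OF sums_summable[OF geo]])
    have sn: "summable (\<lambda>k. norm (fst (g (z k))))"
      using bd by (auto intro: summable_comparison_test'[OF sums_summable[OF geo]])
    define v' w' where "v' = (\<Sum>k. fst (g (z k)))" and "w' = (\<Sum>k. snd (g (z k)))"
    have mem: "v' \<in> V" "w' \<in> W"
      unfolding v'_def w'_def
      by (rule closed_sequentially[OF V(2) _ summable_LIMSEQ[OF sv]] closed_sequentially[OF W(2) _ summable_LIMSEQ[OF sw]];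
          auto intro!: subspace_sum V W g)+
    have part: "(\<Sum>k<m. fst (g (z k))) + (\<Sum>k<m. snd (g (z k))) = v + w - z m" for m
      by (induction m) (auto simp: z0 zS algebra_simps)
    have "(\<lambda>m. norm (v + w) * (1 / 2) ^ m) \<longlonglongrightarrow> norm (v + w) * 0"
      by (intro tendsto_intros LIMSEQ_realpow_zero) auto
    then have "z \<longlonglongrightarrow> 0"
      by (intro Lim_null_comparison[of z "\<lambda>m. norm (v + w) * (1 / 2) ^ m"]) (auto simp: zn)
    then have "(\<lambda>m. v + w - z m) \<longlonglongrightarrow> v + w - 0"
      by (intro tendsto_intros)
    moreover have "(\<lambda>m. (\<Sum>k<m. fst (g (z k))) + (\<Sum>k<m. snd (g (z k)))) \<longlonglongrightarrow> v' + w'"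
      unfolding v'_def w'_def by (intro tendsto_add summable_LIMSEQ sv sw)
    ultimately have "v' + w' = v + w"
      unfolding part using LIMSEQ_unique by fastforce
    then have "v - v' = w' - w"
      by (simp add: algebra_simps)
    then have "v - v' \<in> V \<inter> W"
      using vw mem V W by (metis IntI subspace_diff)
    then have "v = v'"
      using disj by simp
    have "norm v' \<le> (\<Sum>k. norm (fst (g (z k))))"
      unfolding v'_def by (rule summable_norm[OF sn])
    also have "\<dots> \<le> (\<Sum>k. M * norm (v + w) * (1 / 2) ^ k)"
      by (intro suminf_le sn bd sums_summable[OF geo])
    also have "\<dots> = M * norm (v + w) * 2"
      using geo by (simp add: sums_iff)
    finally show ?thesis
      using \<open>v = v'\<close> by simp
  qed
  then show ?thesis
    using M by (intro exI[of _ "2 * M"]) auto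
qed

text \<open>The representing vector minimises \<open>\<parallel>x\<parallel>\<^sup>2 - 2 f x\<close>; minimising sequences are Cauchy by the
  parallelogram identity.\<close>

lemma riesz_subspace:
  fixes S :: "'a::{real_inner,complete_space} set" and f :: "'a \<Rightarrow> real"
  assumes S: "subspace S" "closed S"
    and add: "\<And>x y. x \<in> S \<Longrightarrow> y \<in> S \<Longrightarrow> f (x + y) = f x + f y"
    and scale: "\<And>r x. x \<in> S \<Longrightarrow> f (r *\<^sub>R x) = r * f x"
    and bound: "\<And>x. x \<in> S \<Longrightarrow> \<bar>f x\<bar> \<le> C * norm x"
  shows "\<exists>y\<in>S. \<forall>x\<in>S. f x = inner y x"
proof -
  define q where "q x = (norm x)\<^sup>2 - 2 * f x" for x
  have par: "q x + q y = 2 * q ((1 / 2) *\<^sub>R (x + y)) + (1 / 2) * (norm (x - y))\<^sup>2"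
    if "x \<in> S" "y \<in> S" for x y
    using that S add scale[of "x + y" "1 / 2"]
    by (simp add: q_def subspace_add power2_norm_eq_inner inner_add_left inner_add_right
        inner_diff_left inner_diff_right inner_commute algebra_simps)
  have low: "- C\<^sup>2 \<le> q x" if "x \<in> S" for x
  proof -
    have "2 * f x \<le> 2 * (C * norm x)"
      using bound[OF that] by simp
    moreover have "0 \<le> (norm x - C)\<^sup>2"
      by simp
    ultimately show ?thesis
      by (simp add: q_def power2_eq_square algebra_simps)
  qed
  define m where "m = Inf (q ` S)"
  have bdd: "bdd_below (q ` S)"
    using low by (intro bdd_belowI[of _ "- C\<^sup>2"]) auto
  have ne: "q ` S \<noteq> {}"
    using S subspace_0 by blast
  have mle: "m \<le> q x" if "x \<in> S" for x
    unfolding m_def using bdd that by (intro cInf_lower) auto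
  have "\<exists>x\<in>S. q x < m + 1 / real (Suc k)" for k
    using cInf_lessD[OF ne, of "m + 1 / real (Suc k)"] by (auto simp: m_def)
  then obtain X where X: "\<And>k. X k \<in> S" "\<And>k. q (X k) < m + 1 / real (Suc k)"
    by metis
  have X2: "(norm (X i - X j))\<^sup>2 \<le> 2 / real (Suc i) + 2 / real (Suc j)" for i j
    using par[OF X(1) X(1), of i j] X(2)[of i] X(2)[of j] mle[of "(1 / 2) *\<^sub>R (X i + X j)"] S X(1)
    by (simp add: subspace_add subspace_scale)
  have "Cauchy X"
  proof (rule metric_CauchyI)
    fix e :: real assume e: "0 < e"
    obtain N :: nat where N: "4 / e\<^sup>2 < real N"
      using reals_Archimedean2 by blast
    have "dist (X i) (X j) < e" if "i \<ge> N" "j \<ge> N" for i j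
    proof -
      have *: "2 / real (Suc k) < e\<^sup>2 / 2" if "k \<ge> N" for k
      proof -
        have "4 / e\<^sup>2 < real (Suc k)"
          using N that by linarith
        then show ?thesis
          using e by (simp add: field_simps)
      qed
      have "(norm (X i - X j))\<^sup>2 < e\<^sup>2"
        using X2[of i j] *[OF that(1)] *[OF that(2)] by linarith
      then show ?thesis
        using e by (simp add: dist_norm power2_less_imp_less)
    qed
    then show "\<exists>N. \<forall>i\<ge>N. \<forall>j\<ge>N. dist (X i) (X j) < e"
      by blast
  qed
  then obtain y where y: "X \<longlonglongrightarrow> y"
    using Cauchy_convergent convergent_def by blast
  have yS: "y \<in> S"
    using S(2) X(1) y closed_sequentially by blast
  have fy: "(\<lambda>k. f (X k)) \<longlonglongrightarrow> f y"
  proof -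
    have "(\<lambda>k. f (X k - y)) \<longlonglongrightarrow> 0"
    proof (rule Lim_null_comparison)
      show "\<forall>\<^sub>F k in sequentially. norm (f (X k - y)) \<le> C * norm (X k - y)"
        using bound S X(1) yS by (simp add: subspace_diff)
      have "(\<lambda>k. C * norm (X k - y)) \<longlonglongrightarrow> C * norm (y - y)"
        by (intro tendsto_intros y)
      then show "(\<lambda>k. C * norm (X k - y)) \<longlonglongrightarrow> 0"
        by simp
    qed
    moreover have "f (X k - y) = f (X k) - f y" for k
      using add[of "X k - y" y] S X(1) yS by (simp add: subspace_diff)
    ultimately show ?thesis
      by (simp add: LIM_zero_iff)
  qed
  have "(\<lambda>k. q (X k)) \<longlonglongrightarrow> q y"
    unfolding q_def by (intro tendsto_intros fy y)
  moreover have "(\<lambda>k. m + 1 / real (Suc k)) \<longlonglongrightarrow> m + 0"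
    using LIMSEQ_inverse_real_of_nat by (intro tendsto_add) (auto simp: inverse_eq_divide)
  ultimately have qy: "q y \<le> m"
    using X(2) by (intro LIMSEQ_le[of "\<lambda>k. q (X k)" "q y" "\<lambda>k. m + 1 / real (Suc k)" m])
      (auto intro!: exI[of _ 0] less_imp_le)
  have "f x = inner y x" if x: "x \<in> S" for x
  proof -
    have key: "0 \<le> 2 * t * (inner y x - f x) + t\<^sup>2 * (norm x)\<^sup>2" for t
    proof -
      have "q y \<le> q (y + t *\<^sub>R x)"
        using qy mle[of "y + t *\<^sub>R x"] S x yS by (simp add: subspace_add subspace_scale)
      then show ?thesis
        using add[of y "t *\<^sub>R x"] scale S x yS
        by (simp add: q_def subspace_scale power2_norm_eq_inner inner_add_left inner_add_right
            inner_commute[of x y] algebra_simps power2_eq_square[of t])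
    qed
    define d where "d = inner y x - f x"
    have "d = 0"
    proof (rule ccontr)
      assume "d \<noteq> 0"
      \<comment> \<open>The minimiser of 2 t d + t^2 (norm x ^ 2 + 1); the added 1 covers x =
        0.\<close>
      define t where "t = - d / ((norm x)\<^sup>2 + 1)"
      have "0 \<le> 2 * t * d + t\<^sup>2 * (norm x)\<^sup>2"
        using key d_def by simp
      also have "\<dots> \<le> 2 * t * d + t\<^sup>2 * ((norm x)\<^sup>2 + 1)"
        by (simp add: mult_left_mono)
      also have "\<dots> = - (d\<^sup>2 / ((norm x)\<^sup>2 + 1))"
        by (simp add: t_def power2_eq_square add_nonneg_eq_0_iff field_simps)
      also have "\<dots> < 0"
        using \<open>d \<noteq> 0\<close> by (simp add: add_nonneg_pos)
      finally show False by simp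
    qed
    then show ?thesis
      by (simp add: d_def)
  qed
  then show ?thesis
    using yS by blast
qed

text \<open>The Riesz theorem in the second variable; testing with y = G x gives the norm of
  \<open>G\<close>. The form is only real bilinear because \<open>inner\<close> is the real part of
  \<open>cinner\<close>; complex linearity of the operators obtained this way is checked
  separately.\<close>

lemma bilinear_form_represented:
  fixes \<beta> :: "'a::{real_inner,complete_space} \<Rightarrow> 'a \<Rightarrow> real"
  assumes "\<And>x x' y. \<beta> (x + x') y = \<beta> x y + \<beta> x' y" "\<And>x y y'. \<beta> x (y + y') = \<beta> x y + \<beta> x y'"
    "\<And>r x y. \<beta> (r *\<^sub>R x) y = r * \<beta> x y" "\<And>r x y. \<beta> x (r *\<^sub>R y) = r * \<beta> x y"
    "\<And>x y. \<bar>\<beta> x y\<bar> \<le> C * norm x * norm y"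
  shows "\<exists>G :: 'a \<Rightarrow>\<^sub>L 'a. \<forall>x y. inner (G x) y = \<beta> x y"
proof -
  have "\<exists>z. \<forall>y. \<beta> x y = inner z y" for x
    using riesz_subspace[of UNIV "\<beta> x" "C * norm x"] assms by auto
  then obtain G where G: "\<And>x y. \<beta> x y = inner (G x) y"
    by metis
  have eqI: "u = v" if "\<And>y. inner u y = inner v y" for u v :: 'a
    using that by (meson vector_eq_rdot)
  have "bounded_linear G"
  proof (rule bounded_linear_intro)
    show "G (x + y) = G x + G y" "G (r *\<^sub>R x) = r *\<^sub>R G x" for x y r
      using assms(1,3) by (auto intro!: eqI simp: inner_add_left simp flip: G)
    show "norm (G x) \<le> norm x * \<bar>C\<bar>" for x
    proof (cases "norm (G x) = 0")
      case False
      have "norm (G x) * norm (G x) = \<beta> x (G x)"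
        by (simp add: G power2_norm_eq_inner flip: power2_eq_square)
      also have "\<dots> \<le> C * norm x * norm (G x)"
        using assms(5)[of x "G x"] by linarith
      finally have "norm (G x) \<le> C * norm x"
        using False by simp
      also have "\<dots> \<le> norm x * \<bar>C\<bar>"
        by (simp add: mult.commute[of C] mult_left_mono)
      finally show ?thesis .
    qed simp
  qed
  then show ?thesis
    using G by (intro exI[of _ "Blinfun G"]) (simp add: bounded_linear_Blinfun_apply)
qed

instance chilbert_space \<subseteq> banach ..

section \<open>Square-summable sequences\<close>

lemmas ell2_nth_simps [simp] = zero_ell2.rep_eq plus_ell2.rep_eq minus_ell2.rep_eq uminus_ell2.rep_eq
  scaleC_ell2.rep_eq scaleR_ell2.rep_eq ampliation.rep_eq

lemma ell2_eqI: "(\<And>i. ell2_nth x i = ell2_nth y i) \<Longrightarrow> x = y"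
  by (simp add: fun_eq_iff flip: ell2_nth_inject)

lemma bounded_linear_ell2_nth: "bounded_linear (\<lambda>z. ell2_nth z i)"
  by (rule bounded_linear_intro[where K = 1]) (simp_all add: norm_ell2_nth_le)

lemma continuous_on_ell2_nth [continuous_intros]:
  "continuous_on S f \<Longrightarrow> continuous_on S (\<lambda>z. ell2_nth (f z) i)"
  by (rule bounded_linear.continuous_on[OF bounded_linear_ell2_nth])

lift_definition at_coord :: "nat \<Rightarrow> 'a::complex_inner \<Rightarrow> 'a ell2" is "\<lambda>i x j. if j = i then x else 0"
  by (rule summable_finite[of "{_}"]) auto

lemmas at_coord_nth [simp] = at_coord.rep_eq

lemma norm_ell2_squared: "(norm x)\<^sup>2 = (\<Sum>i. (norm (ell2_nth x i))\<^sup>2)"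
  by (simp add: norm_ell2_eq suminf_nonneg summable_ell2_nth)

lemma norm_ell2_finite:
  assumes "\<And>i. i \<ge> n \<Longrightarrow> ell2_nth x i = 0"
  shows "(norm x)\<^sup>2 = (\<Sum>i<n. (norm (ell2_nth x i))\<^sup>2)"
  unfolding norm_ell2_squared by (rule suminf_finite) (auto simp: assms not_less)

lemma norm_at_coord [simp]: "norm (at_coord i x) = norm x"
proof -
  have "(norm (at_coord i x))\<^sup>2 = (\<Sum>j\<in>{i}. (norm (ell2_nth (at_coord i x) j))\<^sup>2)"
    unfolding norm_ell2_squared by (rule suminf_finite) auto
  then show ?thesis
    by simp
qed

lemma at_coord_add: "at_coord i (x + y) = at_coord i x + at_coord i y"
  and at_coord_scaleC: "at_coord i (c *\<^sub>C x) = c *\<^sub>C at_coord i x"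
  and at_coord_scaleR: "at_coord i (r *\<^sub>R x) = r *\<^sub>R at_coord i x"
  by (rule ell2_eqI; simp)+

lemma bounded_linear_at_coord: "bounded_linear (at_coord i)"
  by (rule bounded_linear_intro[where K = 1]) (simp_all add: at_coord_add at_coord_scaleR)

lemma bounded_linear_ampliation: "bounded_linear (ampliation a)"
proof (rule bounded_linear_intro)
  show "ampliation a (x + y) = ampliation a x + ampliation a y"
    "ampliation a (r *\<^sub>R x) = r *\<^sub>R ampliation a x" for x y r
    by (rule ell2_eqI; simp add: blinfun.bilinear_simps)+
  show "norm (ampliation a x) \<le> norm x * norm a" for x
  proof (rule power2_le_imp_le)
    have "(norm (ampliation a x))\<^sup>2 = (\<Sum>i. (norm (a (ell2_nth x i)))\<^sup>2)"
      by (simp add: norm_ell2_squared)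
    also have "\<dots> \<le> (\<Sum>i. (norm a)\<^sup>2 * (norm (ell2_nth x i))\<^sup>2)"
    proof (rule suminf_le)
      show "(norm (a (ell2_nth x i)))\<^sup>2 \<le> (norm a)\<^sup>2 * (norm (ell2_nth x i))\<^sup>2" for i
        using power_mono[OF norm_blinfun[of a "ell2_nth x i"], of 2] by (simp add: power_mult_distrib)
      show "summable (\<lambda>i. (norm (a (ell2_nth x i)))\<^sup>2)"
        using summable_ell2_nth[of "ampliation a x"] by simp
    qed (intro summable_mult summable_ell2_nth)
    also have "\<dots> = (norm x * norm a)\<^sup>2"
      by (simp add: suminf_mult summable_ell2_nth norm_ell2_squared power_mult_distrib mult.commute)
    finally show "(norm (ampliation a x))\<^sup>2 \<le> (norm x * norm a)\<^sup>2" .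
  qed simp
qed

lemmas ampliation_linear = bounded_linear.linear[OF bounded_linear_ampliation]

lemma ampliation_at_coord [simp]: "ampliation a (at_coord i x) = at_coord i (a x)"
  by (rule ell2_eqI) simp

lemma continuous_on_ampliation [continuous_intros]:
  "continuous_on S f \<Longrightarrow> continuous_on S (\<lambda>z. ampliation a (f z))"
  by (rule bounded_linear.continuous_on[OF bounded_linear_ampliation])

lemma ell2_nth_sum [simp]: "ell2_nth (\<Sum>i\<in>I. f i) j = (\<Sum>i\<in>I. ell2_nth (f i) j)"
  by (induction I rule: infinite_finite_induct) simp_all

lemma ell2_truncation_tendsto: "(\<lambda>n. \<Sum>i<n. at_coord i (ell2_nth z i)) \<longlonglongrightarrow> z"
proof -
  have eq: "(norm ((\<Sum>i<n. at_coord i (ell2_nth z i)) - z))\<^sup>2 = (norm z)\<^sup>2 - (\<Sum>i<n. (norm (ell2_nth z i))\<^sup>2)" for n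
  proof -
    have nth: "ell2_nth ((\<Sum>i<n. at_coord i (ell2_nth z i)) - z) j = (if j < n then 0 else - ell2_nth z j)" for j
      by (simp add: if_distrib[of "\<lambda>x. x - _"] cong: if_cong)
    have "(\<lambda>j. if j \<in> {..<n} then (norm (ell2_nth z j))\<^sup>2 else 0) sums (\<Sum>i<n. (norm (ell2_nth z i))\<^sup>2)"
      by (rule sums_If_finite_set) simp
    then have "(\<lambda>j. (norm (ell2_nth z j))\<^sup>2 - (if j \<in> {..<n} then (norm (ell2_nth z j))\<^sup>2 else 0)) sums
        ((norm z)\<^sup>2 - (\<Sum>i<n. (norm (ell2_nth z i))\<^sup>2))"
      unfolding norm_ell2_squared[of z] by (intro sums_diff summable_sums summable_ell2_nth)
    moreover have "(norm (ell2_nth ((\<Sum>i<n. at_coord i (ell2_nth z i)) - z) j))\<^sup>2 =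
        (norm (ell2_nth z j))\<^sup>2 - (if j \<in> {..<n} then (norm (ell2_nth z j))\<^sup>2 else 0)" for j
      unfolding nth by simp
    ultimately show ?thesis
      unfolding norm_ell2_squared[of "_ - z"] by (simp add: sums_iff)
  qed
  have "(\<lambda>n. (norm z)\<^sup>2 - (\<Sum>i<n. (norm (ell2_nth z i))\<^sup>2)) \<longlonglongrightarrow> (norm z)\<^sup>2 - (norm z)\<^sup>2"
    unfolding norm_ell2_squared[of z] by (intro tendsto_diff tendsto_const summable_LIMSEQ summable_ell2_nth)
  then have "(\<lambda>n. sqrt ((norm ((\<Sum>i<n. at_coord i (ell2_nth z i)) - z))\<^sup>2)) \<longlonglongrightarrow> sqrt 0"
    unfolding eq by (intro tendsto_real_sqrt) simp
  then show ?thesis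
    by (simp add: tendsto_norm_zero_iff LIM_zero_iff)
qed

text \<open>The coding of pairs identifies \<open>H\<^sup>\<infinity>\<close> with the space of square-summable sequences in \<open>H\<^sup>\<infinity>\<close>;
  \<open>block n\<close> and \<open>embed n\<close> are the projection to and the inclusion of the \<open>n\<close>-th entry.\<close>

lemma strict_mono_prod_encode: "strict_mono (\<lambda>i. prod_encode (n, i))"
  by (auto simp: strict_mono_Suc_iff prod_encode_def)

lift_definition block :: "nat \<Rightarrow> 'a::complex_inner ell2 \<Rightarrow> 'a ell2" is "\<lambda>n f i. f (prod_encode (n, i))"
proof -
  fix n and f :: "nat \<Rightarrow> 'a"
  assume "summable (\<lambda>i. (norm (f i))\<^sup>2)"
  from summable_reindex[OF this, of "\<lambda>i. prod_encode (n, i)"]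
  show "summable (\<lambda>i. (norm (f (prod_encode (n, i))))\<^sup>2)"
    using strict_mono_prod_encode[of n] by (simp add: o_def strict_mono_imp_inj_on)
qed

lift_definition embed :: "nat \<Rightarrow> 'a::complex_inner ell2 \<Rightarrow> 'a ell2"
  is "\<lambda>n f j. if fst (prod_decode j) = n then f (snd (prod_decode j)) else 0"
proof -
  fix n and f :: "nat \<Rightarrow> 'a"
  assume f: "summable (\<lambda>i. (norm (f i))\<^sup>2)"
  let ?g = "\<lambda>j. (norm (if fst (prod_decode j) = n then f (snd (prod_decode j)) else 0))\<^sup>2"
  have "?g j = 0" if "j \<notin> range (\<lambda>i. prod_encode (n, i))" for j
  proof -
    have "fst (prod_decode j) \<noteq> n"
      using that by (metis prod.collapse prod_decode_inverse rangeI)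
    then show ?thesis
      by simp
  qed
  then have "summable (\<lambda>i. ?g (prod_encode (n, i))) \<longleftrightarrow> summable ?g"
    by (rule summable_mono_reindex[OF strict_mono_prod_encode])
  with f show "summable ?g"
    by simp
qed

lemmas block_nth [simp] = block.rep_eq
lemmas embed_nth [simp] = embed.rep_eq

lemma block_embed: "block m (embed n z) = (if m = n then z else 0)"
  by (rule ell2_eqI) simp

lemma block_linear: "block n (x + y) = block n x + block n y" "block n (c *\<^sub>C x) = c *\<^sub>C block n x"
    "block n (r *\<^sub>R x) = r *\<^sub>R block n x"
  and embed_linear: "embed n (x + y) = embed n x + embed n y" "embed n (c *\<^sub>C x) = c *\<^sub>C embed n x"
    "embed n (r *\<^sub>R x) = r *\<^sub>R embed n x"
  by (rule ell2_eqI; simp)+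

lemma norm_block_le: "norm (block n z) \<le> norm z"
proof (rule power2_le_imp_le)
  have "(\<Sum>i. (norm (ell2_nth z (prod_encode (n, i))))\<^sup>2) \<le> (\<Sum>i. (norm (ell2_nth z i))\<^sup>2)"
    using suminf_reindex_mono[OF summable_ell2_nth, of "\<lambda>i. prod_encode (n, i)" z] strict_mono_prod_encode[of n]
    by (simp add: o_def strict_mono_imp_inj_on)
  then show "(norm (block n z))\<^sup>2 \<le> (norm z)\<^sup>2"
    unfolding norm_ell2_squared by simp
qed simp

lemma norm_embed: "norm (embed n z) = norm z"
proof -
  let ?g = "\<lambda>j. (norm (ell2_nth (embed n z) j))\<^sup>2"
  have "?g j = 0" if "j \<notin> range (\<lambda>i. prod_encode (n, i))" for j
  proof -
    have "fst (prod_decode j) \<noteq> n"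
      using that by (metis prod.collapse prod_decode_inverse rangeI)
    then show ?thesis
      by simp
  qed
  then have "(\<Sum>i. ?g (prod_encode (n, i))) = (\<Sum>j. ?g j)"
    by (rule suminf_mono_reindex[OF strict_mono_prod_encode])
  then have "(norm (embed n z))\<^sup>2 = (norm z)\<^sup>2"
    unfolding norm_ell2_squared by simp
  then show ?thesis
    by simp
qed

lemma bounded_linear_block: "bounded_linear (block n)"
  by (rule bounded_linear_intro[where K = 1]) (simp_all add: block_linear norm_block_le)

lemma bounded_linear_embed: "bounded_linear (embed n)"
  by (rule bounded_linear_intro[where K = 1]) (simp_all add: embed_linear norm_embed)

lemma ampliation_block: "ampliation a (block n z) = block n (ampliation a z)"
  and ampliation_embed: "ampliation a (embed n z) = embed n (ampliation a z)"
  by (rule ell2_eqI; simp add: blinfun.zero_right)+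

section \<open>Module projections\<close>

definition module_projection ::
    "('a::complex_inner \<Rightarrow>\<^sub>L 'a) set \<Rightarrow> 'a ell2 set \<Rightarrow> ('a ell2 \<Rightarrow>\<^sub>L 'a ell2) \<Rightarrow> bool"
  where "module_projection A V P \<longleftrightarrow> P \<in> bounded_ops \<and> (\<forall>a\<in>A. \<forall>z. P (ampliation a z) = ampliation a (P z)) \<and>
    (\<forall>z. P z \<in> V) \<and> (\<forall>z\<in>V. P z = z)"

text \<open>The decomposition along V and W is unique, so the projection inherits linearity and
  commutation with \<open>A\<close>. Its continuity is the only analytic point and comes from
  \<open>complement_bounded\<close>.\<close>

lemma complement_module_projection:
  fixes A :: "('a::chilbert_space \<Rightarrow>\<^sub>L 'a) set"
  assumes V: "submodule A V" and W: "submodule A W"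
    and disj: "V \<inter> W = {0}" and sum: "{v + w | v w. v \<in> V \<and> w \<in> W} = UNIV"
  shows "\<exists>P. module_projection A V P"
proof -
  have V': "csubspace V" "closed V" "\<And>a x. a \<in> A \<Longrightarrow> x \<in> V \<Longrightarrow> ampliation a x \<in> V"
    and W': "csubspace W" "closed W" "\<And>a x. a \<in> A \<Longrightarrow> x \<in> W \<Longrightarrow> ampliation a x \<in> W"
    using V W by (auto simp: submodule_def)
  obtain K where K: "\<And>v w. v \<in> V \<Longrightarrow> w \<in> W \<Longrightarrow> norm v \<le> K * norm (v + w)"
    using complement_bounded[OF csubspace_imp_subspace V'(2) csubspace_imp_subspace W'(2) disj sum] V' W'
    by blast
  have "\<exists>v w. v \<in> V \<and> w \<in> W \<and> z = v + w" for z
    using sum by blast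
  then obtain p r where pr: "\<And>z. p z \<in> V" "\<And>z. r z \<in> W" "\<And>z. z = p z + r z"
    by metis
  have zp: "z - p z = r z" for z
    using add_diff_cancel_left'[of "p z" "r z"] unfolding pr(3)[symmetric] .
  have uniq: "p z = v" if "v \<in> V" "z - v \<in> W" for z v
  proof -
    have "p z - v \<in> V"
      using V' pr that by (simp add: csubspace_diff)
    moreover have eq: "p z - v = (z - v) - r z"
      unfolding zp[symmetric] by simp
    have "p z - v \<in> W"
      unfolding eq by (rule csubspace_diff[OF W'(1) that(2) pr(2)])
    ultimately have "p z - v \<in> V \<inter> W"
      by blast
    then show ?thesis
      unfolding disj by simp
  qed
  have add: "p (x + y) = p x + p y" for x y
    by (rule uniq) (simp_all add: add_diff_add zp csubspace_add V' W' pr)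
  have scale: "p (c *\<^sub>C x) = c *\<^sub>C p x" for c x
    by (rule uniq)
      (simp_all add: zp csubspace_scale V' W' pr flip: complex_vector.scale_right_diff_distrib)
  have amp: "p (ampliation a x) = ampliation a (p x)" if "a \<in> A" for a x
    by (rule uniq) (simp_all add: zp V' W' that pr flip: linear_diff[OF ampliation_linear])
  have "bounded_linear p"
  proof (rule bounded_linear_intro)
    show "p (x + y) = p x + p y" "p (c *\<^sub>R x) = c *\<^sub>R p x" for x y c
      by (simp_all add: add scale scaleR_scaleC)
    show "norm (p x) \<le> norm x * K" for x
      using K[OF pr(1,2), of x x] unfolding pr(3)[symmetric] by (simp add: mult.commute)
  qed
  then have *: "blinfun_apply (Blinfun p) = p"
    by (rule bounded_linear_Blinfun_apply)
  have "p z = z" if "z \<in> V" for z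
    by (rule uniq) (use that W' in \<open>auto simp: csubspace_0\<close>)
  then have "module_projection A V (Blinfun p)"
    by (auto simp: module_projection_def * bounded_ops_def scale amp pr)
  then show ?thesis ..
qed

text \<open>If there were no uniform bound, the direct sum of a sequence of bad submodules would not be
  complemented.\<close>

lemma uniform_module_projections:
  fixes A :: "('a::chilbert_space \<Rightarrow>\<^sub>L 'a) set"
  assumes "complete_reduction_property A"
  shows "\<exists>K\<ge>1. \<forall>V. submodule A V \<longrightarrow> (\<exists>P. module_projection A V P \<and> norm P \<le> K)"
proof (rule ccontr)
  assume contra: "\<not> ?thesis"
  have "\<exists>V. submodule A V \<and> (\<forall>P. module_projection A V P \<longrightarrow> real n < norm P)" for n :: nat
  proof -
    have "real n + 1 \<ge> 1"
      by simp
    then obtain V where "submodule A V" "\<And>P. module_projection A V P \<Longrightarrow> \<not> norm P \<le> real n + 1"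
      using contra by meson
    then show ?thesis
      by (intro exI[of _ V]) force
  qed
  then obtain V where V: "\<And>n :: nat. submodule A (V n)"
    and bad: "\<And>n P. module_projection A (V n) P \<Longrightarrow> real n < norm P"
    by metis
  have V': "csubspace (V n)" "closed (V n)" "\<And>a x. a \<in> A \<Longrightarrow> x \<in> V n \<Longrightarrow> ampliation a x \<in> V n" for n
    using V by (auto simp: submodule_def)
  define U where "U = {z. \<forall>n. block n z \<in> V n}"
  have "submodule A U"
    unfolding submodule_def
  proof (intro conjI ballI)
    have [simp]: "block n 0 = 0" for n
      by (rule ell2_eqI) simp
    then show "csubspace U"
      by (intro csubspaceI) (auto simp: U_def block_linear csubspace_0 csubspace_add csubspace_scale V')
    have "U = (\<Inter>n. block n -` V n)"
      by (auto simp: U_def)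
    then show "closed U"
      using closed_vimage[OF V'(2) linear_continuous_on[OF bounded_linear_block, of UNIV]] by auto
    show "ampliation a x \<in> U" if "a \<in> A" "x \<in> U" for a x
      using that V' by (auto simp: U_def simp flip: ampliation_block)
  qed
  then obtain W where "submodule A W" "U \<inter> W = {0}" "{v + w | v w. v \<in> U \<and> w \<in> W} = UNIV"
    using assms unfolding complete_reduction_property_def by meson
  then obtain P where P: "module_projection A U P"
    using complement_module_projection[OF \<open>submodule A U\<close>] by blast
  obtain n :: nat where n: "norm P \<le> real n"
    using real_arch_simple by blast
  \<comment> \<open>Compressed to the n-th block, \<open>P\<close> is a module projection onto
    \<open>V n\<close> whose norm is at most norm P \<le> n, against the choice of
    \<open>V n\<close>.\<close>
  define Q where "Q = Blinfun (\<lambda>z. block n (P (embed n z)))"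
  have Q: "blinfun_apply Q z = block n (P (embed n z))" for z
    unfolding Q_def
    by (subst bounded_linear_Blinfun_apply)
      (auto intro!: bounded_linear_compose[OF bounded_linear_block]
        bounded_linear_compose[OF blinfun.bounded_linear_right bounded_linear_embed])
  have "module_projection A (V n) Q"
    unfolding module_projection_def
  proof (intro conjI ballI allI)
    show "Q \<in> bounded_ops"
      using P by (intro bounded_opsI) (simp add: Q embed_linear block_linear module_projection_def bounded_opsD)
    show "blinfun_apply Q (ampliation a z) = ampliation a (blinfun_apply Q z)" if "a \<in> A" for a z
      using P that by (simp add: Q ampliation_block module_projection_def flip: ampliation_embed)
    show "blinfun_apply Q z \<in> V n" for z
      using P by (auto simp: Q module_projection_def U_def)
    show "blinfun_apply Q z = z" if "z \<in> V n" for z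
    proof -
      have "embed n z \<in> U"
        using that by (auto simp: U_def block_embed csubspace_0 V')
      then show ?thesis
        using P by (simp add: Q module_projection_def block_embed)
    qed
  qed
  then have "real n < norm Q"
    by (rule bad)
  moreover have "norm Q \<le> norm P"
  proof (rule norm_blinfun_bound)
    show "norm (blinfun_apply Q z) \<le> norm P * norm z" for z
      using order_trans[OF norm_block_le norm_blinfun, of n P "embed n z"] by (simp add: Q norm_embed)
  qed simp
  ultimately show False
    using n by simp
qed

section \<open>Invariant subspaces and the commutant\<close>

text \<open>Stated for an arbitrary set of operators, since both \<open>A\<close> and
  \<open>A \<union> B\<close> with the commutant \<open>B\<close> occur below.\<close>

definition invariant_subspace :: "('a::complex_inner \<Rightarrow>\<^sub>L 'a) set \<Rightarrow> 'a set \<Rightarrow> bool"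
  where "invariant_subspace T X \<longleftrightarrow> csubspace X \<and> closed X \<and> (\<forall>t\<in>T. \<forall>x\<in>X. t x \<in> X)"

definition projection_onto :: "'a::complex_inner set \<Rightarrow> ('a \<Rightarrow>\<^sub>L 'a) \<Rightarrow> bool"
  where "projection_onto X P \<longleftrightarrow> P \<in> bounded_ops \<and> (\<forall>x. P x \<in> X) \<and> (\<forall>x\<in>X. P x = x)"

definition commutant :: "('a::complex_inner \<Rightarrow>\<^sub>L 'a) set \<Rightarrow> ('a \<Rightarrow>\<^sub>L 'a) set"
  where "commutant A = {b \<in> bounded_ops. \<forall>a\<in>A. \<forall>x. b (a x) = a (b x)}"

lemma commutantD: "b \<in> commutant A \<Longrightarrow> a \<in> A \<Longrightarrow> b (a x) = a (b x)"
  and commutant_bounded_ops: "b \<in> commutant A \<Longrightarrow> b \<in> bounded_ops"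
  by (auto simp: commutant_def)

lemma commutant_scaleC_apply: "b \<in> commutant A \<Longrightarrow> b (c *\<^sub>C x) = c *\<^sub>C b x"
  by (rule bounded_opsD[OF commutant_bounded_ops])

lemma commutant_simps [simp]:
  assumes "A \<subseteq> bounded_ops"
  shows "0 \<in> commutant A" "id_blinfun \<in> commutant A"
    "b \<in> commutant A \<Longrightarrow> b' \<in> commutant A \<Longrightarrow> b + b' \<in> commutant A"
    "b \<in> commutant A \<Longrightarrow> b' \<in> commutant A \<Longrightarrow> b - b' \<in> commutant A"
    "b \<in> commutant A \<Longrightarrow> b' \<in> commutant A \<Longrightarrow> b o\<^sub>L b' \<in> commutant A"
    "b \<in> commutant A \<Longrightarrow> c *\<^sub>C b \<in> commutant A"
    "b \<in> commutant A \<Longrightarrow> r *\<^sub>R b \<in> commutant A"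
  using assms
  by (auto simp: commutant_def blinfun.bilinear_simps subset_eq bounded_opsD)

lemma invariant_subspaceD:
  assumes "invariant_subspace T X"
  shows "csubspace X" "closed X" "t \<in> T \<Longrightarrow> x \<in> X \<Longrightarrow> t x \<in> X"
  using assms by (auto simp: invariant_subspace_def)

lemma projection_ontoD:
  assumes "projection_onto X P"
  shows "P \<in> bounded_ops" "P x \<in> X" "x \<in> X \<Longrightarrow> P x = x"
  using assms by (auto simp: projection_onto_def)

lemma invariant_subspace_closure:
  assumes "csubspace X" "\<And>t x. t \<in> T \<Longrightarrow> x \<in> X \<Longrightarrow> blinfun_apply t x \<in> X"
  shows "invariant_subspace T (closure X)"
  unfolding invariant_subspace_def
proof (intro conjI ballI csubspace_closure assms closed_closure)
  fix t x assume t: "t \<in> T" and "x \<in> closure X"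
  have "blinfun_apply t ` closure X \<subseteq> closure X"
    using closure_subset assms(2)[OF t]
    by (intro image_closure_subset) (auto intro!: continuous_intros)
  then show "blinfun_apply t x \<in> closure X"
    using \<open>x \<in> closure X\<close> by blast
qed

text \<open>Kernels of intertwining operators are the case \<open>Y = {0}\<close>. With
  \<open>1 - P\<close> in place of \<open>P\<close> it lifts an invariant subspace of the kernel of
  a projection to one that also contains the part of the range inside \<open>N\<close>.\<close>

lemma invariant_subspace_preimage:
  assumes N: "invariant_subspace T N" and Y: "invariant_subspace T Y"
    and P: "P \<in> bounded_ops" "\<And>t x. t \<in> T \<Longrightarrow> x \<in> N \<Longrightarrow> P (t x) = t (P x)"
  shows "invariant_subspace T {x \<in> N. P x \<in> Y}"
  unfolding invariant_subspace_def
proof (intro conjI ballI)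
  note N' = invariant_subspaceD[OF N] and Y' = invariant_subspaceD[OF Y]
  show "csubspace {x \<in> N. P x \<in> Y}"
    by (rule csubspaceI)
      (auto simp: blinfun.bilinear_simps bounded_opsD[OF P(1)] intro: N' Y' csubspace_0 csubspace_add csubspace_scale)
  have "{x \<in> N. P x \<in> Y} = N \<inter> P -` Y"
    by auto
  moreover have "closed (P -` Y)"
    using Y'(2) by (intro closed_vimage) (auto intro!: continuous_intros)
  ultimately show "closed {x \<in> N. P x \<in> Y}"
    using N'(2) by auto
  show "t x \<in> {x \<in> N. P x \<in> Y}" if "t \<in> T" "x \<in> {x \<in> N. P x \<in> Y}" for t x
    using that by (auto simp: P N' Y')
qed

lemma invariant_subspace_zero: "invariant_subspace T {0}"
  by (auto simp: invariant_subspace_def blinfun.bilinear_simps intro!: csubspaceI)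

lemma invariant_subspace_UNIV: "invariant_subspace T UNIV"
  by (auto simp: invariant_subspace_def intro!: csubspaceI)

lemma invariant_subspace_Int:
  "invariant_subspace T X \<Longrightarrow> invariant_subspace T Y \<Longrightarrow> invariant_subspace T (X \<inter> Y)"
  by (auto simp: invariant_subspace_def complex_vector.subspace_inter)

lemma projection_onto_vanishing:
  assumes "invariant_subspace T N" "projection_onto X P" "\<And>t x. t \<in> T \<Longrightarrow> P (t x) = t (P x)"
  shows "invariant_subspace T {x \<in> N. P x = 0}"
  using invariant_subspace_preimage[OF assms(1) invariant_subspace_zero, of P]
    assms projection_ontoD(1)[OF assms(2)] by simp

section \<open>Compact operators and sigma-weak neighbourhoods\<close>

lemma compact_opsD:
  assumes "k \<in> compact_ops"
  shows "k \<in> bounded_ops" "compact (closure (blinfun_apply k ` cball 0 1))"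
  using assms by (auto simp: compact_ops_def)

lemma compact_closure_subset:
  fixes S C :: "'a::metric_space set"
  assumes "compact C" "S \<subseteq> C"
  shows "compact (closure S)"
proof -
  have "closure S = C \<inter> closure S"
    using closure_minimal[OF assms(2) compact_imp_closed[OF assms(1)]] by blast
  then show ?thesis
    using compact_Int_closed[OF assms(1) closed_closure, of S] by simp
qed

lemma compact_ops_left:
  assumes a: "a \<in> bounded_ops" and k: "k \<in> compact_ops"
  shows "a o\<^sub>L k \<in> compact_ops"
  unfolding compact_ops_def
proof (safe)
  show "a o\<^sub>L k \<in> bounded_ops"
    using a compact_opsD[OF k] by simp
  have c: "compact (blinfun_apply a ` closure (blinfun_apply k ` cball 0 1))"
    by (intro compact_continuous_image compact_opsD k) (auto intro!: continuous_intros)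
  have "blinfun_apply (a o\<^sub>L k) ` cball 0 1 \<subseteq> blinfun_apply a ` closure (blinfun_apply k ` cball 0 1)"
    using closure_subset[of "blinfun_apply k ` cball 0 1"] by auto
  then show "compact (closure (blinfun_apply (a o\<^sub>L k) ` cball 0 1))"
    by (rule compact_closure_subset[OF c])
qed

lemma sigma_weak_functional_eq: "sigma_weak_functional x y T = cinner (ampliation T x) y"
  by (simp add: sigma_weak_functional_def cinner_ell2_def)

text \<open>Several functionals are handled by a single vector of \<open>H\<^sup>\<infinity>\<close>, since \<open>H\<^sup>\<infinity>\<close> contains copies
  of its own square.\<close>

lemma sigma_weak_neighbourhood:
  fixes U :: "('a::complex_inner \<Rightarrow>\<^sub>L 'a) set"
  assumes "openin sigma_weak_topology U" "T \<in> U"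
  shows "\<exists>x. \<exists>e>0. \<forall>S\<in>bounded_ops. norm (ampliation S x - ampliation T x) < e \<longrightarrow> S \<in> U"
  using assms unfolding sigma_weak_topology_def openin_topology_generated_by_iff
proof (induction rule: generate_topology_on.induct)
  case (Int a b)
  obtain x e where xe: "e > 0"
    "\<And>S. S \<in> bounded_ops \<Longrightarrow> norm (ampliation S x - ampliation T x) < e \<Longrightarrow> S \<in> a"
    using Int.IH(1) Int.prems by blast
  obtain y d where yd: "d > 0"
    "\<And>S. S \<in> bounded_ops \<Longrightarrow> norm (ampliation S y - ampliation T y) < d \<Longrightarrow> S \<in> b"
    using Int.IH(2) Int.prems by blast
  define z where "z = embed 0 x + embed 1 y"
  have z: "block 0 z = x" "block 1 z = y"
    by (simp_all add: z_def block_linear block_embed)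
  have diff: "block n (u - v) = block n u - block n v" for n and u v :: "'a ell2"
    by (rule ell2_eqI) simp
  have "norm (ampliation S (block n z) - ampliation T (block n z)) \<le> norm (ampliation S z - ampliation T z)" for S n
    unfolding ampliation_block diff[symmetric] by (rule norm_block_le)
  from this[of _ 0] this[of _ 1] show ?case
    unfolding z using xe yd by (intro exI[of _ z] exI[of _ "min e d"]) (auto intro: xe yd le_less_trans)
next
  case (UN \<U>)
  from UN.prems obtain W where W: "W \<in> \<U>" "T \<in> W"
    by blast
  from UN.IH[OF W] W(1) show ?case
    by blast
next
  case (Basis s)
  then obtain x y W where W: "s = {T \<in> bounded_ops. sigma_weak_functional x y T \<in> W}" "open W"
    by blast
  then obtain e where e: "e > 0" "\<And>w. dist w (sigma_weak_functional x y T) < e \<Longrightarrow> w \<in> W"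
    using Basis(2) unfolding open_dist by blast
  have "sigma_weak_functional x y S \<in> W"
    if "norm (ampliation S x - ampliation T x) < e / (norm y + 1)" for S
  proof (rule e(2))
    have "dist (sigma_weak_functional x y S) (sigma_weak_functional x y T) \<le>
        norm (ampliation S x - ampliation T x) * norm y"
      unfolding dist_norm sigma_weak_functional_eq cinner_diff_left[symmetric] by (rule norm_cinner)
    also have "\<dots> \<le> norm (ampliation S x - ampliation T x) * (norm y + 1)"
      by (intro mult_left_mono) auto
    also have "\<dots> < e"
      using that by (simp add: pos_less_divide_eq add_nonneg_pos)
    finally show "dist (sigma_weak_functional x y S) (sigma_weak_functional x y T) < e" .
  qed
  then show ?case
    using e(1) unfolding W(1) by (intro exI[of _ x] exI[of _ "e / (norm y + 1)"]) (auto intro!: divide_pos_pos add_nonneg_pos)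
qed simp

section \<open>Algebras with uniformly bounded module projections\<close>

text \<open>The complete reduction property enters from here on only through the constant
  \<open>K\<close>, and all further bounds are expressed by it. As \<open>K\<close> may be enlarged,
  \<open>1 \<le> K\<close> can be assumed.\<close>

locale reductive =
  fixes A :: "('a::chilbert_space \<Rightarrow>\<^sub>L 'a) set" and K :: real
  assumes algebra: "subalgebra A" and K: "1 \<le> K"
    and projections: "\<And>V. submodule A V \<Longrightarrow> \<exists>P. module_projection A V P \<and> norm P \<le> K"
    and compacts: "nondegenerate (A \<inter> compact_ops)"
begin

abbreviation B where "B \<equiv> commutant A"
abbreviation J where "J \<equiv> A \<inter> compact_ops"

lemma A_bounded_ops: "A \<subseteq> bounded_ops"
  and A_compose: "a \<in> A \<Longrightarrow> a' \<in> A \<Longrightarrow> a o\<^sub>L a' \<in> A"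
  and A_subspace: "csubspace A"
  using algebra by (auto simp: subalgebra_def)

lemma A_scaleC: "a \<in> A \<Longrightarrow> a (c *\<^sub>C x) = c *\<^sub>C a x"
  using A_bounded_ops by (auto simp: bounded_opsD)

lemmas B_simps [simp] = commutant_simps[OF A_bounded_ops]

definition entry :: "('a ell2 \<Rightarrow>\<^sub>L 'a ell2) \<Rightarrow> nat \<Rightarrow> nat \<Rightarrow> 'a \<Rightarrow>\<^sub>L 'a"
  where "entry P i j = Blinfun (\<lambda>x. ell2_nth (P (at_coord j x)) i)"

lemma entry_apply: "blinfun_apply (entry P i j) x = ell2_nth (P (at_coord j x)) i"
  unfolding entry_def
  by (subst bounded_linear_Blinfun_apply)
    (auto intro!: bounded_linear_compose[OF bounded_linear_ell2_nth]
      bounded_linear_compose[OF blinfun.bounded_linear_right bounded_linear_at_coord])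

lemma norm_entry: "norm (entry P i j) \<le> norm P"
proof (rule norm_blinfun_bound)
  show "norm (entry P i j x) \<le> norm P * norm x" for x
    using order_trans[OF norm_ell2_nth_le norm_blinfun, of P "at_coord j x" i] by (simp add: entry_apply)
qed simp

text \<open>The source of concrete elements of the commutant: the projections in \<open>B\<close>
  and the operators of \<open>graph_projection\<close> are entries of module projections.\<close>

lemma entry_commutant:
  assumes "module_projection A V P"
  shows "entry P i j \<in> B"
  using assms A_bounded_ops
  by (auto simp: commutant_def entry_apply module_projection_def at_coord_scaleC bounded_opsD
      intro!: bounded_opsI simp flip: ampliation_at_coord)

lemma submodule_at_0:
  assumes "invariant_subspace A X"
  shows "submodule A {z. ell2_nth z 0 \<in> X \<and> (\<forall>i>0. ell2_nth z i = 0)}" (is "submodule A ?V")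
  unfolding submodule_def
proof (intro conjI ballI)
  note X = invariant_subspaceD[OF assms]
  show "csubspace ?V"
    by (rule csubspaceI) (auto intro: X csubspace_0 csubspace_add csubspace_scale)
  have "?V = (\<lambda>z. ell2_nth z 0) -` X \<inter> (\<Inter>i\<in>{0<..}. (\<lambda>z. ell2_nth z i) -` {0})"
    by auto
  also have "closed \<dots>"
    by (intro closed_Int closed_INT ballI closed_vimage X closed_singleton)
      (auto intro!: continuous_intros)
  finally show "closed ?V" .
  show "ampliation a z \<in> ?V" if "a \<in> A" "z \<in> ?V" for a z
    using that by (auto simp: X blinfun.bilinear_simps)
qed

text \<open>The entry at (0, 0) of a module projection onto the copy of \<open>X\<close> in
  coordinate 0.\<close>

lemma projection_in_commutant:
  assumes "invariant_subspace A X"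
  shows "\<exists>p\<in>B. projection_onto X p \<and> norm p \<le> K"
proof -
  obtain P where P: "module_projection A {z. ell2_nth z 0 \<in> X \<and> (\<forall>i>0. ell2_nth z i = 0)} P" "norm P \<le> K"
    using projections[OF submodule_at_0[OF assms]] by blast
  have "projection_onto X (entry P 0 0)"
    using P commutant_bounded_ops[OF entry_commutant[OF P(1)]]
    by (auto simp: projection_onto_def entry_apply module_projection_def)
  then show ?thesis
    using entry_commutant[OF P(1)] norm_entry P(2) by (meson order_trans)
qed

text \<open>The entries of a projection onto the graph of \<open>b\<close>.\<close>

lemma graph_projection:
  assumes b: "b \<in> B"
  shows "\<exists>x\<in>B. \<exists>y\<in>B. (\<forall>z. x z + y (b z) = z) \<and> (\<forall>z. norm (b (x z)) \<le> K * norm z)"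
proof -
  let ?V = "{z. ell2_nth z 1 = b (ell2_nth z 0) \<and> (\<forall>i>1. ell2_nth z i = 0)}"
  have "submodule A ?V"
    unfolding submodule_def
  proof (intro conjI ballI)
    show "csubspace ?V"
      by (rule csubspaceI) (auto simp: blinfun.bilinear_simps commutant_scaleC_apply[OF b])
    have "?V = {z. ell2_nth z 1 = b (ell2_nth z 0)} \<inter> (\<Inter>i\<in>{1<..}. (\<lambda>z. ell2_nth z i) -` {0})"
      by auto
    also have "closed \<dots>"
      by (intro closed_Int closed_INT ballI closed_vimage closed_singleton closed_Collect_eq)
        (auto intro!: continuous_intros)
    finally show "closed ?V" .
    show "ampliation a z \<in> ?V" if "a \<in> A" "z \<in> ?V" for a z
      using that b by (auto simp: blinfun.bilinear_simps commutantD)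
  qed
  then obtain P where P: "module_projection A ?V P" "norm P \<le> K"
    using projections by blast
  \<comment> \<open>Coordinate 0 of the fact that \<open>P\<close> fixes the pair (z, b z). The norm
    bound below is coordinate 1 of \<open>P\<close> applied to (z, 0).\<close>
  have "entry P 0 0 z + entry P 0 1 (b z) = z" for z
  proof -
    have "P (at_coord 0 z + at_coord 1 (b z)) = at_coord 0 z + at_coord 1 (b z)"
      using P by (auto simp: module_projection_def)
    from arg_cong[OF this, of "\<lambda>z. ell2_nth z 0"] show ?thesis
      by (simp add: entry_apply blinfun.bilinear_simps)
  qed
  moreover have "norm (b (entry P 0 0 z)) \<le> K * norm z" for z
  proof -
    have "b (entry P 0 0 z) = ell2_nth (P (at_coord 0 z)) 1"
      using P by (auto simp: module_projection_def entry_apply)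
    also have "norm \<dots> \<le> norm P * norm z"
      using order_trans[OF norm_ell2_nth_le norm_blinfun, of P "at_coord 0 z" 1] by simp
    also have "\<dots> \<le> K * norm z"
      by (simp add: P(2) mult_right_mono)
    finally show ?thesis .
  qed
  ultimately show ?thesis
    using entry_commutant[OF P(1)] by blast
qed

text \<open>With \<open>T = p b (1 - p)\<close> and \<open>x\<close>, \<open>y\<close> from the graph of \<open>t T\<close>, invariance of \<open>N\<close> under \<open>y\<close>
  gives \<open>T x = T\<close>, so that \<open>t T\<close> is bounded by \<open>K\<close> for every \<open>t\<close>.\<close>

lemma projection_central:
  assumes N: "invariant_subspace (A \<union> B) N" and p: "p \<in> B" "projection_onto N p" and b: "b \<in> B"
  shows "p (b z) = b (p z)"
proof -
  note N' = invariant_subspaceD[OF N] and p' = projection_ontoD[OF p(2)]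
  define T where "T = p o\<^sub>L b o\<^sub>L (id_blinfun - p)"
  have T: "T z = p (b (z - p z))" for z
    by (simp add: T_def blinfun.bilinear_simps)
  have TB: "T \<in> B"
    unfolding T_def using p b by (intro B_simps)
  have TN: "T z = 0" if "z \<in> N" for z
    using that by (simp add: T p' blinfun.bilinear_simps)
  have bound: "t * norm (T z) \<le> K * norm z" if "t \<ge> 0" for t z
  proof -
    obtain x y where xy: "x \<in> B" "y \<in> B" "\<And>z. x z + y ((t *\<^sub>R T) z) = z"
      "\<And>z. norm ((t *\<^sub>R T) (x z)) \<le> K * norm z"
      using graph_projection[of "t *\<^sub>R T"] TB by auto
    have "(t *\<^sub>R T) z \<in> N"
      by (simp add: T scaleR_blinfun.rep_eq scaleR_scaleC csubspace_scale N' p')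
    then have "y ((t *\<^sub>R T) z) \<in> N"
      using N'(3)[of y] xy(2) by blast
    moreover have "x z = z - y ((t *\<^sub>R T) z)"
      using xy(3)[of z] by (metis add_diff_cancel_right')
    ultimately have "T (x z) = T z"
      using TN by (simp add: blinfun.diff_right)
    then show ?thesis
      using xy(4)[of z] that by (simp add: scaleR_blinfun.rep_eq)
  qed
  have "T z = 0"
  proof (rule ccontr)
    assume "T z \<noteq> 0"
    then have "0 < norm (T z)"
      by simp
    moreover obtain n :: nat where "K * norm z / norm (T z) < real n"
      using reals_Archimedean2 by blast
    ultimately have "K * norm z < real n * norm (T z)"
      by (simp add: pos_divide_less_eq)
    then show False
      using bound[of "real n" z] by simp
  qed
  then have "p (b z) = p (b (p z))"
    by (simp add: T blinfun.diff_right)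
  also have "\<dots> = b (p z)"
    by (rule p'(3)) (use N'(3)[of b] p' b in blast)
  finally show ?thesis .
qed

lemma central_projection:
  assumes "invariant_subspace (A \<union> B) N"
  shows "\<exists>p\<in>B. projection_onto N p \<and> norm p \<le> K \<and> (\<forall>b\<in>B. \<forall>z. p (b z) = b (p z))"
proof -
  have "invariant_subspace A N"
    using assms by (auto simp: invariant_subspace_def)
  then show ?thesis
    using projection_in_commutant projection_central[OF assms] by meson
qed

text \<open>Commuting idempotents with the same range coincide. This transfers the bound
  \<open>K\<close> to central idempotents of any origin.\<close>

lemma central_projection_unique:
  assumes "p \<in> B" "projection_onto N p" "\<And>b z. b \<in> B \<Longrightarrow> p (b z) = b (p z)"
    and "q \<in> B" "projection_onto N q"
  shows "q = p"
proof (rule blinfun_eqI)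
  fix z
  have "q z = p (q z)"
    using assms by (simp add: projection_onto_def)
  also have "\<dots> = q (p z)"
    using assms by simp
  also have "\<dots> = p z"
    using assms by (simp add: projection_onto_def)
  finally show "q z = p z" .
qed

section \<open>Compact elements and the double commutant theorem\<close>

lemma J_compose: "a \<in> A \<Longrightarrow> k \<in> J \<Longrightarrow> a o\<^sub>L k \<in> J"
  using A_bounded_ops by (auto intro: A_compose compact_ops_left)

text \<open>The common kernel \<open>N\<close> of \<open>J\<close> is a submodule, because
  \<open>J\<close> is a right ideal. A projection p in \<open>B\<close> onto \<open>N\<close>
  satisfies p k = k p = 0 for k in \<open>J\<close>, so it vanishes on the ranges of
  \<open>J\<close>, which span a dense subspace. Hence p = 0 and \<open>N\<close> is
  trivial.\<close>

lemma ex_compact_nonzero: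
  assumes "x \<noteq> 0"
  shows "\<exists>k\<in>J. k x \<noteq> 0"
proof (rule ccontr)
  assume contra: "\<not> ?thesis"
  define N where "N = {x. \<forall>k\<in>J. k x = 0}"
  have "invariant_subspace A N"
    unfolding invariant_subspace_def
  proof (intro conjI ballI)
    show "csubspace N"
      by (rule csubspaceI) (auto simp: N_def blinfun.bilinear_simps A_scaleC)
    have "N = (\<Inter>k\<in>J. blinfun_apply k -` {0})"
      by (auto simp: N_def)
    also have "closed \<dots>"
      by (intro closed_INT ballI closed_vimage closed_singleton) (auto intro!: continuous_intros)
    finally show "closed N" .
    fix a x assume a: "a \<in> A" "x \<in> N"
    \<comment> \<open>The right ideal property: \<open>a\<close> maps the unit ball into a ball of
      radius norm a, whose image under \<open>k\<close> is a multiple of a relatively compact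
      set.\<close>
    have *: "k o\<^sub>L a \<in> J" if k: "k \<in> J" for k
    proof -
      have "compact (closure (blinfun_apply (k o\<^sub>L a) ` cball 0 1))"
      proof -
        have c: "compact ((\<lambda>x. norm a *\<^sub>R x) ` closure (blinfun_apply k ` cball 0 1))"
          using k by (intro compact_continuous_image compact_opsD continuous_intros) auto
        have "blinfun_apply (k o\<^sub>L a) ` cball 0 1 \<subseteq> (\<lambda>x. norm a *\<^sub>R x) ` closure (blinfun_apply k ` cball 0 1)"
        proof (rule image_subsetI)
          fix x :: 'a assume x: "x \<in> cball 0 1"
          show "(k o\<^sub>L a) x \<in> (\<lambda>x. norm a *\<^sub>R x) ` closure (blinfun_apply k ` cball 0 1)"
          proof (cases "a = 0")
            case True
            have "k 0 \<in> closure (blinfun_apply k ` cball 0 1)"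
              by (rule subsetD[OF closure_subset]) (intro imageI; simp)
            then show ?thesis
              using True by (auto simp: blinfun.bilinear_simps intro!: image_eqI)
          next
            case False
            have "norm (a x) \<le> norm a * norm x"
              by (rule norm_blinfun)
            also have "\<dots> \<le> norm a"
              using x by (simp add: mult_left_le)
            finally have "norm ((1 / norm a) *\<^sub>R a x) \<le> 1"
              using False by simp
            then have "k ((1 / norm a) *\<^sub>R a x) \<in> closure (blinfun_apply k ` cball 0 1)"
              by (intro subsetD[OF closure_subset] imageI) simp
            moreover have "(k o\<^sub>L a) x = norm a *\<^sub>R k ((1 / norm a) *\<^sub>R a x)"
              using False by (simp add: blinfun.bilinear_simps)
            ultimately show ?thesis
              by blast
          qed
        qed
        then show ?thesis
          by (rule compact_closure_subset[OF c])
      qed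
      then show ?thesis
        using k a A_compose A_bounded_ops by (auto simp: compact_ops_def)
    qed
    have "(k o\<^sub>L a) x = 0" if "k \<in> J" for k
      using a(2) *[OF that] unfolding N_def by blast
    then show "a x \<in> N"
      by (simp add: N_def)
  qed
  then obtain p where p: "p \<in> B" "projection_onto N p"
    using projection_in_commutant by blast
  note p' = projection_ontoD[OF p(2)]
  have zero: "p (blinfun_apply k y) = 0" if k: "k \<in> J" for k y
  proof -
    have "p (k y) = k (p y)"
      using k p by (auto intro: commutantD)
    also have "\<dots> = 0"
      using p'(2)[of y] k by (auto simp: N_def)
    finally show ?thesis .
  qed
  have "invariant_subspace {} {y. p y = 0}"
    using projection_onto_vanishing[OF invariant_subspace_UNIV p(2), of "{}"] by simp
  then have Y: "csubspace {y. p y = 0}" "closed {y. p y = 0}"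
    by (auto simp: invariant_subspace_def)
  have "cspan {blinfun_apply k y | k y. k \<in> J} \<subseteq> {y. p y = 0}"
    using zero by (intro complex_vector.span_minimal Y) auto
  then have "closure (cspan {blinfun_apply k y | k y. k \<in> J}) \<subseteq> {y. p y = 0}"
    by (rule closure_minimal[OF _ Y(2)])
  then have "p x = 0"
    using compacts by (auto simp: nondegenerate_def)
  moreover have "p x = x"
    using contra by (intro p') (auto simp: N_def)
  ultimately show False
    using assms by simp
qed

lemma orbit_submodule: "submodule A (closure {ampliation a x | a. a \<in> A})" (is "submodule A (closure ?X)")
proof -
  have "csubspace ?X"
  proof (rule csubspaceI)
    have zero: "ampliation 0 x = 0" and add: "ampliation (a + b) x = ampliation a x + ampliation b x"
      and scale: "ampliation (c *\<^sub>C a) x = c *\<^sub>C ampliation a x" for a b c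
      by (rule ell2_eqI; simp add: blinfun.bilinear_simps)+
    show "0 \<in> ?X"
      using csubspace_0[OF A_subspace] zero by force
    show "u + v \<in> ?X" if "u \<in> ?X" "v \<in> ?X" for u v
      using that csubspace_add[OF A_subspace] add by (auto, metis)
    show "c *\<^sub>C u \<in> ?X" if "u \<in> ?X" for c u
      using that csubspace_scale[OF A_subspace] scale by (auto, metis)
  qed
  have inv: "ampliation a u \<in> ?X" if a: "a \<in> A" and u: "u \<in> ?X" for a u
  proof -
    obtain a' where "a' \<in> A" "u = ampliation a' x"
      using u by blast
    moreover have "ampliation a (ampliation a' x) = ampliation (a o\<^sub>L a') x" for a'
      by (rule ell2_eqI) simp
    ultimately show ?thesis
      using A_compose[OF a] by auto
  qed
  show ?thesis
    unfolding submodule_def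
  proof (intro conjI ballI csubspace_closure \<open>csubspace ?X\<close> closed_closure)
    fix a u assume a: "a \<in> A" and "u \<in> closure ?X"
    have "ampliation a ` closure ?X \<subseteq> closure ?X"
      using closure_subset inv[OF a]
      by (intro image_closure_subset continuous_intros closed_closure image_subsetI subsetD[OF closure_subset])
    then show "ampliation a u \<in> closure ?X"
      using \<open>u \<in> closure ?X\<close> by blast
  qed
qed

text \<open>\<open>A\<close> is not assumed to contain the identity. For a module projection
  \<open>P\<close> onto the orbit closure, every k in \<open>J\<close> maps x - P x to k x - P (k x)
  = 0, and coordinatewise a vector killed by all of \<open>J\<close> is zero.\<close>

lemma in_closure_orbit: "x \<in> closure {ampliation a x | a. a \<in> A}" (is "x \<in> closure ?X")
proof -
  obtain P where P: "module_projection A (closure ?X) P"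
    using projections[OF orbit_submodule] by blast
  have "x - P x = 0"
  proof (rule ell2_eqI, rule ccontr)
    fix i assume "ell2_nth (x - P x) i \<noteq> ell2_nth 0 i"
    then have "ell2_nth (x - P x) i \<noteq> 0"
      by simp
    then obtain k where k: "k \<in> J" "k (ell2_nth (x - P x) i) \<noteq> 0"
      using ex_compact_nonzero by blast
    have "ampliation k x \<in> closure ?X"
      using k(1) closure_subset[of ?X] by blast
    then have "P (ampliation k x) = ampliation k x"
      using P by (simp add: module_projection_def)
    then have "ampliation k (x - P x) = 0"
      using P k(1) by (simp add: module_projection_def linear_diff[OF ampliation_linear])
    from arg_cong[OF this, of "\<lambda>z. ell2_nth z i"] k(2) show False
      by simp
  qed
  then show ?thesis
    using P by (simp add: module_projection_def) (metis (no_types, lifting))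
qed

text \<open>A sigma-weak neighbourhood is controlled by one vector x of \<open>'a ell2\<close>, so
  it suffices to approximate \<open>ampliation T x\<close> by the orbit of x. A module projection
  onto the orbit closure has its entries in \<open>B\<close>, hence commutes with
  \<open>ampliation T\<close>; so the orbit closure is invariant under it, and it contains
  x.\<close>

lemma double_commutant:
  assumes closed: "closedin sigma_weak_topology A"
    and T: "T \<in> bounded_ops" "\<And>b x. b \<in> B \<Longrightarrow> T (b x) = b (T x)"
  shows "T \<in> A"
proof (rule ccontr)
  assume "T \<notin> A"
  have "T \<in> topspace sigma_weak_topology"
    unfolding sigma_weak_topology_def topology_generated_by_topspace
    using T(1) by blast
  then obtain x e where e: "e > 0"
    "\<And>S. S \<in> bounded_ops \<Longrightarrow> norm (ampliation S x - ampliation T x) < e \<Longrightarrow> S \<in> topspace sigma_weak_topology - A"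
    using sigma_weak_neighbourhood[of "topspace sigma_weak_topology - A" T] closed \<open>T \<notin> A\<close>
    unfolding closedin_def by blast
  obtain P where P: "module_projection A (closure {ampliation a x | a. a \<in> A}) P"
    using projections[OF orbit_submodule] by blast
  have coord: "P (ampliation T (at_coord j v)) = ampliation T (P (at_coord j v))" for j v
    by (rule ell2_eqI) (simp add: T(2)[OF entry_commutant[OF P]] flip: entry_apply)
  have "P (ampliation T z) = ampliation T (P z)" for z
  proof (rule LIMSEQ_unique)
    let ?z = "\<lambda>n. \<Sum>i<n. at_coord i (ell2_nth z i)"
    show "(\<lambda>n. P (ampliation T (?z n))) \<longlonglongrightarrow> P (ampliation T z)"
      by (intro blinfun.tendsto tendsto_const bounded_linear.tendsto[OF bounded_linear_ampliation] ell2_truncation_tendsto)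
    have "P (ampliation T (?z n)) = ampliation T (P (?z n))" for n
      by (simp add: linear_sum[OF ampliation_linear] blinfun.sum_right coord del: ampliation_at_coord)
    moreover have "(\<lambda>n. ampliation T (P (?z n))) \<longlonglongrightarrow> ampliation T (P z)"
      by (intro blinfun.tendsto tendsto_const bounded_linear.tendsto[OF bounded_linear_ampliation] ell2_truncation_tendsto)
    ultimately show "(\<lambda>n. P (ampliation T (?z n))) \<longlonglongrightarrow> ampliation T (P z)"
      by simp
  qed
  from this[of x] have "P (ampliation T x) = ampliation T x"
    using P in_closure_orbit[of x] by (simp add: module_projection_def)
  moreover have "P (ampliation T x) \<in> closure {ampliation a x | a. a \<in> A}"
    using P unfolding module_projection_def by blast
  ultimately have "ampliation T x \<in> closure {ampliation a x | a. a \<in> A}"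
    by simp
  then obtain a where "a \<in> A" "norm (ampliation a x - ampliation T x) < e"
    using e(1) unfolding closure_approachable dist_norm by blast
  then show False
    using e(2)[of a] A_bounded_ops by auto
qed

end

section \<open>The fixed point theorems of Schauder and Lomonosov\<close>

text \<open>The dimension depends on the size of a finite net found inside a proof, so it cannot be
  part of a type; points are functions that vanish from index n on.\<close>

definition unit_cube :: "nat \<Rightarrow> (nat \<Rightarrow> real) set"
  where "unit_cube n = {x. (\<forall>i<n. 0 \<le> x i \<and> x i \<le> 1) \<and> (\<forall>i\<ge>n. x i = 0)}"

lemma compact_unit_cube: "compact (unit_cube n)"
proof -
  have "unit_cube n = PiE UNIV (\<lambda>i. if i < n then {0..1} else {0})"
    by (auto simp: unit_cube_def PiE_def Pi_def not_less split: if_splits)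
  moreover have "compactin euclidean (PiE UNIV (\<lambda>i. if i < n then {0..1} else {0 :: real}))"
    unfolding euclidean_product_topology[symmetric] compactin_PiE by simp
  ultimately show ?thesis
    by simp
qed

text \<open>The metric on functions is a sum with weights (1 / 2)^n, whose total is 2.\<close>

lemma dist_fun_uniform:
  fixes x y :: "nat \<Rightarrow> real"
  assumes "\<And>i. \<bar>x i - y i\<bar> \<le> d"
  shows "dist x y \<le> 2 * d"
proof -
  have d: "0 \<le> d"
    using assms[of 0] by simp
  have sm: "summable (\<lambda>n. (1 / 2 :: real) ^ n)"
    by (simp add: summable_geometric_iff)
  have "dist x y \<le> (\<Sum>n. (1 / 2) ^ n * d)"
    unfolding dist_fun_def
  proof (rule suminf_le)
    have b: "min (dist (x (from_nat n)) (y (from_nat n))) 1 \<le> min d 1" for n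
      using assms[of "from_nat n"] by (auto simp: dist_real_def)
    show "(1 / 2) ^ n * min (dist (x (from_nat n)) (y (from_nat n))) 1 \<le> (1 / 2) ^ n * d" for n
      using b[of n] by (intro mult_left_mono) auto
    show "summable (\<lambda>n. (1 / 2) ^ n * min (dist (x (from_nat n)) (y (from_nat n))) 1)"
      by (rule summable_comparison_test'[OF sm]) auto
  qed (intro summable_mult2 sm)
  also have "\<dots> = 2 * d"
    using suminf_mult2[OF sm, of d] suminf_geometric[of "1 / 2 :: real"] by simp
  finally show ?thesis .
qed

text \<open>Kuhn's lemma on the grid of mesh 1 / p provides a small cell in which, for every i, f x
  i - x i is nonnegative at one vertex and nonpositive at another; uniform continuity then makes it
  small. An approximate fixed point is enough, as \<open>schauder\<close> passes to a limit
  anyway.\<close>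

lemma brouwer_unit_cube_approx:
  fixes f :: "(nat \<Rightarrow> real) \<Rightarrow> nat \<Rightarrow> real"
  assumes cont: "\<And>i. i < n \<Longrightarrow> continuous_on (unit_cube n) (\<lambda>x. f x i)"
    and range: "\<And>x i. x \<in> unit_cube n \<Longrightarrow> i < n \<Longrightarrow> 0 \<le> f x i \<and> f x i \<le> 1"
    and e: "0 < e"
  shows "\<exists>x\<in>unit_cube n. \<forall>i<n. \<bar>f x i - x i\<bar> \<le> e"
proof -
  have "\<exists>d>0. \<forall>x\<in>unit_cube n. \<forall>y\<in>unit_cube n. dist y x < d \<longrightarrow> dist (f y i) (f x i) < e / 2" if "i < n" for i
    using compact_uniformly_continuous[OF cont[OF that] compact_unit_cube] e
    unfolding uniformly_continuous_on_def by (meson half_gt_zero)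
  then obtain D where D: "\<And>i. i < n \<Longrightarrow> D i > 0"
    "\<And>i x y. i < n \<Longrightarrow> x \<in> unit_cube n \<Longrightarrow> y \<in> unit_cube n \<Longrightarrow> dist y x < D i \<Longrightarrow> dist (f y i) (f x i) < e / 2"
    by metis
  define d where "d = Min (insert (e / 2) (D ` {..<n}))"
  have d: "d > 0"
    using D(1) e unfolding d_def by (subst Min_gr_iff) auto
  have de: "d \<le> e / 2"
    unfolding d_def by (intro Min_le) auto
  have unif: "\<bar>f y i - f x i\<bar> < e / 2" if "i < n" "x \<in> unit_cube n" "y \<in> unit_cube n" "dist y x < d" for i x y
  proof -
    have "d \<le> D i"
      using that(1) unfolding d_def by (intro Min_le) auto
    then show ?thesis
      using D(2)[OF that(1-3)] that(4) by (simp add: dist_real_def)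
  qed
  \<comment> \<open>Vertices of a cell differ from its corner by at most 1 / p in each coordinate,
    hence by 2 / p < d in the metric, by \<open>dist_fun_uniform\<close>.\<close>
  obtain p :: nat where p: "2 / d < real p"
    using reals_Archimedean2 by blast
  have "0 < 2 / d"
    using d by simp
  then have p0: "0 < real p"
    using p by linarith
  then have "0 < p"
    by simp
  have pd: "2 / real p < d"
    using p p0 d by (simp add: field_simps)
  define pt where "pt q i = (if i < n then real (q i) / real p else 0)" for q :: "nat \<Rightarrow> nat" and i
  have pt: "pt q \<in> unit_cube n" if "\<forall>i<n. q i \<le> p" for q
    using that p0 by (auto simp: pt_def unit_cube_def)
  \<comment> \<open>The values on the faces are those that Kuhn's lemma prescribes; they agree with
    the sign of f x i - x i there because \<open>f\<close> has values in [0, 1].\<close>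
  define label where "label q i = (if q i = 0 then 0 else if q i = p then 1 else if pt q i \<le> f (pt q) i then 0 else (1 :: nat))" for q i
  have label0: "pt q i \<le> f (pt q) i" if "i < n" "\<forall>i<n. q i \<le> p" "label q i = 0" for q i
    using that range[OF pt[OF that(2)] that(1)] p0 by (auto simp: label_def pt_def split: if_splits)
  have label1: "f (pt q) i \<le> pt q i" if "i < n" "\<forall>i<n. q i \<le> p" "label q i \<noteq> 0" for q i
    using that range[OF pt[OF that(2)] that(1)] p0 by (auto simp: label_def pt_def split: if_splits)
  obtain q where q: "\<forall>i<n. q i < p"
    "\<forall>i<n. \<exists>r s. (\<forall>j<n. q j \<le> r j \<and> r j \<le> q j + 1) \<and> (\<forall>j<n. q j \<le> s j \<and> s j \<le> q j + 1) \<and> label r i \<noteq> label s i"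
    by (rule kuhn_lemma[of p n label]) (use \<open>0 < p\<close> in \<open>auto simp: label_def\<close>)
  have qp: "\<forall>i<n. q i \<le> p"
    using q(1) by (simp add: less_imp_le)
  have near: "\<forall>j<n. r j \<le> p" "pt q i \<le> pt r i" "pt r i \<le> pt q i + e / 2" "\<bar>f (pt r) i - f (pt q) i\<bar> < e / 2"
    if i: "i < n" and r: "\<forall>j<n. q j \<le> r j \<and> r j \<le> q j + 1" for i r
  proof -
    show rp: "\<forall>j<n. r j \<le> p"
      using r q(1) by (metis Suc_eq_plus1 Suc_leI order_trans)
    show "pt q i \<le> pt r i"
      using i r p0 by (simp add: pt_def divide_right_mono)
    have diff: "\<bar>pt r j - pt q j\<bar> \<le> 1 / real p" for j
    proof (cases "j < n")
      case True
      then have "real (r j) - real (q j) \<le> 1" "0 \<le> real (r j) - real (q j)"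
        using r by (auto simp: algebra_simps)
      then show ?thesis
        using p0 True by (simp add: pt_def divide_right_mono flip: diff_divide_distrib)
    qed (simp add: pt_def)
    have "1 / real p \<le> 2 / real p"
      by (simp add: divide_right_mono)
    then have "1 / real p \<le> e / 2"
      using pd de by linarith
    then show "pt r i \<le> pt q i + e / 2"
      using diff[of i] by linarith
    have "dist (pt r) (pt q) \<le> 2 * (1 / real p)"
      by (rule dist_fun_uniform) (rule diff)
    then show "\<bar>f (pt r) i - f (pt q) i\<bar> < e / 2"
      using pd by (intro unif i pt qp rp) auto
  qed
  have "\<bar>f (pt q) i - pt q i\<bar> \<le> e" if i: "i < n" for i
  proof -
    obtain r s where rs: "\<forall>j<n. q j \<le> r j \<and> r j \<le> q j + 1" "\<forall>j<n. q j \<le> s j \<and> s j \<le> q j + 1" "label r i \<noteq> label s i"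
      using q(2)[rule_format, OF i] by blast
    have *: "\<bar>f (pt q) i - pt q i\<bar> \<le> e" if "\<forall>j<n. q j \<le> r j \<and> r j \<le> q j + 1"
      "\<forall>j<n. q j \<le> s j \<and> s j \<le> q j + 1" "label r i = 0" "label s i \<noteq> 0" for r s
      using near[OF i that(1)] near[OF i that(2)] label0[OF i near(1)[OF i that(1)] that(3)] label1[OF i near(1)[OF i that(2)] that(4)]
      by linarith
    show ?thesis
      using rs *[of r s] *[of s r] by (cases "label r i = 0") (auto simp: label_def split: if_splits)
  qed
  then show ?thesis
    using pt[OF qp] by blast
qed

text \<open>The compact set \<open>T\<close> has a finite net \<open>p\<close> of mesh e / 2. The
  weights \<beta> of F (P x) with respect to the net define a map of a finite-dimensional cube into
  itself, to which the approximate form of Brouwer's theorem applies.\<close>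

lemma schauder_approx:
  fixes F :: "'a::real_normed_vector \<Rightarrow> 'a"
  assumes U: "convex U" "U \<noteq> {}" and F: "continuous_on U F" "F ` U \<subseteq> T" and T: "compact T" "T \<subseteq> U"
    and e: "0 < e"
  shows "\<exists>x\<in>U. norm (F x - x) < e"
proof -
  obtain C where C: "finite C" "C \<subseteq> T" "T \<subseteq> (\<Union>c\<in>C. ball c (e / 2))"
    using compactE_image[OF T(1), of T "\<lambda>c. ball c (e / 2)"] e by (metis UN_I centre_in_ball half_gt_zero open_ball subsetI)
  have "T \<noteq> {}"
    using U(2) F(2) by blast
  then have "C \<noteq> {}"
    using C(3) by blast
  obtain n :: nat and p where p: "C = p ` {..<n}" "inj_on p {..<n}"
    using finite_imp_nat_seg_image_inj_on[OF C(1)] unfolding lessThan_def by metis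
  have n: "0 < n"
    using p \<open>C \<noteq> {}\<close> by auto
  have pT: "p i \<in> T" if "i < n" for i
    using C(2) p(1) that by blast
  define w where "w i y = max 0 (e / 2 - norm (y - p i))" for i y
  define W where "W y = (\<Sum>i<n. w i y)" for y
  define \<beta> where "\<beta> i y = w i y / W y" for i y
  have w: "0 \<le> w i y" for i y
    by (simp add: w_def)
  have W: "0 < W y" if y: "y \<in> T" for y
  proof -
    obtain i where i: "i < n" "norm (y - p i) < e / 2"
      using subsetD[OF C(3) y] p(1) by (auto simp: dist_norm norm_minus_commute)
    have "w i y \<le> W y"
      unfolding W_def using i(1) w by (intro member_le_sum) auto
    then show ?thesis
      using i by (simp add: w_def)
  qed
  have \<beta>: "0 \<le> \<beta> i y" "(\<Sum>i<n. \<beta> i y) = 1" if "y \<in> T" for i y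
    using W[OF that] w by (simp_all add: \<beta>_def less_imp_le W_def flip: sum_divide_distrib)
  have \<beta>1: "\<beta> i y \<le> 1" if "y \<in> T" "i < n" for i y
  proof -
    have "\<beta> i y \<le> (\<Sum>i<n. \<beta> i y)"
      using that \<beta>(1)[OF that(1)] by (intro member_le_sum) auto
    then show ?thesis
      using \<beta>(2)[OF that(1)] by simp
  qed
  have \<beta>_near: "norm ((\<Sum>i<n. \<beta> i y *\<^sub>R p i) - y) \<le> e / 2" if y: "y \<in> T" for y
  proof -
    have "(\<Sum>i<n. \<beta> i y *\<^sub>R p i) - y = (\<Sum>i<n. \<beta> i y *\<^sub>R p i) - (\<Sum>i<n. \<beta> i y) *\<^sub>R y"
      using \<beta>(2)[OF y] by simp
    also have "\<dots> = (\<Sum>i<n. \<beta> i y *\<^sub>R (p i - y))"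
      by (simp add: scaleR_sum_left sum_subtractf algebra_simps)
    also have "norm \<dots> \<le> (\<Sum>i<n. \<beta> i y * (e / 2))"
    proof (rule sum_norm_le)
      fix i
      have "\<beta> i y * norm (p i - y) \<le> \<beta> i y * (e / 2)"
      proof (cases "\<beta> i y = 0")
        case False
        then have "norm (y - p i) < e / 2"
          by (auto simp: \<beta>_def w_def)
        then show ?thesis
          using \<beta>(1)[OF y, of i] by (intro mult_left_mono) (auto simp: norm_minus_commute)
      qed simp
      then show "norm (\<beta> i y *\<^sub>R (p i - y)) \<le> \<beta> i y * (e / 2)"
        using \<beta>(1)[OF y, of i] by simp
    qed
    also have "\<dots> = e / 2"
      unfolding sum_distrib_right[symmetric] \<beta>(2)[OF y] by simp
    finally show ?thesis .
  qed
  define s where "s x = (\<Sum>i<n. x i)" for x :: "nat \<Rightarrow> real"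
  \<comment> \<open>A retraction of the cube to the simplex: missing mass is spread evenly, excess
    mass is divided out. It is needed since the fixed point theorem is available for cubes, while
    convex combinations need weights of sum 1.\<close>
  define \<gamma> where "\<gamma> x i = (x i + max 0 (1 - s x) / real n) / max 1 (s x)" for x i
  define P where "P x = (\<Sum>i<n. \<gamma> x i *\<^sub>R p i)" for x
  have \<gamma>_sum: "(\<Sum>i<n. \<gamma> x i) = 1" for x
  proof -
    have "(\<Sum>i<n. \<gamma> x i) = (s x + max 0 (1 - s x)) / max 1 (s x)"
      using n by (simp add: \<gamma>_def s_def sum.distrib flip: sum_divide_distrib)
    also have "\<dots> = 1"
      by (cases "s x \<le> 1") auto
    finally show ?thesis .
  qed
  have PU: "P x \<in> U" if "x \<in> unit_cube n" for x
    unfolding P_def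
  proof (rule convex_sum[OF _ U(1)])
    show "0 \<le> \<gamma> x i" if "i \<in> {..<n}" for i
      using \<open>x \<in> unit_cube n\<close> that by (simp add: \<gamma>_def unit_cube_def)
  qed (use \<gamma>_sum pT T(2) in auto)
  have PT: "F (P x) \<in> T" if "x \<in> unit_cube n" for x
    using PU[OF that] F(2) by blast
  have cont_P: "continuous_on (unit_cube n) P"
  proof -
    have c: "continuous_on (unit_cube n) (\<lambda>x. x i)" for i :: nat
      by (rule continuous_on_subset[OF continuous_on_product_coordinates]) simp
    show ?thesis
      unfolding P_def \<gamma>_def s_def using n
      by (intro continuous_intros c) (auto simp: max_def)
  qed
  have cont_\<beta>: "continuous_on (unit_cube n) (\<lambda>x. \<beta> i (F (P x)))" for i
  proof -
    have FP: "continuous_on (unit_cube n) (\<lambda>x. F (P x))"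
      by (rule continuous_on_compose2[OF F(1) cont_P]) (use PU in auto)
    show ?thesis
      unfolding \<beta>_def W_def w_def
      by (intro continuous_intros FP) (use W[OF PT] in \<open>force simp: W_def w_def\<close>)
  qed
  define M where "M = (\<Sum>i<n. norm (p i)) + 1"
  have M: "M > 0"
    by (simp add: M_def add_nonneg_pos sum_nonneg)
  \<comment> \<open>The weights \<gamma> x i and \<beta> i differ by at most (n + 1) \<delta>, and
    the norms of the p i add up to less than \<open>M\<close>. This makes the error e / 4; another e
    / 2 is due to the net.\<close>
  define \<delta> where "\<delta> = e / (4 * (real n + 1) * M)"
  have \<delta>: "\<delta> > 0"
    using e M by (simp add: \<delta>_def)
  obtain x where x: "x \<in> unit_cube n" "\<And>i. i < n \<Longrightarrow> \<bar>\<beta> i (F (P x)) - x i\<bar> \<le> \<delta>"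
    using brouwer_unit_cube_approx[of n "\<lambda>x i. \<beta> i (F (P x))" \<delta>] cont_\<beta> \<beta>(1)[OF PT] \<beta>1[OF PT] \<delta> by blast
  have s1: "\<bar>1 - s x\<bar> \<le> real n * \<delta>"
  proof -
    have "1 - s x = (\<Sum>i<n. \<beta> i (F (P x)) - x i)"
      by (simp add: sum_subtractf \<beta>(2)[OF PT[OF x(1)]] s_def)
    also have "\<bar>\<dots>\<bar> \<le> (\<Sum>i<n. \<delta>)"
      using x(2) by (intro order_trans[OF sum_abs sum_mono]) auto
    finally show ?thesis
      by simp
  qed
  have \<gamma>x: "\<bar>\<gamma> x i - x i\<bar> \<le> \<bar>1 - s x\<bar>" if i: "i < n" for i
  proof (cases "s x \<le> 1")
    case True
    then have "\<gamma> x i - x i = (1 - s x) / real n"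
      by (simp add: \<gamma>_def)
    moreover have "(1 - s x) / real n \<le> (1 - s x) / 1"
      using n True by (intro divide_left_mono) auto
    ultimately show ?thesis
      using True n by simp
  next
    case False
    have "x i - \<gamma> x i = x i * ((s x - 1) / s x)"
      using False by (simp add: \<gamma>_def field_simps)
    moreover have xi: "0 \<le> x i" "x i \<le> 1"
      using x(1) i by (auto simp: unit_cube_def)
    have t: "0 \<le> (s x - 1) / s x" "(s x - 1) / s x \<le> s x - 1"
      using False divide_left_mono[of 1 "s x" "s x - 1"] by auto
    have "0 \<le> x i * ((s x - 1) / s x)"
      using xi t by (intro mult_nonneg_nonneg)
    moreover have "x i * ((s x - 1) / s x) \<le> 1 * (s x - 1)"
      using xi t by (intro mult_mono) auto
    ultimately have "0 \<le> x i - \<gamma> x i" "x i - \<gamma> x i \<le> s x - 1"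
      by (simp_all only: mult_1)
    then show ?thesis
      using False by linarith
  qed
  have "norm (P x - (\<Sum>i<n. \<beta> i (F (P x)) *\<^sub>R p i)) \<le> (\<Sum>i<n. ((real n + 1) * \<delta>) * norm (p i))"
  proof -
    have "P x - (\<Sum>i<n. \<beta> i (F (P x)) *\<^sub>R p i) = (\<Sum>i<n. (\<gamma> x i - \<beta> i (F (P x))) *\<^sub>R p i)"
      by (simp add: P_def sum_subtractf scaleR_diff_left)
    also have "norm \<dots> \<le> (\<Sum>i<n. ((real n + 1) * \<delta>) * norm (p i))"
    proof (rule sum_norm_le)
      fix i assume i: "i \<in> {..<n}"
      have "\<bar>\<gamma> x i - \<beta> i (F (P x))\<bar> \<le> (real n + 1) * \<delta>"
        using \<gamma>x[of i] x(2)[of i] s1 i unfolding distrib_right mult_1 lessThan_iff by linarith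
      then show "norm ((\<gamma> x i - \<beta> i (F (P x))) *\<^sub>R p i) \<le> ((real n + 1) * \<delta>) * norm (p i)"
        by (simp add: mult_right_mono)
    qed
    finally show ?thesis .
  qed
  also have "\<dots> \<le> ((real n + 1) * \<delta>) * M"
    unfolding sum_distrib_left[symmetric] M_def using \<delta> by (intro mult_left_mono) auto
  also have "\<dots> = e / 4"
  proof -
    have "q * (e / (4 * q * M)) * M = e / 4" if "q > 0" for q
      using M that by (simp add: field_simps)
    from this[of "real n + 1"] show ?thesis
      by (simp add: \<delta>_def)
  qed
  finally have "norm (P x - (\<Sum>i<n. \<beta> i (F (P x)) *\<^sub>R p i)) \<le> e / 4" .
  then have "norm (F (P x) - P x) \<le> e / 4 + e / 2"
    using \<beta>_near[OF PT[OF x(1)]] norm_triangle_ineq[of "P x - (\<Sum>i<n. \<beta> i (F (P x)) *\<^sub>R p i)" "(\<Sum>i<n. \<beta> i (F (P x)) *\<^sub>R p i) - F (P x)"]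
    by (simp add: norm_minus_commute)
  then show ?thesis
    using PU[OF x(1)] e by (intro bexI[of _ "P x"]) auto
qed

text \<open>Compactness of \<open>T\<close> makes the images of approximate fixed points converge
  along a subsequence. The points themselves then have the same limit.\<close>

theorem schauder:
  fixes F :: "'a::real_normed_vector \<Rightarrow> 'a"
  assumes U: "convex U" "U \<noteq> {}" and F: "continuous_on U F" "F ` U \<subseteq> T" and T: "compact T" "T \<subseteq> U"
  shows "\<exists>x\<in>T. F x = x"
proof -
  have "\<exists>x\<in>U. norm (F x - x) < 1 / real (Suc n)" for n
    by (rule schauder_approx[OF assms]) simp
  then obtain X where X: "\<And>n. X n \<in> U" "\<And>n. norm (F (X n) - X n) < 1 / real (Suc n)"
    by metis
  have "\<forall>n. F (X n) \<in> T"
    using F(2) X(1) by blast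
  then obtain l r where l: "l \<in> T" "strict_mono r" "((\<lambda>n. F (X n)) \<circ> r) \<longlonglongrightarrow> l"
    using T(1) unfolding compact_def by meson
  have "(\<lambda>n. F (X n) - X n) \<longlonglongrightarrow> 0"
    using X(2) by (intro Lim_null_comparison[OF _ LIMSEQ_inverse_real_of_nat])
      (auto simp: inverse_eq_divide intro!: always_eventually less_imp_le)
  then have "((\<lambda>n. F (X n) - X n) \<circ> r) \<longlonglongrightarrow> 0"
    using l(2) by (rule LIMSEQ_subseq_LIMSEQ)
  from tendsto_diff[OF l(3) this] have Xl: "(X \<circ> r) \<longlonglongrightarrow> l"
    by (simp add: o_def)
  have "(\<lambda>n. F ((X \<circ> r) n)) \<longlonglongrightarrow> F l"
    using F(1) l(1) T(2) X(1) by (intro continuous_on_tendsto_compose[OF F(1) Xl]) (auto simp: o_def)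
  then have "F l = l"
    using l(3) unfolding o_def by (rule LIMSEQ_unique)
  then show ?thesis
    using l(1) by blast
qed

text \<open>The map \<open>x \<mapsto> \<Sum>i. \<beta>\<^sub>i (k x) c\<^sub>i (k x)\<close>, with a partition of unity \<open>\<beta>\<close> subordinate to sets that
  the \<open>c\<^sub>i\<close> move into a given ball, maps this ball compactly into itself.\<close>

lemma lomonosov:
  fixes V :: "'a::complex_inner set" and C :: "('a \<Rightarrow>\<^sub>L 'a) set"
  assumes V: "subspace V" "closed V"
    and C: "subspace C" "\<And>c x. c \<in> C \<Longrightarrow> x \<in> V \<Longrightarrow> blinfun_apply c x \<in> V"
    and dense: "\<And>x. x \<in> V \<Longrightarrow> x \<noteq> 0 \<Longrightarrow> V \<subseteq> closure {blinfun_apply c x | c. c \<in> C}"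
    and k: "k \<in> compact_ops" "\<And>x. x \<in> V \<Longrightarrow> k x \<in> V" "x1 \<in> V" "k x1 \<noteq> 0"
  shows "\<exists>c\<in>C. \<exists>u\<in>V. u \<noteq> 0 \<and> c (k u) = u"
proof -
  have nk: "norm k > 0" "norm (k x1) > 0"
    using k(4) by auto
  \<comment> \<open>On the ball of this radius k x differs from k x1 by at most half of norm (k x1),
    so \<open>k\<close> stays away from 0. The radius is also below norm x1, which keeps 0 out of
    the ball.\<close>
  define r where "r = norm (k x1) / (2 * norm k)"
  have r: "r > 0"
    using nk by (simp add: r_def)
  have rx: "r < norm x1"
  proof -
    have "norm (k x1) \<le> norm k * norm x1"
      by (rule norm_blinfun)
    then have "r \<le> norm x1 / 2"
      using nk by (simp add: r_def field_simps)
    moreover have "x1 \<noteq> 0"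
      using k(4) by (auto simp: blinfun.zero_right)
    ultimately show ?thesis
      by (smt (verit) field_sum_of_halves zero_less_norm_iff)
  qed
  define U where "U = V \<inter> cball x1 r"
  have U: "convex U" "U \<noteq> {}" "closed U" "U \<subseteq> V"
    using k(3) r V by (auto simp: U_def subspace_imp_convex intro!: convex_Int closed_Int)
  define S where "S = closure (k ` U)"
  have kU: "norm (k x) \<ge> norm (k x1) / 2" if "x \<in> U" for x
  proof -
    have "norm (k x1 - k x) \<le> norm k * norm (x1 - x)"
      unfolding blinfun.diff_right[symmetric] by (rule norm_blinfun)
    also have "\<dots> \<le> norm k * r"
      using that by (intro mult_left_mono) (auto simp: U_def dist_norm)
    also have "\<dots> = norm (k x1) / 2"
      using nk by (simp add: r_def)
    finally show ?thesis
      using norm_triangle_ineq2[of "k x1" "k x"] by linarith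
  qed
  have S_ne: "y \<noteq> 0" if "y \<in> S" for y
  proof -
    have "S \<subseteq> {y. norm (k x1) / 2 \<le> norm y}"
      unfolding S_def using kU
      by (intro closure_minimal closed_Collect_le continuous_intros) auto
    then show ?thesis
      using that nk by auto
  qed
  have SV: "S \<subseteq> V"
    unfolding S_def using U(4) k(2) V(2) by (intro closure_minimal) auto
  have compS: "compact S"
  proof -
    define R where "R = norm x1 + r"
    have R: "R > 0"
      using r by (simp add: R_def add_nonneg_pos)
    have c: "compact ((\<lambda>x. R *\<^sub>R x) ` closure (blinfun_apply k ` cball 0 1))"
      by (intro compact_continuous_image compact_opsD k continuous_intros)
    show ?thesis
      unfolding S_def
    proof (rule compact_closure_subset[OF c], rule image_subsetI)
      fix x assume "x \<in> U"
      then have "norm x \<le> R"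
        using norm_triangle_ineq2[of x x1] by (auto simp: U_def R_def dist_norm norm_minus_commute)
      then have "k ((1 / R) *\<^sub>R x) \<in> closure (blinfun_apply k ` cball 0 1)"
        using R by (intro subsetD[OF closure_subset] imageI) simp
      moreover have "k x = R *\<^sub>R k ((1 / R) *\<^sub>R x)"
        using R by (simp add: blinfun.scaleR_right)
      ultimately show "k x \<in> (\<lambda>x. R *\<^sub>R x) ` closure (blinfun_apply k ` cball 0 1)"
        by blast
    qed
  qed
  define O' where "O' c = {y :: 'a. norm (blinfun_apply c y - x1) < r}" for c
  have op: "open (O' c)" for c
    unfolding O'_def by (intro open_Collect_less continuous_intros)
  \<comment> \<open>Points of \<open>S\<close> are nonzero, so their orbits under \<open>C\<close>
    are dense in \<open>V\<close> and meet the open ball around x1.\<close>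
  have "\<exists>c\<in>C. y \<in> O' c" if "y \<in> S" for y
  proof -
    have "x1 \<in> closure {blinfun_apply c y | c. c \<in> C}"
      using dense[of y] that SV S_ne k(3) by blast
    then show ?thesis
      using r unfolding closure_approachable O'_def dist_norm by blast
  qed
  then have "S \<subseteq> (\<Union>c\<in>C. O' c)"
    by blast
  then obtain D where D: "D \<subseteq> C" "finite D" "S \<subseteq> (\<Union>c\<in>D. O' c)"
    using compactE_image[OF compS, of C O'] op by blast
  define w where "w c y = max 0 (r - norm (blinfun_apply c y - x1))" for c and y :: 'a
  define W where "W y = (\<Sum>c\<in>D. w c y)" for y
  have w: "0 \<le> w c y" for c y
    by (simp add: w_def)
  have W: "0 < W y" if y: "y \<in> S" for y
  proof -
    obtain c where c: "c \<in> D" "norm (blinfun_apply c y - x1) < r"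
      using subsetD[OF D(3) y] by (auto simp: O'_def)
    have "w c y \<le> W y"
      unfolding W_def using c(1) w D(2) by (intro member_le_sum) auto
    then show ?thesis
      using c by (simp add: w_def)
  qed
  define \<Psi> where "\<Psi> y = (\<Sum>c\<in>D. (w c y / W y) *\<^sub>R blinfun_apply c y)" for y
  have \<Psi>U: "\<Psi> y \<in> U" if y: "y \<in> S" for y
  proof -
    have mem: "blinfun_apply c y \<in> U" if "c \<in> D" "w c y \<noteq> 0" for c
      using that C(2)[of c y] D(1) SV y by (auto simp: U_def w_def dist_norm norm_minus_commute max_def split: if_splits)
    have "\<Psi> y = (\<Sum>c\<in>{c\<in>D. w c y \<noteq> 0}. (w c y / W y) *\<^sub>R blinfun_apply c y)"
      unfolding \<Psi>_def using D(2) by (intro sum.mono_neutral_right) auto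
    also have "\<dots> \<in> U"
    proof (rule convex_sum[OF _ U(1)])
      have "(\<Sum>c\<in>{c\<in>D. w c y \<noteq> 0}. w c y / W y) = (\<Sum>c\<in>D. w c y / W y)"
        using D(2) by (intro sum.mono_neutral_left) auto
      also have "\<dots> = 1"
        using W[OF y] by (simp add: W_def flip: sum_divide_distrib)
      finally show "(\<Sum>c\<in>{c\<in>D. w c y \<noteq> 0}. w c y / W y) = 1" .
    qed (use D(2) mem w W[OF y] in auto)
    finally show ?thesis .
  qed
  have cont\<Psi>: "continuous_on S \<Psi>"
    unfolding \<Psi>_def W_def w_def
    by (intro continuous_intros) (use W in \<open>force simp: W_def w_def\<close>)
  have kS: "k x \<in> S" if "x \<in> U" for x
    unfolding S_def by (rule subsetD[OF closure_subset]) (use that in blast)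
  have "\<exists>u\<in>\<Psi> ` S. \<Psi> (k u) = u"
  proof (rule schauder[OF U(1,2)])
    show "continuous_on U (\<lambda>u. \<Psi> (k u))"
      by (rule continuous_on_compose2[OF cont\<Psi>]) (use kS in \<open>auto intro!: continuous_intros\<close>)
    show "compact (\<Psi> ` S)"
      by (rule compact_continuous_image[OF cont\<Psi> compS])
  qed (use \<Psi>U kS in auto)
  then obtain u where u: "u \<in> U" "\<Psi> (k u) = u"
    using \<Psi>U by blast
  \<comment> \<open>Freezing the coefficients at the fixed point turns the nonlinear map into a
    linear operator in \<open>C\<close>.\<close>
  define c where "c = (\<Sum>c\<in>D. (w c (k u) / W (k u)) *\<^sub>R c)"
  have "c \<in> C"
    unfolding c_def using D(1) by (intro subspace_sum C subspace_scale) auto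
  moreover have "c (k u) = u"
    using u(2) by (simp add: c_def \<Psi>_def blinfun.sum_left scaleR_blinfun.rep_eq)
  moreover have "u \<noteq> 0"
    using u(1) rx by (auto simp: U_def dist_norm)
  ultimately show ?thesis
    using u(1) U(4) by blast
qed

section \<open>Minimal invariant subspaces\<close>

definition minimal_invariant :: "('a::complex_inner \<Rightarrow>\<^sub>L 'a) set \<Rightarrow> 'a set \<Rightarrow> bool"
  where "minimal_invariant T Y \<longleftrightarrow> invariant_subspace T Y \<and> Y \<noteq> {0} \<and>
    (\<forall>Z\<subseteq>Y. invariant_subspace T Z \<longrightarrow> Z = {0} \<or> Z = Y)"

lemma minimal_invariantD:
  assumes "minimal_invariant T Y"
  shows "invariant_subspace T Y" "Y \<noteq> {0}"
    "Z \<subseteq> Y \<Longrightarrow> invariant_subspace T Z \<Longrightarrow> Z = {0} \<or> Z = Y"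
  using assms by (auto simp: minimal_invariant_def)

lemma csubspace_nonzero: "csubspace X \<Longrightarrow> X \<noteq> {0} \<Longrightarrow> \<exists>x\<in>X. x \<noteq> 0"
  using csubspace_0 by blast

lemma csubspace_chain_Union:
  assumes "subset.chain \<S> \<X>" "\<X> \<noteq> {}" "\<And>X. X \<in> \<X> \<Longrightarrow> csubspace X"
  shows "csubspace (\<Union>\<X>)"
proof (rule csubspaceI)
  show "0 \<in> \<Union>\<X>"
    using assms(2,3) csubspace_0 by blast
  fix x y assume "x \<in> \<Union>\<X>" "y \<in> \<Union>\<X>"
  then obtain X Y where XY: "X \<in> \<X>" "x \<in> X" "Y \<in> \<X>" "y \<in> Y"
    by blast
  then have "X \<subseteq> Y \<or> Y \<subseteq> X"
    using assms(1) by (auto simp: subset_chain_def)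
  then show "x + y \<in> \<Union>\<X>"
    using XY assms(3) csubspace_add by blast
qed (use assms(3) csubspace_scale in blast)

lemma invariant_subspace_chain_closure:
  assumes "subset.chain \<S> \<X>" "\<X> \<noteq> {}" "\<And>X. X \<in> \<X> \<Longrightarrow> invariant_subspace T X"
  shows "invariant_subspace T (closure (\<Union>\<X>))"
  using assms by (intro invariant_subspace_closure csubspace_chain_Union[OF assms(1,2)])
    (auto dest: invariant_subspaceD)

text \<open>A finite e-net of \<open>S\<close> can be chosen in the union, and finitely many points
  of the union of a chain lie in one member.\<close>

lemma compact_chain_uniform:
  fixes S :: "'a::real_normed_vector set"
  assumes "compact S" "S \<subseteq> closure (\<Union>\<X>)" "subset.chain \<S> \<X>" "\<X> \<noteq> {}" "0 < e"
  shows "\<exists>X\<in>\<X>. \<forall>s\<in>S. \<exists>x\<in>X. norm (s - x) < e"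
proof -
  have "S \<subseteq> (\<Union>x\<in>\<Union>\<X>. ball x e)"
  proof
    fix s assume "s \<in> S"
    then obtain x where "x \<in> \<Union>\<X>" "dist x s < e"
      using assms(2,5) closure_approachable by blast
    then show "s \<in> (\<Union>x\<in>\<Union>\<X>. ball x e)"
      by auto
  qed
  then obtain D where D: "D \<subseteq> \<Union>\<X>" "finite D" "S \<subseteq> (\<Union>x\<in>D. ball x e)"
    using compactE_image[OF assms(1), of "\<Union>\<X>" "\<lambda>x. ball x e"] by (metis open_ball)
  obtain X where X: "X \<in> \<X>" "D \<subseteq> X"
    using finite_subset_Union_chain[OF D(2,1) assms(4,3)] by blast
  have "\<exists>x\<in>X. norm (s - x) < e" if "s \<in> S" for s
    using subsetD[OF D(3) that] X(2) by (auto simp: dist_norm norm_minus_commute)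
  then show ?thesis
    using X(1) by blast
qed

text \<open>\<open>compact_chain_uniform\<close> for the images of unit vectors of the closed union,
  which stay in it by invariance; homogeneity gives the factor norm x.\<close>

lemma compact_ops_chain_uniform:
  fixes F :: "('a::complex_inner \<Rightarrow>\<^sub>L 'a) set"
  assumes F: "finite F" "F \<subseteq> compact_ops" "F \<subseteq> T"
    and chain: "subset.chain \<S> \<X>" "\<X> \<noteq> {}" "\<And>X. X \<in> \<X> \<Longrightarrow> invariant_subspace T X" and e: "0 < e"
  shows "\<exists>X\<in>\<X>. \<forall>k\<in>F. \<forall>x\<in>closure (\<Union>\<X>). \<exists>x'\<in>X. norm (k x - x') \<le> e * norm x"
proof -
  note inv = invariant_subspaceD[OF invariant_subspace_chain_closure[OF chain]]
  define S where "S = closure (\<Union>\<X>) \<inter> (\<Union>k\<in>F. closure (blinfun_apply k ` cball 0 1))"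
  have "compact S"
    unfolding S_def using F by (intro closed_Int_compact compact_UN ballI) (auto intro: compact_opsD)
  then obtain X where X: "X \<in> \<X>" "\<And>s. s \<in> S \<Longrightarrow> \<exists>x\<in>X. norm (s - x) < e"
    using compact_chain_uniform[OF _ _ chain(1,2) e, of S] by (auto simp: S_def)
  have csX: "csubspace X"
    using chain(3)[OF X(1)] by (rule invariant_subspaceD)
  have "\<exists>x'\<in>X. norm (k x - x') \<le> e * norm x" if k: "k \<in> F" and x: "x \<in> closure (\<Union>\<X>)" for k x
  proof (cases "x = 0")
    case True
    then show ?thesis
      using csubspace_0[OF csX] by (auto simp: blinfun.zero_right)
  next
    case False
    define y where "y = (1 / norm x) *\<^sub>R x"
    have y: "norm y \<le> 1" "x = norm x *\<^sub>R y"
      using False by (simp_all add: y_def)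
    have "y \<in> closure (\<Union>\<X>)"
      unfolding y_def using x inv(1) by (simp add: csubspace_scale scaleR_scaleC)
    then have "k y \<in> closure (\<Union>\<X>)"
      using inv(3) k F(3) by blast
    moreover have "k y \<in> closure (blinfun_apply k ` cball 0 1)"
      using y(1) by (intro subsetD[OF closure_subset] imageI) simp
    ultimately have "k y \<in> S"
      using k by (auto simp: S_def)
    then obtain x' where x': "x' \<in> X" "norm (k y - x') < e"
      using X(2) by blast
    have "k x - norm x *\<^sub>R x' = norm x *\<^sub>R (k y - x')"
      by (subst y(2)) (simp add: blinfun.scaleR_right scaleR_diff_right)
    then have "norm (k x - norm x *\<^sub>R x') \<le> e * norm x"
      using mult_left_mono[of "norm (k y - x')" e "norm x"] x'(2) by (simp add: mult.commute)
    moreover have "norm x *\<^sub>R x' \<in> X"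
      using x'(1) csX by (simp add: csubspace_scale scaleR_scaleC)
    ultimately show ?thesis
      by blast
  qed
  then show ?thesis
    using X(1) by blast
qed

text \<open>\<open>1 - P\<close> kills x, so it may be applied to y - x. Thus closeness to
  \<open>X\<close> makes the component off \<open>X\<close> small.\<close>

lemma norm_complement_le:
  assumes "projection_onto X P" "norm P \<le> K" "x \<in> X"
  shows "norm (y - P y) \<le> (1 + K) * norm (y - x)"
proof -
  have eq: "y - P y = (y - x) - P (y - x)"
    using assms by (simp add: projection_onto_def blinfun.diff_right)
  have "norm (P (y - x)) \<le> norm P * norm (y - x)"
    by (rule norm_blinfun)
  also have "\<dots> \<le> K * norm (y - x)"
    using assms(2) by (rule mult_right_mono) simp
  finally show ?thesis
    unfolding eq distrib_right mult_1
    using norm_triangle_ineq4[of "y - x" "P (y - x)"] by linarith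
qed

text \<open>If \<open>W\<close> contains no minimal invariant subspace, then no proper invariant subspace is maximal,
  so some chain of proper invariant subspaces has dense union. By compactness the operators in \<open>F\<close>
  are small on the complement of a sufficiently large member of the chain.\<close>

lemma small_invariant_subspace:
  fixes F :: "('a::complex_inner \<Rightarrow>\<^sub>L 'a) set"
  assumes proj: "\<And>X. invariant_subspace T X \<Longrightarrow>
      \<exists>P. projection_onto X P \<and> norm P \<le> K \<and> (\<forall>t\<in>T. \<forall>x. P (t x) = t (P x))"
    and K: "1 \<le> K" and W: "invariant_subspace T W" "W \<noteq> {0}" "\<And>Y. Y \<subseteq> W \<Longrightarrow> \<not> minimal_invariant T Y"
    and F: "finite F" "F \<subseteq> compact_ops" "F \<subseteq> T" and e: "0 < e"
  shows "\<exists>Y\<subseteq>W. invariant_subspace T Y \<and> Y \<noteq> {0} \<and> (\<forall>k\<in>F. \<forall>y\<in>Y. norm (k y) \<le> e * norm y)"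
proof (rule ccontr)
  assume contra: "\<not> ?thesis"
  define \<S> where "\<S> = {X. invariant_subspace T X \<and> X \<subset> W}"
  have compl: "\<exists>P. projection_onto X P \<and> norm P \<le> K \<and> (\<forall>t\<in>T. \<forall>x. P (t x) = t (P x)) \<and>
      invariant_subspace T {w \<in> W. P w = 0} \<and> {w \<in> W. P w = 0} \<noteq> {0}" if X: "X \<in> \<S>" for X
  proof -
    obtain P where P: "projection_onto X P" "norm P \<le> K" "\<And>t x. t \<in> T \<Longrightarrow> P (t x) = t (P x)"
      using proj[of X] X by (auto simp: \<S>_def)
    obtain w where w: "w \<in> W" "w \<notin> X"
      using X by (auto simp: \<S>_def)
    have Pw: "P w \<in> X"
      using P(1) by (rule projection_ontoD)
    have "w - P w \<in> W"
      using X Pw w by (intro csubspace_diff[OF invariant_subspaceD(1)[OF W(1)]]) (auto simp: \<S>_def)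
    moreover have "P (w - P w) = 0"
      using projection_ontoD(3)[OF P(1) Pw] by (simp add: blinfun.diff_right)
    moreover have "w - P w \<noteq> 0"
      using Pw w(2) by auto
    ultimately have "w - P w \<in> {w \<in> W. P w = 0}" "w - P w \<notin> {0}"
      by auto
    then have "{w \<in> W. P w = 0} \<noteq> {0}"
      by metis
    then show ?thesis
      using P projection_onto_vanishing[OF W(1) P(1,3)] by blast
  qed
  have bounds: "\<exists>U\<in>\<S>. \<forall>X\<in>\<X>. X \<subseteq> U" if chain: "subset.chain \<S> \<X>" for \<X>
  proof (cases "\<X> = {}")
    case True
    have "{0} \<in> \<S>"
      using W(1,2) csubspace_0[OF invariant_subspaceD(1)[OF W(1)]]
      by (auto simp: \<S>_def invariant_subspace_zero)
    then show ?thesis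
      using True by blast
  next
    case False
    have mem: "X \<in> \<S>" if "X \<in> \<X>" for X
      using chain that by (auto simp: subset_chain_def)
    have inv: "invariant_subspace T (closure (\<Union>\<X>))"
      using mem by (intro invariant_subspace_chain_closure[OF chain False]) (auto simp: \<S>_def)
    have sub: "closure (\<Union>\<X>) \<subseteq> W"
      using mem invariant_subspaceD(2)[OF W(1)] by (intro closure_minimal) (auto simp: \<S>_def)
    have "closure (\<Union>\<X>) \<noteq> W"
    proof
      assume eq: "closure (\<Union>\<X>) = W"
      \<comment> \<open>The tolerance e / (1 + K) allows for the factor lost in
        \<open>norm_complement_le\<close>.\<close>
      obtain X where X: "X \<in> \<X>" "\<And>k x. k \<in> F \<Longrightarrow> x \<in> W \<Longrightarrow> \<exists>x'\<in>X. norm (k x - x') \<le> e / (1 + K) * norm x"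
        using compact_ops_chain_uniform[OF F chain False, of "e / (1 + K)"] mem e K
        unfolding eq by (auto simp: \<S>_def)
      obtain P where P: "projection_onto X P" "norm P \<le> K" "\<And>t x. t \<in> T \<Longrightarrow> P (t x) = t (P x)"
        "invariant_subspace T {w \<in> W. P w = 0}" "{w \<in> W. P w = 0} \<noteq> {0}"
        using compl[OF mem[OF X(1)]] by blast
      have small: "norm (k y) \<le> e * norm y" if k: "k \<in> F" and y: "y \<in> {w \<in> W. P w = 0}" for k y
      proof -
        obtain x' where x': "x' \<in> X" "norm (k y - x') \<le> e / (1 + K) * norm y"
          using X(2)[OF k, of y] y by blast
        have "P (k y) = 0"
          using P(3)[of k y] k F(3) y by (auto simp: blinfun.zero_right)
        then have "norm (k y) \<le> (1 + K) * norm (k y - x')"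
          using norm_complement_le[OF P(1,2) x'(1), of "k y"] by simp
        also have "\<dots> \<le> (1 + K) * (e / (1 + K) * norm y)"
          using K x'(2) by (intro mult_left_mono) auto
        also have "\<dots> = e * norm y"
          using K by simp
        finally show ?thesis .
      qed
      have "\<exists>Y\<subseteq>W. invariant_subspace T Y \<and> Y \<noteq> {0} \<and> (\<forall>k\<in>F. \<forall>y\<in>Y. norm (k y) \<le> e * norm y)"
        by (intro exI[of _ "{w \<in> W. P w = 0}"] conjI ballI P small) auto
      with contra show False ..
    qed
    then show ?thesis
      using inv sub closure_subset[of "\<Union>\<X>"] by (intro bexI[of _ "closure (\<Union>\<X>)"]) (auto simp: \<S>_def)
  qed
  obtain X where X: "X \<in> \<S>" and max: "\<And>Z. Z \<in> \<S> \<Longrightarrow> X \<subseteq> Z \<Longrightarrow> Z = X"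
    using subset_Zorn[OF bounds] by blast
  obtain P where P: "projection_onto X P" "\<And>t x. t \<in> T \<Longrightarrow> P (t x) = t (P x)"
    and Y: "invariant_subspace T {w \<in> W. P w = 0}" "{w \<in> W. P w = 0} \<noteq> {0}"
    using compl[OF X] by blast
  have "Z = {0} \<or> Z = {w \<in> W. P w = 0}" if Z: "Z \<subseteq> {w \<in> W. P w = 0}" "invariant_subspace T Z" for Z
  proof (rule disjCI)
    assume "Z \<noteq> {w \<in> W. P w = 0}"
    then obtain w where w: "w \<in> W" "P w = 0" "w \<notin> Z"
      using Z(1) by blast
    define Q where "Q = id_blinfun - P"
    have Q: "Q x = x - P x" for x
      by (simp add: Q_def blinfun.diff_left)
    \<comment> \<open>This preimage contains both \<open>X\<close> and \<open>Z\<close> but not w.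
      Maximality makes it equal to \<open>X\<close>, so \<open>Z\<close> lies in \<open>X\<close>
      and in the kernel of \<open>P\<close>, hence is 0.\<close>
    have "invariant_subspace T {x \<in> W. Q x \<in> Z}"
      by (rule invariant_subspace_preimage[OF W(1) Z(2)])
        (simp_all add: Q_def P(2) blinfun.diff_right blinfun.diff_left projection_ontoD[OF P(1)])
    moreover have "X \<subseteq> {x \<in> W. Q x \<in> Z}"
      using X projection_ontoD(3)[OF P(1)] csubspace_0[OF invariant_subspaceD(1)[OF Z(2)]]
      by (auto simp: \<S>_def Q)
    moreover have "w \<notin> {x \<in> W. Q x \<in> Z}"
      using w by (simp add: Q)
    ultimately have "{x \<in> W. Q x \<in> Z} = X"
      using w(1) by (intro max) (auto simp: \<S>_def)
    moreover have "z \<in> {x \<in> W. Q x \<in> Z}" if "z \<in> Z" for z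
      using that Z(1) by (auto simp: Q)
    ultimately have "z = 0" if "z \<in> Z" for z
      using that Z(1) projection_ontoD(3)[OF P(1), of z] by auto
    then show "Z = {0}"
      using csubspace_0[OF invariant_subspaceD(1)[OF Z(2)]] by blast
  qed
  then have "minimal_invariant T {w \<in> W. P w = 0}"
    using Y by (simp add: minimal_invariant_def)
  then show False
    using W(3)[of "{w \<in> W. P w = 0}"] by blast
qed

text \<open>Signs are chosen one at a time, so that the inner product of the new term with the
  partial sum has the desired sign. It replaces averaging over random signs.\<close>

lemma ex_signs_le:
  fixes x :: "'i \<Rightarrow> 'a::real_inner"
  assumes "finite I"
  shows "\<exists>s. (\<forall>i. s i = 1 \<or> s i = - 1) \<and> (norm (\<Sum>i\<in>I. s i *\<^sub>R x i))\<^sup>2 \<le> (\<Sum>i\<in>I. (norm (x i))\<^sup>2)"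
    and "\<exists>s. (\<forall>i. s i = 1 \<or> s i = - 1) \<and> (\<Sum>i\<in>I. (norm (x i))\<^sup>2) \<le> (norm (\<Sum>i\<in>I. s i *\<^sub>R x i))\<^sup>2"
  using assms
proof (induction I rule: finite_induct)
  case empty
  {
    case 1
    then show ?case
      by (auto intro: exI[of _ "\<lambda>_. 1"])
  next
    case 2
    then show ?case
      by (auto intro: exI[of _ "\<lambda>_. 1"])
  }
next
  case (insert i I)
  have step: "(norm (\<Sum>j\<in>insert i I. (s(i := t)) j *\<^sub>R x j))\<^sup>2 =
      (norm (x i))\<^sup>2 + 2 * t * inner (x i) (\<Sum>j\<in>I. s j *\<^sub>R x j) + (norm (\<Sum>j\<in>I. s j *\<^sub>R x j))\<^sup>2"
    if "t = 1 \<or> t = - 1" for s t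
  proof -
    have "(\<Sum>j\<in>I. (s(i := t)) j *\<^sub>R x j) = (\<Sum>j\<in>I. s j *\<^sub>R x j)"
      using insert(2) by (intro sum.cong) auto
    then show ?thesis
      using insert(1,2) that
      by (auto simp: power2_norm_eq_inner inner_add_left inner_add_right 
          inner_commute[of "\<Sum>j\<in>I. s j *\<^sub>R x j" "x i"])
  qed
  {
    case 1
    obtain s where s: "\<forall>i. s i = 1 \<or> s i = - 1"
      "(norm (\<Sum>i\<in>I. s i *\<^sub>R x i))\<^sup>2 \<le> (\<Sum>i\<in>I. (norm (x i))\<^sup>2)"
      using insert.IH(1) by blast
    define t :: real where "t = (if inner (x i) (\<Sum>j\<in>I. s j *\<^sub>R x j) \<le> 0 then 1 else - 1)"
    have "2 * t * inner (x i) (\<Sum>j\<in>I. s j *\<^sub>R x j) \<le> 0"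
      by (simp add: t_def)
    then show ?case
      using s step[of t s] insert(1,2) by (intro exI[of _ "s(i := t)"]) (auto simp: t_def)
  next
    case 2
    obtain s where s: "\<forall>i. s i = 1 \<or> s i = - 1"
      "(\<Sum>i\<in>I. (norm (x i))\<^sup>2) \<le> (norm (\<Sum>i\<in>I. s i *\<^sub>R x i))\<^sup>2"
      using insert.IH(2) by blast
    define t :: real where "t = (if inner (x i) (\<Sum>j\<in>I. s j *\<^sub>R x j) \<le> 0 then - 1 else 1)"
    have "0 \<le> 2 * t * inner (x i) (\<Sum>j\<in>I. s j *\<^sub>R x j)"
      by (simp add: t_def)
    then show ?case
      using s step[of t s] insert(1,2) by (intro exI[of _ "s(i := t)"]) (auto simp: t_def)
  }
qed

context reductive
begin

section \<open>Central projections and independent families\<close>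

abbreviation fully_invariant :: "'a set \<Rightarrow> bool"
  where "fully_invariant \<equiv> invariant_subspace (A \<union> B)"

lemma fully_invariant_imp_invariant: "fully_invariant N \<Longrightarrow> invariant_subspace A N"
  by (auto simp: invariant_subspace_def)

lemma fully_invariantD:
  assumes "fully_invariant N" "x \<in> N"
  shows "a \<in> A \<Longrightarrow> a x \<in> N" "b \<in> B \<Longrightarrow> b x \<in> N"
  using assms by (auto simp: invariant_subspace_def)

text \<open>For fully invariant \<open>N\<close> the choice is immaterial by
  \<open>central_projection_unique\<close>.\<close>

definition cproj :: "'a set \<Rightarrow> 'a \<Rightarrow>\<^sub>L 'a"
  where "cproj N = (SOME p. p \<in> B \<and> projection_onto N p \<and> norm p \<le> K \<and> (\<forall>b\<in>B. \<forall>z. p (b z) = b (p z)))"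

lemma cproj:
  assumes "fully_invariant N"
  shows "cproj N \<in> B" "projection_onto N (cproj N)" "norm (cproj N) \<le> K"
    "b \<in> B \<Longrightarrow> cproj N (b z) = b (cproj N z)"
proof -
  have "\<exists>p. p \<in> B \<and> projection_onto N p \<and> norm p \<le> K \<and> (\<forall>b\<in>B. \<forall>z. p (b z) = b (p z))"
    using central_projection[OF assms] by blast
  from someI_ex[OF this, folded cproj_def]
  show "cproj N \<in> B" "projection_onto N (cproj N)" "norm (cproj N) \<le> K"
    "b \<in> B \<Longrightarrow> cproj N (b z) = b (cproj N z)"
    by auto
qed

lemma cproj_apply:
  assumes "fully_invariant N"
  shows "cproj N x \<in> N" "x \<in> N \<Longrightarrow> cproj N x = x" "a \<in> A \<Longrightarrow> cproj N (a x) = a (cproj N x)"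
  using cproj(1,2)[OF assms] by (auto simp: projection_onto_def commutantD)

text \<open>The two projections commute, so the product has its values in the intersection.\<close>

lemma cproj_disjoint:
  assumes "fully_invariant N" "fully_invariant M" "N \<inter> M = {0}"
  shows "cproj N (cproj M x) = 0" "x \<in> M \<Longrightarrow> cproj N x = 0"
proof -
  have *: "cproj N (cproj M x) = 0" for x
  proof -
    have "cproj N (cproj M x) = cproj M (cproj N x)"
      by (rule cproj(4)[OF assms(1) cproj(1)[OF assms(2)]])
    then show ?thesis
      using cproj_apply(1)[OF assms(1), of "cproj M x"] cproj_apply(1)[OF assms(2), of "cproj N x"] assms(3)
      by (metis Int_iff singletonD)
  qed
  then show "cproj N (cproj M x) = 0" "x \<in> M \<Longrightarrow> cproj N x = 0"
    using cproj_apply(2)[OF assms(2), of x] *[of x] by auto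
qed

text \<open>Central idempotents are determined by their range, hence bounded by \<open>K\<close>.\<close>

lemma norm_central_le:
  assumes p: "p \<in> B" "\<And>x. p (p x) = p x" "\<And>b x. b \<in> B \<Longrightarrow> p (b x) = b (p x)"
  shows "norm p \<le> K"
proof -
  let ?N = "{x. p x = x}"
  have "fully_invariant ?N"
    unfolding invariant_subspace_def
  proof (intro conjI ballI)
    show "csubspace ?N"
      by (rule csubspaceI) (auto simp: blinfun.bilinear_simps commutant_scaleC_apply[OF p(1)])
    show "closed ?N"
      by (intro closed_Collect_eq continuous_intros)
    show "t x \<in> ?N" if tx: "t \<in> A \<union> B" "x \<in> ?N" for t x
    proof -
      have "p (t x) = t (p x)"
        using tx(1) commutantD[OF p(1), of t x] p(3)[of t x] by blast
      then show ?thesis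
        using tx(2) by simp
    qed
  qed
  moreover have "projection_onto ?N p"
    using p(1,2) by (auto simp: projection_onto_def commutant_bounded_ops)
  ultimately have "cproj ?N = p"
    by (intro central_projection_unique[of p ?N] cproj p)
  then show ?thesis
    using cproj(3)[OF \<open>fully_invariant ?N\<close>] by simp
qed

text \<open>Pairwise trivial intersection suffices: the central projections then annihilate each
  other, which makes the sum of the members direct.\<close>

definition independent_family :: "'a set set \<Rightarrow> bool"
  where "independent_family \<N> \<longleftrightarrow> (\<forall>N\<in>\<N>. fully_invariant N) \<and> (\<forall>N\<in>\<N>. \<forall>M\<in>\<N>. N \<noteq> M \<longrightarrow> N \<inter> M = {0})"

lemma independent_familyD:
  assumes "independent_family \<N>"
  shows "N \<in> \<N> \<Longrightarrow> fully_invariant N" "N \<in> \<N> \<Longrightarrow> M \<in> \<N> \<Longrightarrow> N \<noteq> M \<Longrightarrow> N \<inter> M = {0}"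
    "\<F> \<subseteq> \<N> \<Longrightarrow> independent_family \<F>"
  using assms unfolding independent_family_def by blast+

lemma cproj_family:
  assumes "independent_family \<N>" "N \<in> \<N>" "M \<in> \<N>"
  shows "cproj N (cproj M x) = (if N = M then cproj N x else 0)" "x \<in> M \<Longrightarrow> cproj N x = (if N = M then x else 0)"
proof -
  note N = independent_familyD(1)[OF assms(1,2)] and M = independent_familyD(1)[OF assms(1,3)]
  show "cproj N (cproj M x) = (if N = M then cproj N x else 0)"
  proof (cases "N = M")
    case True
    then show ?thesis
      using cproj_apply(2)[OF M cproj_apply(1)[OF M]] by simp
  next
    case False
    then show ?thesis
      using cproj_disjoint(1)[OF N M] independent_familyD(2)[OF assms] by simp
  qed
  show "cproj N x = (if N = M then x else 0)" if "x \<in> M"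
  proof (cases "N = M")
    case True
    then show ?thesis
      using cproj_apply(2)[OF M that] by simp
  next
    case False
    then show ?thesis
      using cproj_disjoint(2)[OF N M] independent_familyD(2)[OF assms] that by simp
  qed
qed

lemma sum_cproj_apply:
  assumes fam: "independent_family \<N>" and "N \<in> \<N>" "\<F> \<subseteq> \<N>" "finite \<F>"
  shows "cproj N (\<Sum>M\<in>\<F>. cproj M x) = (if N \<in> \<F> then cproj N x else 0)"
proof -
  have "cproj N (\<Sum>M\<in>\<F>. cproj M x) = (\<Sum>M\<in>\<F>. if N = M then cproj N x else 0)"
    unfolding blinfun.sum_right using assms(2,3) by (intro sum.cong refl cproj_family(1)[OF fam]) auto
  also have "\<dots> = (if N \<in> \<F> then cproj N x else 0)"
    using assms(4) by simp
  finally show ?thesis .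
qed

text \<open>The sum is again a central idempotent, so \<open>K\<close> bounds it whatever the number
  of terms.\<close>

lemma norm_sum_cproj_le:
  assumes "independent_family \<F>" "finite \<F>"
  shows "norm (\<Sum>N\<in>\<F>. cproj N) \<le> K"
proof (rule norm_central_le)
  have fi: "fully_invariant N" if "N \<in> \<F>" for N
    using independent_familyD(1)[OF assms(1) that] .
  have "(\<Sum>N\<in>\<G>. cproj N) \<in> B" if "\<G> \<subseteq> \<F>" for \<G>
    using finite_subset[OF that assms(2)] that
    by (induction \<G> rule: finite_induct) (auto simp: cproj(1)[OF fi])
  then show "(\<Sum>N\<in>\<F>. cproj N) \<in> B"
    by blast
  show "(\<Sum>N\<in>\<F>. cproj N) ((\<Sum>N\<in>\<F>. cproj N) x) = (\<Sum>N\<in>\<F>. cproj N) x" for x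
    unfolding blinfun.sum_left
    by (intro sum.cong refl) (simp add: sum_cproj_apply[OF assms(1) _ subset_refl assms(2)])
  show "(\<Sum>N\<in>\<F>. cproj N) (b x) = b ((\<Sum>N\<in>\<F>. cproj N) x)" if "b \<in> B" for b x
    unfolding blinfun.sum_left blinfun.sum_right by (intro sum.cong refl cproj(4)[OF fi that])
qed

lemma norm_signed_sum_cproj_le:
  assumes "independent_family \<F>" "finite \<F>" "\<And>N. s N = 1 \<or> s N = - 1"
  shows "norm (\<Sum>N\<in>\<F>. s N *\<^sub>R cproj N x) \<le> 2 * K * norm x"
proof -
  let ?P = "{N \<in> \<F>. s N = 1}" and ?M = "{N \<in> \<F>. s N = - 1}"
  have "(\<Sum>N\<in>\<F>. s N *\<^sub>R cproj N x) = (\<Sum>N\<in>?P \<union> ?M. s N *\<^sub>R cproj N x)"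
    using assms(3) by (intro sum.cong) auto
  also have "\<dots> = (\<Sum>N\<in>?P. s N *\<^sub>R cproj N x) + (\<Sum>N\<in>?M. s N *\<^sub>R cproj N x)"
    using assms(2) by (intro sum.union_disjoint) auto
  also have "\<dots> = (\<Sum>N\<in>?P. cproj N) x - (\<Sum>N\<in>?M. cproj N) x"
    by (simp add: blinfun.sum_left sum_negf)
  also have "norm \<dots> \<le> norm ((\<Sum>N\<in>?P. cproj N) x) + norm ((\<Sum>N\<in>?M. cproj N) x)"
    by (rule norm_triangle_ineq4)
  also have "\<dots> \<le> K * norm x + K * norm x"
  proof (rule add_mono)
    have *: "norm ((\<Sum>N\<in>\<G>. cproj N) x) \<le> K * norm x" if "\<G> \<subseteq> \<F>" for \<G>
    proof -
      have "norm (\<Sum>N\<in>\<G>. cproj N) \<le> K"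
        using that by (intro norm_sum_cproj_le independent_familyD(3)[OF assms(1)] finite_subset[OF that assms(2)])
      then show ?thesis
        by (intro order_trans[OF norm_blinfun mult_right_mono]) auto
    qed
    show "norm ((\<Sum>N\<in>?P. cproj N) x) \<le> K * norm x" "norm ((\<Sum>N\<in>?M. cproj N) x) \<le> K * norm x"
      by (rule *; blast)+
  qed
  finally show ?thesis
    by simp
qed

text \<open>For suitable signs the signed sum of the components dominates their square sum, and
  every signed sum is a difference of two sums bounded by \<open>K\<close>.\<close>

lemma sum_norm_cproj_le:
  assumes "independent_family \<F>" "finite \<F>"
  shows "(\<Sum>N\<in>\<F>. (norm (cproj N x))\<^sup>2) \<le> (2 * K * norm x)\<^sup>2"
proof -
  obtain s where s: "\<forall>N. s N = 1 \<or> s N = - 1"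
    "(\<Sum>N\<in>\<F>. (norm (cproj N x))\<^sup>2) \<le> (norm (\<Sum>N\<in>\<F>. s N *\<^sub>R cproj N x))\<^sup>2"
    using ex_signs_le(2)[OF assms(2), of "\<lambda>N. cproj N x"] by blast
  have "norm (\<Sum>N\<in>\<F>. s N *\<^sub>R cproj N x) \<le> 2 * K * norm x"
    using s(1) by (intro norm_signed_sum_cproj_le assms) auto
  then show ?thesis
    using s(2) by (meson norm_ge_zero order_trans power_mono)
qed

text \<open>For suitable signs the signed sum y of the x N is dominated by the square sum. Applying
  the same signs to the components of y restores the sum of the x N at the cost of a factor 2
  K.\<close>

lemma norm_sum_le_family:
  assumes fam: "independent_family \<F>" "finite \<F>" and x: "\<And>N. N \<in> \<F> \<Longrightarrow> x N \<in> N"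
  shows "(norm (\<Sum>N\<in>\<F>. x N))\<^sup>2 \<le> (2 * K)\<^sup>2 * (\<Sum>N\<in>\<F>. (norm (x N))\<^sup>2)"
proof -
  obtain s where s: "\<forall>N. s N = 1 \<or> s N = - 1"
    "(norm (\<Sum>N\<in>\<F>. s N *\<^sub>R x N))\<^sup>2 \<le> (\<Sum>N\<in>\<F>. (norm (x N))\<^sup>2)"
    using ex_signs_le(1)[OF assms(2), of x] by blast
  define y where "y = (\<Sum>N\<in>\<F>. s N *\<^sub>R x N)"
  have "cproj N y = s N *\<^sub>R x N" if N: "N \<in> \<F>" for N
  proof -
    have "cproj N y = (\<Sum>M\<in>\<F>. if N = M then s N *\<^sub>R x N else 0)"
      unfolding y_def blinfun.sum_right
      using cproj_family(2)[OF fam(1) N] x by (intro sum.cong refl) (auto simp: blinfun.scaleR_right)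
    then show ?thesis
      using fam(2) N by simp
  qed
  moreover have "s N *\<^sub>R s N *\<^sub>R x N = x N" for N
    using s(1)[rule_format, of N] by auto
  ultimately have "(\<Sum>N\<in>\<F>. s N *\<^sub>R cproj N y) = (\<Sum>N\<in>\<F>. x N)"
    by (intro sum.cong) auto
  then have "norm (\<Sum>N\<in>\<F>. x N) \<le> 2 * K * norm y"
    using norm_signed_sum_cproj_le[OF fam, of s y] s(1) by auto
  then have "(norm (\<Sum>N\<in>\<F>. x N))\<^sup>2 \<le> (2 * K * norm y)\<^sup>2"
    by (rule power_mono) simp
  also have "\<dots> = (2 * K)\<^sup>2 * (norm y)\<^sup>2"
    by (simp add: power_mult_distrib)
  also have "\<dots> \<le> (2 * K)\<^sup>2 * (\<Sum>N\<in>\<F>. (norm (x N))\<^sup>2)"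
    using s(2) by (intro mult_left_mono) (auto simp: y_def)
  finally show ?thesis .
qed

text \<open>For an independent family this is the algebraic direct sum, described through
  projections so that each element comes with its components.\<close>

definition algebraic_sum :: "'a set set \<Rightarrow> 'a set"
  where "algebraic_sum \<N> = {x. \<exists>\<F>. finite \<F> \<and> \<F> \<subseteq> \<N> \<and> x = (\<Sum>N\<in>\<F>. cproj N x)}"

lemma algebraic_sum:
  assumes fam: "independent_family \<N>"
  shows "fully_invariant (closure (algebraic_sum \<N>))" "N \<in> \<N> \<Longrightarrow> N \<subseteq> algebraic_sum \<N>"
proof -
  have mono: "x = (\<Sum>N\<in>\<G>. cproj N x)"
    if "finite \<G>" "\<G> \<subseteq> \<N>" "\<F> \<subseteq> \<G>" "x = (\<Sum>N\<in>\<F>. cproj N x)" for \<F> \<G> x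
  proof -
    have "cproj N x = 0" if "N \<in> \<G> - \<F>" for N
    proof -
      have "cproj N (\<Sum>M\<in>\<F>. cproj M x) = 0"
        using sum_cproj_apply[OF fam, of N \<F> x] that \<open>\<G> \<subseteq> \<N>\<close> \<open>\<F> \<subseteq> \<G>\<close> finite_subset[OF \<open>\<F> \<subseteq> \<G>\<close> \<open>finite \<G>\<close>]
        by auto
      then show ?thesis
        using \<open>x = (\<Sum>N\<in>\<F>. cproj N x)\<close> by simp
    qed
    then have "(\<Sum>N\<in>\<F>. cproj N x) = (\<Sum>N\<in>\<G>. cproj N x)"
      using that(1,3) by (intro sum.mono_neutral_left) auto
    then show ?thesis
      using that(4) by simp
  qed
  show "fully_invariant (closure (algebraic_sum \<N>))"
  proof (rule invariant_subspace_closure)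
    show "csubspace (algebraic_sum \<N>)"
    proof (rule csubspaceI)
      show "0 \<in> algebraic_sum \<N>"
        by (auto simp: algebraic_sum_def intro!: exI[of _ "{}"])
      show "x + y \<in> algebraic_sum \<N>" if xy: "x \<in> algebraic_sum \<N>" "y \<in> algebraic_sum \<N>" for x y
      proof -
        obtain \<F> \<G> where FG: "finite \<F>" "\<F> \<subseteq> \<N>" "x = (\<Sum>N\<in>\<F>. cproj N x)" "finite \<G>" "\<G> \<subseteq> \<N>" "y = (\<Sum>N\<in>\<G>. cproj N y)"
          using xy by (auto simp: algebraic_sum_def)
        have "x = (\<Sum>N\<in>\<F> \<union> \<G>. cproj N x)" "y = (\<Sum>N\<in>\<F> \<union> \<G>. cproj N y)"
          by (rule mono[OF _ _ _ FG(3)] mono[OF _ _ _ FG(6)]; use FG in auto)+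
        then have "x + y = (\<Sum>N\<in>\<F> \<union> \<G>. cproj N (x + y))"
          by (simp add: blinfun.add_right sum.distrib)
        then show ?thesis
          using FG unfolding algebraic_sum_def by blast
      qed
      show "c *\<^sub>C x \<in> algebraic_sum \<N>" if x: "x \<in> algebraic_sum \<N>" for c x
      proof -
        obtain \<F> where F: "finite \<F>" "\<F> \<subseteq> \<N>" "x = (\<Sum>N\<in>\<F>. cproj N x)"
          using x by (auto simp: algebraic_sum_def)
        have "c *\<^sub>C x = c *\<^sub>C (\<Sum>N\<in>\<F>. cproj N x)"
          using F(3) by simp
        also have "\<dots> = (\<Sum>N\<in>\<F>. cproj N (c *\<^sub>C x))"
          unfolding complex_vector.scale_sum_right using F(2)
          by (intro sum.cong refl) (auto simp: commutant_scaleC_apply[OF cproj(1)[OF independent_familyD(1)[OF fam]]])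
        finally show ?thesis
          using F unfolding algebraic_sum_def by blast
      qed
    qed
    show "t x \<in> algebraic_sum \<N>" if t: "t \<in> A \<union> B" and x: "x \<in> algebraic_sum \<N>" for t x
    proof -
      obtain \<F> where F: "finite \<F>" "\<F> \<subseteq> \<N>" "x = (\<Sum>N\<in>\<F>. cproj N x)"
        using x by (auto simp: algebraic_sum_def)
      have "t x = t (\<Sum>N\<in>\<F>. cproj N x)"
        using F(3) by simp
      also have "\<dots> = (\<Sum>N\<in>\<F>. cproj N (t x))"
        unfolding blinfun.sum_right
      proof (intro sum.cong refl)
        fix N assume "N \<in> \<F>"
        then have "fully_invariant N"
          using F(2) independent_familyD(1)[OF fam] by blast
        then show "t (cproj N x) = cproj N (t x)"
          using t cproj_apply(3)[of N t x] cproj(4)[of N t x] by auto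
      qed
      finally show ?thesis
        using F unfolding algebraic_sum_def by blast
    qed
  qed
  show "N \<subseteq> algebraic_sum \<N>" if "N \<in> \<N>"
  proof
    fix x assume "x \<in> N"
    then have "x = (\<Sum>N\<in>{N}. cproj N x)"
      using cproj_apply(2)[OF independent_familyD(1)[OF fam that]] by simp
    then show "x \<in> algebraic_sum \<N>"
      using that unfolding algebraic_sum_def by (intro CollectI exI[of _ "{N}"]) auto
  qed
qed

text \<open>A maximal independent family of pieces on which \<open>k\<close> is small exhausts \<open>M\<close>, and the pieces are
  nearly orthogonal, so \<open>k\<close> is small on \<open>M\<close>.\<close>

lemma ex_minimal_fully_invariant:
  assumes M: "fully_invariant M" "M \<noteq> {0}"
  shows "\<exists>N\<subseteq>M. minimal_invariant (A \<union> B) N"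
proof (rule ccontr)
  assume contra: "\<not> ?thesis"
  obtain x where x: "x \<in> M" "x \<noteq> 0"
    using csubspace_nonzero M invariant_subspaceD(1) by blast
  obtain k where k: "k \<in> J" "k x \<noteq> 0"
    using ex_compact_nonzero[OF x(2)] by blast
  define L where "L = (2 * K)\<^sup>2"
  have L: "L > 0"
    using K by (simp add: L_def)
  \<comment> \<open>Chosen such that L e norm x is half of norm (k x). One factor 2 K of
    \<open>L\<close> comes from splitting a vector into components, the other from adding up their
    images.\<close>
  define e where "e = norm (k x) / (2 * L * norm x)"
  have e: "e > 0"
    using k(2) x(2) L by (simp add: e_def)
  define \<S> where "\<S> = {\<F>. independent_family \<F> \<and>
      (\<forall>N\<in>\<F>. N \<subseteq> M \<and> N \<noteq> {0} \<and> (\<forall>y\<in>N. norm (k y) \<le> e * norm y))}"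
  have "\<exists>\<F>\<in>\<S>. \<forall>X\<in>\<S>. \<F> \<subseteq> X \<longrightarrow> X = \<F>"
  proof (rule subset_Zorn_nonempty)
    show "\<S> \<noteq> {}"
      by (auto simp: \<S>_def independent_family_def intro!: exI[of _ "{}"])
    fix \<C> assume C: "\<C> \<noteq> {}" "subset.chain \<S> \<C>"
    have mem: "\<F> \<in> \<S>" if "\<F> \<in> \<C>" for \<F>
      using C(2) that by (auto simp: subset_chain_def)
    have "N \<inter> N' = {0}" if NN: "N \<in> \<Union>\<C>" "N' \<in> \<Union>\<C>" "N \<noteq> N'" for N N'
    proof -
      obtain \<F> \<F>' where F: "\<F> \<in> \<C>" "N \<in> \<F>" "\<F>' \<in> \<C>" "N' \<in> \<F>'"
        using NN by blast
      then have "\<F> \<subseteq> \<F>' \<or> \<F>' \<subseteq> \<F>"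
        using C(2) by (auto simp: subset_chain_def)
      then obtain \<G> where "\<G> \<in> \<S>" "N \<in> \<G>" "N' \<in> \<G>"
        using F mem by blast
      then have "independent_family \<G>"
        by (simp add: \<S>_def)
      then show ?thesis
        by (rule independent_familyD(2)) fact+
    qed
    moreover have "fully_invariant N \<and> N \<subseteq> M \<and> N \<noteq> {0} \<and> (\<forall>y\<in>N. norm (k y) \<le> e * norm y)"
      if N: "N \<in> \<Union>\<C>" for N
    proof -
      obtain \<F> where "\<F> \<in> \<S>" "N \<in> \<F>"
        using N mem by blast
      then show ?thesis
        unfolding \<S>_def using independent_familyD(1)[of \<F> N] by simp
    qed
    ultimately show "\<Union>\<C> \<in> \<S>"
      unfolding \<S>_def independent_family_def mem_Collect_eq by meson
  qed
  then obtain \<F> where F: "\<F> \<in> \<S>" "\<And>X. X \<in> \<S> \<Longrightarrow> \<F> \<subseteq> X \<Longrightarrow> X = \<F>"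
    by blast
  have fam: "independent_family \<F>" and FM: "\<And>N. N \<in> \<F> \<Longrightarrow> N \<subseteq> M" "\<And>N. N \<in> \<F> \<Longrightarrow> N \<noteq> {0}"
    and small: "\<And>N y. N \<in> \<F> \<Longrightarrow> y \<in> N \<Longrightarrow> norm (k y) \<le> e * norm y"
    using F(1) by (auto simp: \<S>_def)
  define X where "X = closure (algebraic_sum \<F>)"
  have X: "fully_invariant X"
    unfolding X_def by (rule algebraic_sum[OF fam])
  have NX: "N \<subseteq> X" if "N \<in> \<F>" for N
    unfolding X_def using algebraic_sum(2)[OF fam that] closure_subset by blast
  have MX: "M \<subseteq> X"
  proof (rule ccontr)
    assume "\<not> M \<subseteq> X"
    then obtain y where y: "y \<in> M" "y \<notin> X"
      by blast
    \<comment> \<open>The part of \<open>M\<close> missed by the closed sum. It contains no minimal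
      fully invariant subspace either, so a further small piece \<open>Y\<close> exists in it,
      against maximality of the family.\<close>
    define W where "W = {w \<in> M. cproj X w = 0}"
    have W: "fully_invariant W"
      unfolding W_def
      by (rule projection_onto_vanishing[OF M(1) cproj(2)[OF X]]) (auto simp: cproj(4)[OF X] cproj_apply(3)[OF X])
    have "y - cproj X y \<in> W"
      using y(1) X fully_invariantD(2)[OF M(1) y(1) cproj(1)[OF X]]
      by (auto simp: W_def cproj_apply blinfun.diff_right intro!: csubspace_diff[OF invariant_subspaceD(1)[OF M(1)]])
    moreover have "y - cproj X y \<noteq> 0"
      using y(2) cproj_apply(1)[OF X, of y] by auto
    ultimately have W0: "W \<noteq> {0}"
      by blast
    have "\<exists>Y\<subseteq>W. fully_invariant Y \<and> Y \<noteq> {0} \<and> (\<forall>k'\<in>{k}. \<forall>y\<in>Y. norm (k' y) \<le> e * norm y)"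
    proof (rule small_invariant_subspace[OF _ K W W0])
      show "\<exists>P. projection_onto X P \<and> norm P \<le> K \<and> (\<forall>t\<in>A \<union> B. \<forall>x. P (t x) = t (P x))"
        if "fully_invariant X" for X
        using cproj[OF that] cproj_apply(3)[OF that] by (intro exI[of _ "cproj X"]) auto
      show "\<not> minimal_invariant (A \<union> B) Y" if "Y \<subseteq> W" for Y
        using contra that by (auto simp: W_def)
    qed (use k e in auto)
    then obtain Y where Y: "Y \<subseteq> W" "fully_invariant Y" "Y \<noteq> {0}" "\<And>y. y \<in> Y \<Longrightarrow> norm (k y) \<le> e * norm y"
      by auto
    have YN: "Y \<inter> N = {0}" if "N \<in> \<F>" for N
    proof -
      have "z = 0" if z: "z \<in> Y" "z \<in> N" for z
      proof -
        have "cproj X z = z"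
          using z(2) NX[OF \<open>N \<in> \<F>\<close>] by (intro cproj_apply(2)[OF X]) auto
        moreover have "cproj X z = 0"
          using z(1) Y(1) by (auto simp: W_def)
        ultimately show ?thesis
          by simp
      qed
      moreover have "0 \<in> Y" "0 \<in> N"
        using Y(2) independent_familyD(1)[OF fam that] by (auto dest!: invariant_subspaceD(1) intro: csubspace_0)
      ultimately show ?thesis
        by blast
    qed
    have "independent_family (insert Y \<F>)"
      using fam Y(2) YN unfolding independent_family_def by (auto simp: Int_commute)
    then have "insert Y \<F> \<in> \<S>"
      using F(1) Y by (auto simp: \<S>_def W_def)
    then have "Y \<in> \<F>"
      using F(2)[of "insert Y \<F>"] by blast
    then show False
      using YN[of Y] Y(3) by blast
  qed
  have "norm (k y) \<le> L * e * norm y" if y: "y \<in> algebraic_sum \<F>" for y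
  proof -
    obtain \<G> where G: "finite \<G>" "\<G> \<subseteq> \<F>" "y = (\<Sum>N\<in>\<G>. cproj N y)"
      using y by (auto simp: algebraic_sum_def)
    have famG: "independent_family \<G>"
      using independent_familyD(3)[OF fam G(2)] .
    have cp: "cproj N y \<in> N" if "N \<in> \<G>" for N
      using cproj_apply(1)[OF independent_familyD(1)[OF famG that]] .
    have "(norm (k y))\<^sup>2 = (norm (\<Sum>N\<in>\<G>. k (cproj N y)))\<^sup>2"
      by (subst G(3)) (simp add: blinfun.sum_right)
    also have "\<dots> \<le> L * (\<Sum>N\<in>\<G>. (norm (k (cproj N y)))\<^sup>2)"
      unfolding L_def
    proof (rule norm_sum_le_family[OF famG G(1)])
      show "k (cproj N y) \<in> N" if "N \<in> \<G>" for N
        using fully_invariantD(1)[OF independent_familyD(1)[OF famG that] cp[OF that], of k] k(1) by simp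
    qed
    also have "\<dots> \<le> L * (\<Sum>N\<in>\<G>. e\<^sup>2 * (norm (cproj N y))\<^sup>2)"
      using L G(2) small cp by (intro mult_left_mono sum_mono) (auto simp flip: power_mult_distrib intro!: power_mono)
    also have "\<dots> = L * e\<^sup>2 * (\<Sum>N\<in>\<G>. (norm (cproj N y))\<^sup>2)"
      by (simp add: sum_distrib_left mult.assoc)
    also have "\<dots> \<le> L * e\<^sup>2 * (2 * K * norm y)\<^sup>2"
      using L sum_norm_cproj_le[OF famG G(1), of y] by (intro mult_left_mono) auto
    also have "\<dots> = (L * e * norm y)\<^sup>2"
      by (simp add: L_def power_mult_distrib power2_eq_square)
    finally show ?thesis
      using L e by (intro power2_le_imp_le[of "norm (k y)"]) auto
  qed
  then have "X \<subseteq> {y. norm (k y) \<le> L * e * norm y}"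
    unfolding X_def by (intro closure_minimal closed_Collect_le continuous_intros) auto
  then have "norm (k x) \<le> L * e * norm x"
    using MX x(1) by blast
  also have "\<dots> = norm (k x) / 2"
    using L x(2) by (simp add: e_def)
  finally show False
    using k(2) by simp
qed

end

section \<open>Joint spectral radius and existence of irreducible submodules\<close>

definition word_product :: "('a::real_normed_vector \<Rightarrow>\<^sub>L 'a) list \<Rightarrow> 'a \<Rightarrow>\<^sub>L 'a"
  where "word_product w = foldr (o\<^sub>L) w id_blinfun"

lemma word_product_Nil [simp]: "word_product [] = id_blinfun"
  by (simp add: word_product_def)

lemma word_product_snoc: "word_product (w @ [k]) = word_product w o\<^sub>L k"
  by (induction w) (simp_all add: word_product_def blinfun_eqI)

lemma word_product_commute:
  assumes "\<And>k x. k \<in> set w \<Longrightarrow> b (blinfun_apply k x) = blinfun_apply k (b x)"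
  shows "b (word_product w x) = word_product w (b x)"
  using assms by (induction w arbitrary: x) (simp_all add: word_product_def)

context reductive
begin

lemma in_closure_orbit_apply: "x \<in> closure {blinfun_apply a x | a. a \<in> A}"
  unfolding closure_approachable
proof (intro allI impI)
  fix e :: real assume "0 < e"
  then obtain a where a: "a \<in> A" "dist (ampliation a (at_coord 0 x)) (at_coord 0 x) < e"
    using in_closure_orbit[of "at_coord 0 x"] unfolding closure_approachable by blast
  have "at_coord 0 (a x) - at_coord 0 x = at_coord 0 (a x - x)"
    by (rule ell2_eqI) simp
  then have "dist (a x) x < e"
    using a(2) by (simp add: dist_norm)
  then show "\<exists>y\<in>{blinfun_apply a x | a. a \<in> A}. dist y x < e"
    using a(1) by blast
qed

text \<open>The joint spectral radius of \<open>\<K>\<close> on \<open>X\<close> is at most \<open>\<delta>\<close>, in a form that passes to extensions by subspaces on which \<open>\<K>\<close> is small modulo \<open>X\<close>.\<close>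

definition geometrically_bounded :: "('a \<Rightarrow>\<^sub>L 'a) set \<Rightarrow> real \<Rightarrow> 'a set \<Rightarrow> bool"
  where "geometrically_bounded \<K> \<delta> X \<longleftrightarrow>
    (\<exists>C. \<forall>w\<in>lists \<K>. \<forall>x\<in>X. norm (word_product w x) \<le> C * \<delta> ^ length w * norm x)"

text \<open>The last letter k of a word is split as P k + (1 - P) k. The first part lands in
  \<open>X\<close>, where words are already controlled; the second stays in \<open>Y\<close> and
  gains \<delta> / 2, half of what the induction allows.\<close>

lemma geometrically_bounded_extend:
  assumes X: "geometrically_bounded \<K> \<delta> X" and \<delta>: "0 < \<delta>" and fin: "finite \<K>"
    and P: "projection_onto X P" and inv: "\<And>k y. k \<in> \<K> \<Longrightarrow> y \<in> Y \<Longrightarrow> blinfun_apply k y - P (blinfun_apply k y) \<in> Y"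
    and small: "\<And>k y. k \<in> \<K> \<Longrightarrow> y \<in> Y \<Longrightarrow> norm (blinfun_apply k y - P (blinfun_apply k y)) \<le> \<delta> / 2 * norm y"
  shows "geometrically_bounded \<K> \<delta> Y"
proof -
  obtain C0 where C0: "\<And>w x. w \<in> lists \<K> \<Longrightarrow> x \<in> X \<Longrightarrow> norm (word_product w x) \<le> C0 * \<delta> ^ length w * norm x"
    using X unfolding geometrically_bounded_def by blast
  define C where "C = max C0 0"
  have C: "norm (word_product w x) \<le> C * \<delta> ^ length w * norm x" if "w \<in> lists \<K>" "x \<in> X" for w x
    using \<delta> by (intro order_trans[OF C0[OF that]] mult_right_mono) (auto simp: C_def)
  have C_nonneg: "0 \<le> C"
    by (simp add: C_def)
  define \<kappa> where "\<kappa> = (\<Sum>k\<in>\<K>. norm k)"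
  have \<kappa>: "norm k \<le> \<kappa>" if "k \<in> \<K>" for k
    unfolding \<kappa>_def using fin that by (intro member_le_sum) auto
  \<comment> \<open>The second term makes C norm P \<kappa> + D \<delta> / 2 at most D \<delta>,
    which closes the induction; the 1 serves the empty word.\<close>
  define D where "D = max 1 (2 * C * norm P * \<kappa> / \<delta>)"
  have "norm (word_product w y) \<le> D * \<delta> ^ length w * norm y" if "w \<in> lists \<K>" "y \<in> Y" for w y
    using that
  proof (induction w arbitrary: y rule: rev_induct)
    case Nil
    have "1 * norm y \<le> D * norm y"
      by (intro mult_right_mono) (auto simp: D_def)
    then show ?case
      by simp
  next
    case (snoc k w)
    then have k: "k \<in> \<K>" and w: "w \<in> lists \<K>"
      by auto
    have "word_product (w @ [k]) y = word_product w (P (k y)) + word_product w (k y - P (k y))"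
      by (simp add: word_product_snoc blinfun.diff_right)
    also have "norm \<dots> \<le> norm (word_product w (P (k y))) + norm (word_product w (k y - P (k y)))"
      by (rule norm_triangle_ineq)
    also have "\<dots> \<le> C * \<delta> ^ length w * (norm P * (\<kappa> * norm y)) + D * \<delta> ^ length w * (\<delta> / 2 * norm y)"
    proof (rule add_mono)
      have "norm (P (k y)) \<le> norm P * (\<kappa> * norm y)"
        using \<kappa>[OF k] by (intro order_trans[OF norm_blinfun] mult_left_mono order_trans[OF norm_blinfun] mult_right_mono) auto
      then show "norm (word_product w (P (k y))) \<le> C * \<delta> ^ length w * (norm P * (\<kappa> * norm y))"
        using \<delta> C_nonneg by (intro order_trans[OF C[OF w projection_ontoD(2)[OF P]]] mult_left_mono) auto
      have "norm (word_product w (k y - P (k y))) \<le> D * \<delta> ^ length w * norm (k y - P (k y))"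
        using w inv[OF k snoc.prems(2)] by (intro snoc.IH)
      also have "\<dots> \<le> D * \<delta> ^ length w * (\<delta> / 2 * norm y)"
        using \<delta> by (intro mult_left_mono small k snoc.prems) (auto simp: D_def)
      finally show "norm (word_product w (k y - P (k y))) \<le> D * \<delta> ^ length w * (\<delta> / 2 * norm y)" .
    qed
    also have "\<dots> = (C * norm P * \<kappa> + D * \<delta> / 2) * (\<delta> ^ length w * norm y)"
      by (simp add: algebra_simps)
    also have "\<dots> \<le> (D * \<delta>) * (\<delta> ^ length w * norm y)"
    proof (rule mult_right_mono)
      have "2 * C * norm P * \<kappa> / \<delta> \<le> D"
        by (simp add: D_def)
      then show "C * norm P * \<kappa> + D * \<delta> / 2 \<le> D * \<delta>"
        using \<delta> by (simp add: field_simps)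
    qed (use \<delta> in simp)
    finally show ?case
      by (simp add: mult_ac)
  qed
  then show ?thesis
    unfolding geometrically_bounded_def by blast
qed

text \<open>Without irreducible submodules, Zorn's lemma and compactness show that the joint spectral radius of
  every finite set of compact elements vanishes.\<close>

lemma geometrically_bounded_without_irreducible:
  assumes N: "invariant_subspace A N" "\<And>V. V \<subseteq> N \<Longrightarrow> \<not> minimal_invariant A V"
    and \<K>: "finite \<K>" "\<K> \<subseteq> J" and \<delta>: "0 < \<delta>"
  shows "geometrically_bounded \<K> \<delta> N"
proof -
  define \<S> where "\<S> = {X. X \<subseteq> N \<and> invariant_subspace A X \<and> geometrically_bounded \<K> \<delta> X}"
  \<comment> \<open>A factor 1 + K is lost in passing to complements, and
    \<open>geometrically_bounded_extend\<close> asks for \<delta> / 2.\<close>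
  define e where "e = \<delta> / (2 * (1 + K))"
  have "q * (\<delta> / (2 * q)) = \<delta> / 2" if "q \<noteq> 0" for q
    using that by simp
  from this[of "1 + K"] have e: "0 < e" "(1 + K) * e = \<delta> / 2"
    using \<delta> K by (simp_all add: e_def)
  have bounds: "\<exists>U\<in>\<S>. \<forall>X\<in>\<X>. X \<subseteq> U" if chain: "subset.chain \<S> \<X>" for \<X>
  proof (cases "\<X> = {}")
    case True
    have "{0} \<in> \<S>"
      using csubspace_0[OF invariant_subspaceD(1)[OF N(1)]]
      by (auto simp: \<S>_def invariant_subspace_zero geometrically_bounded_def blinfun.zero_right)
    then show ?thesis
      using True by blast
  next
    case False
    let ?X = "closure (\<Union>\<X>)"
    have mem: "X \<in> \<S>" if "X \<in> \<X>" for X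
      using chain that by (auto simp: subset_chain_def)
    have invX: "invariant_subspace A X" if "X \<in> \<X>" for X
      using mem[OF that] by (simp add: \<S>_def)
    have inv: "invariant_subspace A ?X"
      by (rule invariant_subspace_chain_closure[OF chain False invX])
    have sub: "?X \<subseteq> N"
      using mem invariant_subspaceD(2)[OF N(1)] by (intro closure_minimal) (auto simp: \<S>_def)
    obtain X where X: "X \<in> \<X>" "\<And>k x. k \<in> \<K> \<Longrightarrow> x \<in> ?X \<Longrightarrow> \<exists>x'\<in>X. norm (k x - x') \<le> e * norm x"
      using compact_ops_chain_uniform[OF \<K>(1) _ _ chain False invX e(1)] \<K>(2) by blast
    obtain P where P: "P \<in> B" "projection_onto X P" "norm P \<le> K"
      using projection_in_commutant[OF invX[OF X(1)]] by blast
    have "geometrically_bounded \<K> \<delta> ?X"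
    proof (rule geometrically_bounded_extend[OF _ \<delta> \<K>(1) P(2)])
      show "geometrically_bounded \<K> \<delta> X"
        using mem[OF X(1)] by (simp add: \<S>_def)
      fix k y assume k: "k \<in> \<K>" and y: "y \<in> ?X"
      have "P (k y) \<in> ?X"
        using projection_ontoD(2)[OF P(2)] X(1) closure_subset by blast
      then show "k y - P (k y) \<in> ?X"
        using k y \<K>(2) invariant_subspaceD(3)[OF inv] by (intro csubspace_diff[OF invariant_subspaceD(1)[OF inv]]) auto
      obtain x' where x': "x' \<in> X" "norm (k y - x') \<le> e * norm y"
        using X(2)[OF k y] by blast
      have "norm (k y - P (k y)) \<le> (1 + K) * norm (k y - x')"
        by (rule norm_complement_le[OF P(2,3) x'(1)])
      also have "\<dots> \<le> (1 + K) * (e * norm y)"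
        using K x'(2) by (intro mult_left_mono) auto
      finally show "norm (k y - P (k y)) \<le> \<delta> / 2 * norm y"
        by (simp add: e(2) flip: mult.assoc)
    qed
    then show ?thesis
      using inv sub closure_subset[of "\<Union>\<X>"] by (intro bexI[of _ ?X]) (auto simp: \<S>_def)
  qed
  obtain X where X: "X \<in> \<S>" and max: "\<And>Z. Z \<in> \<S> \<Longrightarrow> X \<subseteq> Z \<Longrightarrow> Z = X"
    using subset_Zorn[OF bounds] by blast
  have XN: "X \<subseteq> N" and invX: "invariant_subspace A X" and geoX: "geometrically_bounded \<K> \<delta> X"
    using X by (auto simp: \<S>_def)
  have "X = N"
  proof (rule ccontr)
    assume "X \<noteq> N"
    then obtain y where y: "y \<in> N" "y \<notin> X"
      using XN by blast
    obtain P where P: "P \<in> B" "projection_onto X P" "norm P \<le> K"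
      using projection_in_commutant[OF invX] by blast
    note P' = projection_ontoD[OF P(2)]
    define W where "W = {w \<in> N. P w = 0}"
    have W: "invariant_subspace A W"
      unfolding W_def by (rule projection_onto_vanishing[OF N(1) P(2)]) (rule commutantD[OF P(1)])
    have "y - P y \<in> W"
      using y(1) XN P' by (auto simp: W_def blinfun.diff_right intro!: csubspace_diff[OF invariant_subspaceD(1)[OF N(1)]])
    moreover have "y - P y \<noteq> 0"
      using y(2) P'(2)[of y] by auto
    ultimately have W0: "W \<noteq> {0}"
      by blast
    have "\<exists>Y\<subseteq>W. invariant_subspace A Y \<and> Y \<noteq> {0} \<and> (\<forall>k\<in>\<K>. \<forall>y\<in>Y. norm (k y) \<le> e * norm y)"
    proof (rule small_invariant_subspace[OF _ K W W0 _ \<K>(1)])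
      show "\<exists>P. projection_onto X P \<and> norm P \<le> K \<and> (\<forall>t\<in>A. \<forall>x. P (t x) = t (P x))"
        if "invariant_subspace A X" for X
        using projection_in_commutant[OF that] commutantD by blast
      show "\<not> minimal_invariant A Y" if "Y \<subseteq> W" for Y
        using N(2) that by (auto simp: W_def)
    qed (use \<K>(2) e in auto)
    then obtain Y where Y: "Y \<subseteq> W" "invariant_subspace A Y" "Y \<noteq> {0}"
      "\<And>k y. k \<in> \<K> \<Longrightarrow> y \<in> Y \<Longrightarrow> norm (k y) \<le> e * norm y"
      by auto
    define Q where "Q = id_blinfun - P"
    have Q: "Q x = x - P x" for x
      by (simp add: Q_def blinfun.diff_left)
    have QB: "Q \<in> B"
      unfolding Q_def using P(1) by simp
    \<comment> \<open>\<open>Z\<close> is the sum of \<open>X\<close> and \<open>Y\<close>. It is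
      still geometrically bounded, since the operators are small on \<open>Y\<close>, and it is
      larger than the maximal \<open>X\<close>.\<close>
    define Z where "Z = {z \<in> N. Q z \<in> Y}"
    have Z: "invariant_subspace A Z"
      unfolding Z_def by (rule invariant_subspace_preimage[OF N(1) Y(2) commutant_bounded_ops[OF QB]])
        (rule commutantD[OF QB])
    have Y0: "0 \<in> Y"
      using Y(2) by (intro csubspace_0 invariant_subspaceD(1))
    have QY: "Q y = y" if "y \<in> Y" for y
      using that Y(1) by (auto simp: Q W_def)
    have "geometrically_bounded \<K> \<delta> Z"
    proof (rule geometrically_bounded_extend[OF geoX \<delta> \<K>(1) P(2)])
      fix k z assume k: "k \<in> \<K>" and z: "z \<in> Z"
      have kA: "k \<in> A"
        using k \<K>(2) by blast
      have eq: "k z - P (k z) = k (Q z)"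
        by (simp add: Q blinfun.diff_right commutantD[OF P(1) kA])
      have Qz: "Q z \<in> Y"
        using z by (simp add: Z_def)
      then have kQz: "k (Q z) \<in> Y"
        using invariant_subspaceD(3)[OF Y(2) kA] by blast
      then show "k z - P (k z) \<in> Z"
        unfolding eq using Y(1) QY by (auto simp: Z_def W_def)
      have "norm (k (Q z)) \<le> e * norm (Q z)"
        by (rule Y(4)[OF k Qz])
      also have "\<dots> \<le> e * ((1 + K) * norm z)"
        using e(1) norm_complement_le[OF P(2,3) csubspace_0[OF invariant_subspaceD(1)[OF invX]], of z]
        by (intro mult_left_mono) (auto simp: Q)
      also have "\<dots> = \<delta> / 2 * norm z"
        using e(2) by (simp add: mult_ac)
      finally show "norm (k z - P (k z)) \<le> \<delta> / 2 * norm z"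
        unfolding eq .
    qed
    then have "Z \<in> \<S>"
      using Z by (auto simp: \<S>_def Z_def)
    moreover have "X \<subseteq> Z"
      using XN P'(3) Y0 by (auto simp: Z_def Q)
    ultimately have "Z = X"
      by (rule max)
    obtain y where y: "y \<in> Y" "y \<noteq> 0"
      using csubspace_nonzero[OF invariant_subspaceD(1)[OF Y(2)] Y(3)] by blast
    have "y \<in> Z"
      using y(1) Y(1) QY by (auto simp: Z_def W_def)
    then have "P y = y"
      using \<open>Z = X\<close> P'(3) by simp
    then show False
      using y Y(1) by (auto simp: W_def)
  qed
  then show ?thesis
    using geoX by simp
qed

text \<open>By minimality the span \<open>C\<close> of the products a b has dense orbits in
  \<open>N\<close>, so Lomonosov's theorem gives c k u = u with c a combination of products a b.
  Since the b commute with \<open>A\<close>, the n-th iterate is a sum of products of n operators b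
  and words of length n in compact elements of \<open>A\<close>. Without irreducible submodules
  these words decay faster than the factors b can grow, so u = 0.\<close>

lemma ex_irreducible:
  assumes N: "minimal_invariant (A \<union> B) N"
  shows "\<exists>V\<subseteq>N. minimal_invariant A V"
proof (rule ccontr)
  assume contra: "\<not> ?thesis"
  note N' = minimal_invariantD[OF N]
  have inv: "invariant_subspace A N"
    using N'(1) by (rule fully_invariant_imp_invariant)
  note csN = invariant_subspaceD(1)[OF inv] and clN = invariant_subspaceD(2)[OF inv]
  obtain x where x: "x \<in> N" "x \<noteq> 0"
    using csubspace_nonzero[OF csN N'(2)] by blast
  obtain k where k: "k \<in> J" "k x \<noteq> 0"
    using ex_compact_nonzero[OF x(2)] by blast
  define G where "G = {a o\<^sub>L b | a b. a \<in> A \<and> b \<in> B}"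
  define C where "C = cspan G"
  have csC: "csubspace C"
    unfolding C_def by (rule complex_vector.subspace_span)
  have G_bo: "g \<in> bounded_ops" if "g \<in> G" for g
    using that A_bounded_ops by (auto simp: G_def commutant_bounded_ops)
  have C_N: "c y \<in> N" if "c \<in> C" "y \<in> N" for c y
  proof -
    have "C \<subseteq> {c. \<forall>y\<in>N. blinfun_apply c y \<in> N}"
      unfolding C_def
    proof (rule complex_vector.span_minimal)
      show "G \<subseteq> {c. \<forall>y\<in>N. blinfun_apply c y \<in> N}"
        using fully_invariantD[OF N'(1)] by (auto simp: G_def)
      show "csubspace {c. \<forall>y\<in>N. blinfun_apply c y \<in> N}"
        by (rule csubspaceI) (auto simp: blinfun.bilinear_simps intro: csubspace_0 csubspace_add csubspace_scale csN)
    qed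
    then show ?thesis
      using that by blast
  qed
  have C_left: "t o\<^sub>L c \<in> C" if t: "t \<in> A \<union> B" and c: "c \<in> C" for t c
  proof -
    have tb: "t \<in> bounded_ops"
      using t A_bounded_ops commutant_bounded_ops by auto
    have "C \<subseteq> {c. t o\<^sub>L c \<in> C}"
      unfolding C_def
    proof (rule complex_vector.span_minimal)
      have "t o\<^sub>L (a o\<^sub>L b) \<in> G" if a: "a \<in> A" and b: "b \<in> B" for a b
        using t
      proof
        assume "t \<in> A"
        then have "t o\<^sub>L a \<in> A"
          using a by (rule A_compose)
        moreover have "t o\<^sub>L (a o\<^sub>L b) = (t o\<^sub>L a) o\<^sub>L b"
          by (rule blinfun_eqI) simp
        ultimately show ?thesis
          using b unfolding G_def by blast
      next
        assume tB: "t \<in> B"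
        then have "t o\<^sub>L b \<in> B"
          using b by simp
        moreover have "t o\<^sub>L (a o\<^sub>L b) = a o\<^sub>L (t o\<^sub>L b)"
          by (rule blinfun_eqI) (simp add: commutantD[OF tB a])
        ultimately show ?thesis
          using a unfolding G_def by blast
      qed
      then have "t o\<^sub>L g \<in> G" if "g \<in> G" for g
        using that by (auto simp: G_def)
      then show "G \<subseteq> {c. t o\<^sub>L c \<in> cspan G}"
        using complex_vector.span_base by blast
      have eqs: "t o\<^sub>L 0 = 0" "t o\<^sub>L (c + d) = (t o\<^sub>L c) + (t o\<^sub>L d)" "t o\<^sub>L (z *\<^sub>C c) = z *\<^sub>C (t o\<^sub>L c)" for c d z
        by (rule blinfun_eqI; simp add: blinfun.bilinear_simps bounded_opsD[OF tb])+
      show "csubspace {c. t o\<^sub>L c \<in> cspan G}"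
        by (rule csubspaceI) (auto simp: eqs complex_vector.span_zero complex_vector.span_add complex_vector.span_scale)
    qed
    then show ?thesis
      using c by blast
  qed
  have dense: "N \<subseteq> closure {blinfun_apply c y | c. c \<in> C}" if y: "y \<in> N" "y \<noteq> 0" for y
  proof -
    let ?X = "{blinfun_apply c y | c. c \<in> C}"
    have "fully_invariant (closure ?X)"
    proof (rule invariant_subspace_closure)
      show "csubspace ?X"
      proof (rule csubspaceI)
        show "0 \<in> ?X"
          using csubspace_0[OF csC] by force
        show "u + v \<in> ?X" if "u \<in> ?X" "v \<in> ?X" for u v
        proof -
          obtain c d where "c \<in> C" "d \<in> C" "u = c y" "v = d y"
            using \<open>u \<in> ?X\<close> \<open>v \<in> ?X\<close> by blast
          then show ?thesis
            using csubspace_add[OF csC, of c d] by (auto simp: blinfun.add_left intro!: exI[of _ "c + d"])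
        qed
        show "z *\<^sub>C u \<in> ?X" if "u \<in> ?X" for z u
        proof -
          obtain c where "c \<in> C" "u = c y"
            using \<open>u \<in> ?X\<close> by blast
          then show ?thesis
            using csubspace_scale[OF csC, of c z] by (auto intro!: exI[of _ "z *\<^sub>C c"])
        qed
      qed
      fix t u assume t: "t \<in> A \<union> B" and "u \<in> ?X"
      then obtain c where c: "c \<in> C" "u = c y"
        by blast
      have "t u = (t o\<^sub>L c) y"
        by (simp add: c(2))
      then show "t u \<in> ?X"
        using C_left[OF t c(1)] by blast
    qed
    moreover have "closure ?X \<subseteq> N"
      using C_N y(1) clN by (intro closure_minimal) auto
    moreover have "y \<in> closure ?X"
    proof -
      have "{blinfun_apply a y | a. a \<in> A} \<subseteq> ?X"
      proof safe
        fix a assume "a \<in> A"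
        then have "a o\<^sub>L id_blinfun \<in> C"
          unfolding C_def G_def by (intro complex_vector.span_base) (use B_simps(2) in blast)
        then show "\<exists>c. a y = blinfun_apply c y \<and> c \<in> C"
          by (intro exI[of _ "a o\<^sub>L id_blinfun"]) simp
      qed
      then show ?thesis
        using in_closure_orbit_apply[of y] closure_mono by blast
    qed
    ultimately have "closure ?X = N"
      using N'(3)[of "closure ?X"] y(2) by blast
    then show ?thesis
      by simp
  qed
  obtain c u where c: "c \<in> C" and u: "u \<in> N" "u \<noteq> 0" "c (k u) = u"
    using lomonosov[OF csubspace_imp_subspace[OF csN] clN csubspace_imp_subspace[OF csC] C_N dense, of k x]
      k x fully_invariantD(1)[OF N'(1)] by blast
  obtain I r where I: "finite I" "I \<subseteq> G" "c = (\<Sum>g\<in>I. r g *\<^sub>C g)"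
    using c unfolding C_def complex_vector.span_explicit by blast
  have "\<forall>g\<in>I. \<exists>a b. a \<in> A \<and> b \<in> B \<and> g = a o\<^sub>L b"
    using I(2) unfolding G_def by blast
  then obtain a b where ab: "\<And>g. g \<in> I \<Longrightarrow> a g \<in> A" "\<And>g. g \<in> I \<Longrightarrow> b g \<in> B" "\<And>g. g \<in> I \<Longrightarrow> g = a g o\<^sub>L b g"
    by metis
  \<comment> \<open>The scalars and \<open>k\<close> are joined to the factor in \<open>A\<close>,
    so that \<kappa> g is a compact element of \<open>A\<close>. As b g commutes with
    \<open>k\<close>, the map \<open>D\<close> below agrees with c k.\<close>
  define \<kappa> where "\<kappa> g = (r g *\<^sub>C a g) o\<^sub>L k" for g
  have \<kappa>: "\<kappa> g \<in> J" if "g \<in> I" for g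
    unfolding \<kappa>_def using ab(1)[OF that] k(1) by (intro J_compose csubspace_scale A_subspace)
  define D where "D y = (\<Sum>g\<in>I. \<kappa> g (b g y))" for y
  have "D u = (\<Sum>g\<in>I. r g *\<^sub>C g (k u))"
    unfolding D_def
  proof (rule sum.cong[OF refl])
    fix g assume g: "g \<in> I"
    have "b g (k u) = k (b g u)"
      using k(1) by (intro commutantD[OF ab(2)[OF g]]) auto
    then show "\<kappa> g (b g u) = r g *\<^sub>C g (k u)"
      by (subst (3) ab(3)[OF g]) (simp add: \<kappa>_def)
  qed
  then have Du: "D u = u"
    using u(3) by (simp add: I(3) blinfun.sum_left)
  define \<beta> where "\<beta> = (\<Sum>g\<in>I. norm (b g))"
  have \<beta>: "0 \<le> \<beta>"
    unfolding \<beta>_def by (simp add: sum_nonneg)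
  \<comment> \<open>One application of \<open>D\<close> costs \<beta> through the factors b and
    gains \<delta> through the longer word; the product is at most 1 / 2.\<close>
  define \<delta> where "\<delta> = 1 / (2 * (\<beta> + 1))"
  have \<delta>: "0 < \<delta>" "\<beta> * \<delta> \<le> 1 / 2"
    using \<beta> by (simp_all add: \<delta>_def field_simps)
  have "geometrically_bounded (\<kappa> ` I) \<delta> N"
    by (rule geometrically_bounded_without_irreducible[OF inv _ _ _ \<delta>(1)]) (use contra I(1) \<kappa> in auto)
  then obtain M0 where M0: "\<And>w y. w \<in> lists (\<kappa> ` I) \<Longrightarrow> y \<in> N \<Longrightarrow> norm (word_product w y) \<le> M0 * \<delta> ^ length w * norm y"
    unfolding geometrically_bounded_def by blast
  define M where "M = max M0 0"
  have M: "norm (word_product w y) \<le> M * \<delta> ^ length w * norm y" if "w \<in> lists (\<kappa> ` I)" "y \<in> N" for w y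
    using \<delta>(1) by (intro order_trans[OF M0[OF that]] mult_right_mono) (auto simp: M_def)
  \<comment> \<open>The prefix \<open>w\<close> has to be arbitrary: each application of
    \<open>D\<close> appends a letter to it, while b g moves past the word to the front.\<close>
  have iter: "norm (word_product w ((D ^^ n) y)) \<le> M * \<delta> ^ length w * (\<beta> * \<delta>) ^ n * norm y"
    if "w \<in> lists (\<kappa> ` I)" "y \<in> N" for n w y
    using that(1)
  proof (induction n arbitrary: w)
    case 0
    then show ?case
      using M[OF 0 that(2)] by simp
  next
    case (Suc n)
    have eq: "word_product w ((D ^^ Suc n) y) = (\<Sum>g\<in>I. b g (word_product (w @ [\<kappa> g]) ((D ^^ n) y)))"
    proof -
      have "word_product w ((D ^^ Suc n) y) = (\<Sum>g\<in>I. word_product (w @ [\<kappa> g]) (b g ((D ^^ n) y)))"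
        by (simp add: D_def blinfun.sum_right word_product_snoc)
      also have "\<dots> = (\<Sum>g\<in>I. b g (word_product (w @ [\<kappa> g]) ((D ^^ n) y)))"
      proof (rule sum.cong[OF refl])
        fix g assume g: "g \<in> I"
        show "word_product (w @ [\<kappa> g]) (b g ((D ^^ n) y)) = b g (word_product (w @ [\<kappa> g]) ((D ^^ n) y))"
          using Suc.prems \<kappa> g by (intro word_product_commute[symmetric] commutantD[OF ab(2)[OF g]]) auto
      qed
      finally show ?thesis .
    qed
    also have "norm \<dots> \<le> (\<Sum>g\<in>I. norm (b g) * (M * \<delta> ^ Suc (length w) * (\<beta> * \<delta>) ^ n * norm y))"
    proof (rule sum_norm_le)
      fix g assume g: "g \<in> I"
      have "norm (word_product (w @ [\<kappa> g]) ((D ^^ n) y)) \<le> M * \<delta> ^ Suc (length w) * (\<beta> * \<delta>) ^ n * norm y"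
        using Suc.IH[of "w @ [\<kappa> g]"] Suc.prems g by simp
      then show "norm (b g (word_product (w @ [\<kappa> g]) ((D ^^ n) y))) \<le> norm (b g) * (M * \<delta> ^ Suc (length w) * (\<beta> * \<delta>) ^ n * norm y)"
        by (rule order_trans[OF norm_blinfun mult_left_mono]) simp
    qed
    also have "\<dots> = \<beta> * (M * \<delta> ^ Suc (length w) * (\<beta> * \<delta>) ^ n * norm y)"
      unfolding \<beta>_def by (rule sum_distrib_right[symmetric])
    also have "\<dots> = M * \<delta> ^ length w * (\<beta> * \<delta>) ^ Suc n * norm y"
      by (simp add: mult_ac)
    finally show ?case .
  qed
  have "norm u \<le> M * (1 / 2) ^ n * norm u" for n
  proof -
    have "(D ^^ n) u = u"
      by (induction n) (simp_all add: Du)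
    then have "norm u \<le> M * (\<beta> * \<delta>) ^ n * norm u"
      using iter[of "[]" u n] u(1) by simp
    also have "\<dots> \<le> M * (1 / 2) ^ n * norm u"
      using \<delta> \<beta> by (intro mult_right_mono mult_left_mono power_mono) (auto simp: M_def)
    finally show ?thesis .
  qed
  moreover have "(\<lambda>n. M * (1 / 2) ^ n * norm u) \<longlonglongrightarrow> M * 0 * norm u"
    by (intro tendsto_intros LIMSEQ_realpow_zero) auto
  ultimately have "norm u \<le> M * 0 * norm u"
    by (intro LIMSEQ_le_const[of "\<lambda>n. M * (1 / 2) ^ n * norm u"]) auto
  then show False
    using u(2) by simp
qed

end

section \<open>Orthonormal sets\<close>

definition orthonormal :: "'a::complex_inner set \<Rightarrow> bool"
  where "orthonormal E \<longleftrightarrow> (\<forall>e\<in>E. norm e = 1) \<and> (\<forall>e\<in>E. \<forall>e'\<in>E. e \<noteq> e' \<longrightarrow> cinner e e' = 0)"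

lemma cinner_orthonormal:
  "orthonormal E \<Longrightarrow> e \<in> E \<Longrightarrow> e' \<in> E \<Longrightarrow> cinner e e' = (if e = e' then 1 else 0)"
  by (auto simp: orthonormal_def cinner_same)

lemma orthonormal_coefficient:
  assumes "orthonormal E" "finite E" "e \<in> E"
  shows "cinner (\<Sum>e\<in>E. c e *\<^sub>C e) e = c e"
proof -
  have "cinner (\<Sum>e\<in>E. c e *\<^sub>C e) e = (\<Sum>e'\<in>E. if e' = e then c e' else 0)"
    unfolding cinner_sum_left
    by (intro sum.cong refl) (simp add: cinner_scaleC_left cinner_orthonormal[OF assms(1) _ assms(3)])
  then show ?thesis
    using assms(2,3) by simp
qed

lemma norm_orthonormal_sum:
  assumes "orthonormal E" "finite E"
  shows "(norm (\<Sum>e\<in>E. c e *\<^sub>C e))\<^sup>2 = (\<Sum>e\<in>E. (cmod (c e))\<^sup>2)"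
proof -
  let ?x = "\<Sum>e\<in>E. c e *\<^sub>C e"
  have "cinner ?x ?x = (\<Sum>e\<in>E. cnj (c e) * cinner ?x e)"
    unfolding cinner_sum_right cinner_scaleC_right ..
  also have "\<dots> = (\<Sum>e\<in>E. complex_of_real ((cmod (c e))\<^sup>2))"
    by (intro sum.cong refl)
      (simp add: orthonormal_coefficient[OF assms] complex_norm_square mult.commute del: of_real_power)
  finally have "complex_of_real ((norm ?x)\<^sup>2) = complex_of_real (\<Sum>e\<in>E. (cmod (c e))\<^sup>2)"
    by (simp add: cinner_same)
  then show ?thesis
    by (simp only: of_real_eq_iff)
qed

text \<open>An orthonormal subset of greatest cardinality spans \<open>D\<close>, since otherwise
  the normalised remainder of a vector could be added to it.\<close>

lemma orthonormal_basis:
  assumes D: "csubspace D"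
    and bound: "\<And>E. finite E \<Longrightarrow> E \<subseteq> D \<Longrightarrow> orthonormal E \<Longrightarrow> card E \<le> n"
  shows "\<exists>E. finite E \<and> E \<subseteq> D \<and> orthonormal E \<and> (\<forall>w\<in>D. w = (\<Sum>e\<in>E. cinner w e *\<^sub>C e))"
proof -
  let ?P = "\<lambda>m. \<exists>E. finite E \<and> E \<subseteq> D \<and> orthonormal E \<and> card E = m"
  have "?P 0"
    by (auto intro!: exI[of _ "{}"] simp: orthonormal_def)
  moreover have "\<forall>m. ?P m \<longrightarrow> m \<le> n"
    using bound by blast
  ultimately have "\<exists>m. ?P m \<and> (\<forall>m'. ?P m' \<longrightarrow> m' \<le> m)"
    by (rule Nat.ex_has_greatest_nat)
  then obtain m where m: "?P m" and greatest: "\<And>m'. ?P m' \<Longrightarrow> m' \<le> m"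
    by blast
  obtain E where E: "finite E" "E \<subseteq> D" "orthonormal E" "card E = m"
    using m by blast
  have max: "card E' \<le> card E" if "finite E'" "E' \<subseteq> D" "orthonormal E'" for E'
    unfolding E(4) using that by (intro greatest exI[of _ E'] conjI refl)
  have "w = (\<Sum>e\<in>E. cinner w e *\<^sub>C e)" if w: "w \<in> D" for w
  proof (rule ccontr)
    assume neq: "w \<noteq> (\<Sum>e\<in>E. cinner w e *\<^sub>C e)"
    define d where "d = w - (\<Sum>e\<in>E. cinner w e *\<^sub>C e)"
    have "(\<Sum>e\<in>E. cinner w e *\<^sub>C e) \<in> D"
      using E(2) by (metis (no_types, lifting) csubspace_scale[OF D] csubspace_sum[OF D] subsetD)
    then have d: "d \<noteq> 0" "d \<in> D"
      using neq csubspace_diff[OF D w] by (simp_all add: d_def)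
    define f where "f = complex_of_real (1 / norm d) *\<^sub>C d"
    have f: "norm f = 1" "f \<in> D"
      using d by (simp_all add: f_def norm_scaleC norm_divide csubspace_scale[OF D])
    have orth: "cinner f e = 0" if "e \<in> E" for e
      unfolding f_def d_def cinner_scaleC_left cinner_diff_left orthonormal_coefficient[OF E(3,1) that, of "cinner w"]
      by simp
    have "cinner f f = 1"
      using f(1) by (simp add: cinner_same)
    then have "f \<notin> E"
      using orth[of f] by auto
    moreover have "orthonormal (insert f E)"
      using E(3) f(1) orth by (auto simp: orthonormal_def) (metis cinner_commute complex_cnj_zero)
    ultimately show False
      using max[of "insert f E"] E(1,2) f(2) by (simp add: card_insert_if)
  qed
  with E(1-3) show ?thesis
    by (intro exI[of _ E] conjI ballI)
qed

lemma orthonormal_independent: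
  assumes "orthonormal E" "finite E"
  shows "complex_vector.independent E"
proof (rule complex_vector.independent_if_scalars_zero[OF assms(2)])
  fix c e assume "(\<Sum>x\<in>E. c x *\<^sub>C x) = 0" "e \<in> E"
  then show "c e = 0"
    using orthonormal_coefficient[OF assms, of e c] by simp
qed

lemma orthonormal_basis_span:
  fixes v :: "nat \<Rightarrow> 'a::complex_inner"
  shows "\<exists>E. finite E \<and> orthonormal E \<and> (\<forall>j<n. v j = (\<Sum>e\<in>E. cinner (v j) e *\<^sub>C e))"
proof -
  have "card E \<le> card (v ` {..<n})" if "finite E" "E \<subseteq> cspan (v ` {..<n})" "orthonormal E" for E
    using complex_vector.independent_span_bound[of "v ` {..<n}" E] orthonormal_independent[OF that(3,1)] that by simp
  then have "\<exists>E. finite E \<and> E \<subseteq> cspan (v ` {..<n}) \<and> orthonormal E \<and>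
      (\<forall>w\<in>cspan (v ` {..<n}). w = (\<Sum>e\<in>E. cinner w e *\<^sub>C e))"
    by (rule orthonormal_basis[OF complex_vector.subspace_span])
  then obtain E where E: "finite E" "orthonormal E" "\<forall>w\<in>cspan (v ` {..<n}). w = (\<Sum>e\<in>E. cinner w e *\<^sub>C e)"
    by (elim exE conjE)
  have "v j = (\<Sum>e\<in>E. cinner (v j) e *\<^sub>C e)" if "j < n" for j
    using that by (intro bspec[OF E(3)] complex_vector.span_base) auto
  with E(1,2) show ?thesis
    by (intro exI[of _ E] conjI allI impI)
qed

text \<open>The operator m \<otimes> 1 has no larger norm than the scalar matrix m: the vectors are
  expanded in a finite orthonormal set and the hypothesis is applied to each coordinate.\<close>

lemma matrix_norm_vectors:
  fixes v :: "nat \<Rightarrow> 'a::complex_inner"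
  assumes m: "\<And>w. (\<Sum>i<n. (cmod (\<Sum>j<n. m i j * w j))\<^sup>2) \<le> c * (\<Sum>j<n. (cmod (w j))\<^sup>2)"
  shows "(\<Sum>i<n. (norm (\<Sum>j<n. m i j *\<^sub>C v j))\<^sup>2) \<le> c * (\<Sum>j<n. (norm (v j))\<^sup>2)"
proof -
  obtain E where E: "finite E" "orthonormal E" "\<And>j. j < n \<Longrightarrow> v j = (\<Sum>e\<in>E. cinner (v j) e *\<^sub>C e)"
    using orthonormal_basis_span[of n v] by blast
  have nv: "(norm (v j))\<^sup>2 = (\<Sum>e\<in>E. (cmod (cinner (v j) e))\<^sup>2)" if "j < n" for j
    using norm_orthonormal_sum[OF E(2,1), of "cinner (v j)"] E(3)[OF that] by simp
  have "(\<Sum>j<n. m i j *\<^sub>C v j) = (\<Sum>e\<in>E. (\<Sum>j<n. m i j * cinner (v j) e) *\<^sub>C e)" for i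
  proof -
    have "(\<Sum>j<n. m i j *\<^sub>C v j) = (\<Sum>j<n. m i j *\<^sub>C (\<Sum>e\<in>E. cinner (v j) e *\<^sub>C e))"
      using E(3) by (intro sum.cong) auto
    also have "\<dots> = (\<Sum>e\<in>E. \<Sum>j<n. (m i j * cinner (v j) e) *\<^sub>C e)"
      unfolding complex_vector.scale_sum_right scaleC_scaleC by (rule sum.swap)
    finally show ?thesis
      by (simp add: complex_vector.scale_sum_left)
  qed
  then have "(\<Sum>i<n. (norm (\<Sum>j<n. m i j *\<^sub>C v j))\<^sup>2) = (\<Sum>i<n. \<Sum>e\<in>E. (cmod (\<Sum>j<n. m i j * cinner (v j) e))\<^sup>2)"
    by (simp add: norm_orthonormal_sum[OF E(2,1)])
  also have "\<dots> = (\<Sum>e\<in>E. \<Sum>i<n. (cmod (\<Sum>j<n. m i j * cinner (v j) e))\<^sup>2)"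
    by (rule sum.swap)
  also have "\<dots> \<le> (\<Sum>e\<in>E. c * (\<Sum>j<n. (cmod (cinner (v j) e))\<^sup>2))"
    by (intro sum_mono m)
  also have "\<dots> = c * (\<Sum>j<n. \<Sum>e\<in>E. (cmod (cinner (v j) e))\<^sup>2)"
    unfolding sum_distrib_left[symmetric] by (subst sum.swap) simp
  also have "\<dots> = c * (\<Sum>j<n. (norm (v j))\<^sup>2)"
    using nv by simp
  finally show ?thesis .
qed

text \<open>Distinct orthonormal vectors are too far apart to lie in one ball of radius \<open>1 / 2\<close>.\<close>

lemma orthonormal_fixed_bound:
  fixes k :: "'a::complex_inner \<Rightarrow>\<^sub>L 'a"
  assumes "k \<in> compact_ops"
  shows "\<exists>n. \<forall>E. finite E \<longrightarrow> orthonormal E \<longrightarrow> (\<forall>e\<in>E. k e = e) \<longrightarrow> card E \<le> n"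
proof -
  let ?S = "closure (blinfun_apply k ` cball 0 1)"
  obtain C where C: "finite C" "?S \<subseteq> (\<Union>c\<in>C. ball c (1 / 2))"
    using compactE_image[OF compact_opsD(2)[OF assms], of ?S "\<lambda>c. ball c (1 / 2)"]
    by (metis UN_I centre_in_ball half_gt_zero_iff open_ball subsetI zero_less_one)
  have "card E \<le> card C" if E: "finite E" "orthonormal E" "\<forall>e\<in>E. k e = e" for E
  proof -
    have "\<exists>c\<in>C. dist c e < 1 / 2" if "e \<in> E" for e
    proof -
      have "k e \<in> ?S"
        using that E(2) by (intro subsetD[OF closure_subset] imageI) (auto simp: orthonormal_def)
      from subsetD[OF C(2) this] show ?thesis
        using that E(3) by auto
    qed
    then obtain g where g: "\<And>e. e \<in> E \<Longrightarrow> g e \<in> C" "\<And>e. e \<in> E \<Longrightarrow> dist (g e) e < 1 / 2"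
      by metis
    have "inj_on g E"
    proof (rule inj_onI, rule ccontr)
      fix e e' assume e: "e \<in> E" "e' \<in> E" "g e = g e'" "e \<noteq> e'"
      have "cinner (e - e') (e - e') = 2"
        using e E(2) by (simp add: cinner_diff_left cinner_diff_right cinner_orthonormal[OF E(2)])
      then have "Re (complex_of_real ((norm (e - e'))\<^sup>2)) = 2"
        by (simp only: cinner_same) simp
      then have "(norm (e - e'))\<^sup>2 = 2"
        by (simp only: Re_complex_of_real)
      moreover have "norm (e - e') < 1"
        using dist_triangle3[of e e' "g e"] g(2)[OF e(1)] g(2)[OF e(2)] e(3) by (simp add: dist_norm)
      then have "(norm (e - e'))\<^sup>2 < 1"
        by (simp add: power_less_one_iff)
      ultimately show False
        by simp
    qed
    then show ?thesis
      using card_inj_on_le[of g E C] C(1) g(1) by blast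
  qed
  then show ?thesis
    by blast
qed

text \<open>Split off a root, p = (X - \<mu>) q. Either q(s) w is an eigenvector for \<mu>, or it
  vanishes and q has smaller degree.\<close>

lemma eigenvector_exists:
  fixes s :: "'a::complex_inner \<Rightarrow>\<^sub>L 'a" and p :: "complex poly"
  assumes s: "s \<in> bounded_ops" and V: "csubspace V" "\<And>v. v \<in> V \<Longrightarrow> s v \<in> V"
    and p: "p \<noteq> 0" "degree p \<le> n" "(\<Sum>i\<le>n. coeff p i *\<^sub>C (blinfun_apply s ^^ i) w) = 0" and w: "w \<in> V" "w \<noteq> 0"
  shows "\<exists>\<mu>. \<exists>v\<in>V. v \<noteq> 0 \<and> s v = \<mu> *\<^sub>C v"
  using p
proof (induction n arbitrary: p)
  case 0
  then have "coeff p 0 *\<^sub>C w = 0" "coeff p 0 \<noteq> 0"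
    by (auto simp: leading_coeff_0_iff[symmetric] simp del: leading_coeff_0_iff)
  then show ?case
    using w(2) by simp
next
  case (Suc n)
  show ?case
  proof (cases "degree p \<le> n")
    case True
    then have "coeff p (Suc n) = 0"
      by (simp add: coeff_eq_0)
    then show ?thesis
      using Suc.IH[OF Suc.prems(1) True] Suc.prems(3) by simp
  next
    case False
    then have deg: "degree p = Suc n"
      using Suc.prems(2) by simp
    have "\<not> constant (poly p)"
      using deg by (simp add: constant_degree)
    then obtain \<mu> where "poly p \<mu> = 0"
      using fundamental_theorem_of_algebra by blast
    then obtain q where q: "p = [:- \<mu>, 1:] * q"
      unfolding poly_eq_0_iff_dvd by blast
    have q0: "q \<noteq> 0"
      using Suc.prems(1) q by auto
    have dq: "degree q = n"
      using deg q0 unfolding q by (subst (asm) degree_mult_eq) auto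
    define v where "v = (\<Sum>i\<le>n. coeff q i *\<^sub>C (blinfun_apply s ^^ i) w)"
    have pw: "(blinfun_apply s ^^ i) w \<in> V" for i
      by (induction i) (simp_all add: w V)
    have vV: "v \<in> V"
      unfolding v_def by (intro csubspace_sum[OF V(1)] csubspace_scale[OF V(1)] pw)
    have cp: "coeff p i = coeff (pCons 0 q) i - \<mu> * coeff q i" for i
      by (simp add: q)
    have "s v - \<mu> *\<^sub>C v = (\<Sum>i\<le>Suc n. coeff p i *\<^sub>C (blinfun_apply s ^^ i) w)"
    proof -
      have "s v = (\<Sum>i\<le>n. coeff q i *\<^sub>C (blinfun_apply s ^^ Suc i) w)"
        by (simp add: v_def blinfun.sum_right bounded_opsD[OF s])
      also have "\<dots> = (\<Sum>i\<le>Suc n. coeff (pCons 0 q) i *\<^sub>C (blinfun_apply s ^^ i) w)"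
        by (subst sum.atMost_Suc_shift) simp
      finally have 1: "s v = (\<Sum>i\<le>Suc n. coeff (pCons 0 q) i *\<^sub>C (blinfun_apply s ^^ i) w)" .
      have "coeff q (Suc n) = 0"
        using dq by (simp add: coeff_eq_0)
      then have 2: "\<mu> *\<^sub>C v = (\<Sum>i\<le>Suc n. (\<mu> * coeff q i) *\<^sub>C (blinfun_apply s ^^ i) w)"
        by (simp add: v_def complex_vector.scale_sum_right scaleC_scaleC)
      show ?thesis
        unfolding 1 2 cp by (simp add: sum_subtractf complex_vector.scale_left_diff_distrib del: sum.atMost_Suc)
    qed
    then have eig: "s v = \<mu> *\<^sub>C v"
      using Suc.prems(3) by simp
    show ?thesis
    proof (cases "v = 0")
      case True
      then show ?thesis
        using Suc.IH[OF q0] dq by (simp add: v_def)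
    next
      case False
      then show ?thesis
        using eig vV by blast
    qed
  qed
qed

context reductive
begin

section \<open>Irreducible submodules and isotypic components\<close>

text \<open>Lomonosov's theorem for \<open>A\<close> itself, whose orbits in \<open>V\<close> are
  dense by irreducibility. The operator a k it produces lies in \<open>J\<close>; the finite
  dimension of its fixed space is the source of all finiteness below.\<close>

lemma irreducible_fixed_vector:
  assumes V: "minimal_invariant A V"
  shows "\<exists>k\<in>J. \<exists>u\<in>V. norm u = 1 \<and> k u = u"
proof -
  note V' = minimal_invariantD[OF V]
  note inv = invariant_subspaceD[OF V'(1)]
  obtain x where x: "x \<in> V" "x \<noteq> 0"
    using csubspace_nonzero[OF inv(1) V'(2)] by blast
  obtain k where k: "k \<in> J" "k x \<noteq> 0"
    using ex_compact_nonzero[OF x(2)] by blast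
  have dense: "V \<subseteq> closure {blinfun_apply a y | a. a \<in> A}" if y: "y \<in> V" "y \<noteq> 0" for y
  proof -
    let ?X = "{blinfun_apply a y | a. a \<in> A}"
    have "invariant_subspace A (closure ?X)"
    proof (rule invariant_subspace_closure)
      show "csubspace ?X"
      proof (rule csubspaceI)
        show "0 \<in> ?X"
          using csubspace_0[OF A_subspace] by force
        show "u + v \<in> ?X" if uv: "u \<in> ?X" "v \<in> ?X" for u v
        proof -
          obtain c d where "c \<in> A" "d \<in> A" "u = c y" "v = d y"
            using uv by blast
          then show ?thesis
            using csubspace_add[OF A_subspace, of c d] by (auto simp: blinfun.add_left intro!: exI[of _ "c + d"])
        qed
        show "z *\<^sub>C u \<in> ?X" if u: "u \<in> ?X" for z u
        proof -
          obtain c where "c \<in> A" "u = c y"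
            using u by blast
          then show ?thesis
            using csubspace_scale[OF A_subspace, of c z] by (auto intro!: exI[of _ "z *\<^sub>C c"])
        qed
      qed
      fix t u assume t: "t \<in> A" and "u \<in> ?X"
      then obtain c where c: "c \<in> A" "u = c y"
        by blast
      have "t u = (t o\<^sub>L c) y"
        by (simp add: c(2))
      then show "t u \<in> ?X"
        using A_compose[OF t c(1)] by blast
    qed
    moreover have "closure ?X \<subseteq> V"
      using inv(2,3) y(1) by (intro closure_minimal) auto
    ultimately have "closure ?X = V"
      using V'(3)[of "closure ?X"] y(2) in_closure_orbit_apply[of y] by blast
    then show ?thesis
      by simp
  qed
  obtain a u where a: "a \<in> A" and u: "u \<in> V" "u \<noteq> 0" "a (k u) = u"
    using lomonosov[OF csubspace_imp_subspace[OF inv(1)] inv(2) csubspace_imp_subspace[OF A_subspace] inv(3) dense, of k x]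
      k x inv(3) by blast
  define u' where "u' = (1 / norm u) *\<^sub>R u"
  have "norm u' = 1" "(a o\<^sub>L k) u' = u'"
    using u by (simp_all add: u'_def blinfun.scaleR_right)
  moreover have "u' \<in> V"
    using u(1) inv(1) by (simp add: u'_def scaleR_scaleC csubspace_scale)
  ultimately show ?thesis
    using J_compose[OF a k(1)] by blast
qed

text \<open>The kernel of s - \<mu> in \<open>V\<close> is a nonzero submodule.\<close>

lemma irreducible_eigenvalue:
  assumes V: "minimal_invariant A V" and s: "s \<in> B" and v: "v \<in> V" "v \<noteq> 0" "s v = \<mu> *\<^sub>C v" and x: "x \<in> V"
  shows "s x = \<mu> *\<^sub>C x"
proof -
  note V' = minimal_invariantD[OF V]
  define r where "r = s - \<mu> *\<^sub>C id_blinfun"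
  have r: "r \<in> B" "r y = s y - \<mu> *\<^sub>C y" for y
    unfolding r_def using s by (simp_all add: blinfun.diff_left)
  have "invariant_subspace A {x \<in> V. r x \<in> {0}}"
    by (rule invariant_subspace_preimage[OF V'(1) invariant_subspace_zero commutant_bounded_ops[OF r(1)]])
      (rule commutantD[OF r(1)])
  then have "{x \<in> V. r x \<in> {0}} = V"
    using V'(3)[of "{x \<in> V. r x \<in> {0}}"] v r(2) by auto
  then have "r x = 0"
    using x by blast
  then show ?thesis
    by (simp add: r(2))
qed

text \<open>\<open>V\<close> may have infinite dimension, so an eigenvalue does not come for free.
  As s commutes with k, the iterates of s on u remain in the finite-dimensional space of vectors
  fixed by k and hence satisfy a polynomial relation.\<close>

lemma schur:
  assumes V: "minimal_invariant A V" and s: "s \<in> B" "\<And>v. v \<in> V \<Longrightarrow> s v \<in> V"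
  shows "\<exists>\<mu>. \<forall>v\<in>V. s v = \<mu> *\<^sub>C v"
proof -
  note V' = minimal_invariantD[OF V]
  obtain k u where k: "k \<in> J" and u: "u \<in> V" "norm u = 1" "k u = u"
    using irreducible_fixed_vector[OF V] by blast
  obtain n where n: "\<And>E. finite E \<Longrightarrow> orthonormal E \<Longrightarrow> (\<And>e. e \<in> E \<Longrightarrow> k e = e) \<Longrightarrow> card E \<le> n"
    using orthonormal_fixed_bound[of k] k by blast
  define D where "D = {w. k w = w}"
  have csD: "csubspace D"
    using k by (intro csubspaceI) (auto simp: D_def blinfun.bilinear_simps A_scaleC)
  have "card E \<le> n" if "finite E" "E \<subseteq> D" "orthonormal E" for E
    using n[OF that(1,3)] that(2) by (auto simp: D_def)
  then have "\<exists>E. finite E \<and> E \<subseteq> D \<and> orthonormal E \<and> (\<forall>w\<in>D. w = (\<Sum>e\<in>E. cinner w e *\<^sub>C e))"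
    by (rule orthonormal_basis[OF csD])
  then obtain E where E: "finite E" "orthonormal E" "\<forall>w\<in>D. w = (\<Sum>e\<in>E. cinner w e *\<^sub>C e)"
    by (elim exE conjE)
  have pD: "(blinfun_apply s ^^ i) u \<in> D" for i
  proof (induction i)
    case (Suc i)
    then show ?case
      using k commutantD[OF s(1), of k "(blinfun_apply s ^^ i) u"] by (simp add: D_def)
  qed (simp add: D_def u)
  have "\<exists>p. p \<noteq> 0 \<and> degree p \<le> card E \<and> (\<Sum>i\<le>card E. coeff p i *\<^sub>C (blinfun_apply s ^^ i) u) = 0"
  \<comment> \<open>Linear dependence is a notion for sets, so a repetition among the iterates is
    treated separately; it gives the relation X^i - X^j.\<close>
  proof (cases "inj_on (\<lambda>i. (blinfun_apply s ^^ i) u) {..card E}")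
    case False
    then obtain i j where ij: "i \<le> card E" "j \<le> card E" "i \<noteq> j" "(blinfun_apply s ^^ i) u = (blinfun_apply s ^^ j) u"
      by (auto simp: inj_on_def)
    define p :: "complex poly" where "p = monom 1 i - monom 1 j"
    have "coeff p i \<noteq> 0"
      using ij(3) by (simp add: p_def)
    then have "p \<noteq> 0"
      by auto
    moreover have "degree p \<le> card E"
      unfolding p_def using ij by (intro degree_diff_le order_trans[OF degree_monom_le])
    moreover have "coeff p l *\<^sub>C x = (if l = i then x else 0) - (if l = j then x else 0)" for l and x :: 'a
      by (simp add: p_def complex_vector.scale_left_diff_distrib)
    then have "(\<Sum>l\<le>card E. coeff p l *\<^sub>C (blinfun_apply s ^^ l) u) = 0"
      using ij by (simp add: sum_subtractf)
    ultimately show ?thesis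
      by blast
  next
    case True
    let ?S = "(\<lambda>i. (blinfun_apply s ^^ i) u) ` {..card E}"
    have "?S \<subseteq> cspan E"
    proof safe
      fix i
      show "(blinfun_apply s ^^ i) u \<in> cspan E"
        by (subst bspec[OF E(3) pD])
          (intro complex_vector.span_sum complex_vector.span_scale complex_vector.span_base)
    qed
    moreover have "card ?S = Suc (card E)"
      using True by (simp add: card_image)
    ultimately have "complex_vector.dependent ?S"
      using complex_vector.independent_span_bound[OF E(1), of ?S] by auto
    then obtain c where c: "(\<Sum>x\<in>?S. c x *\<^sub>C x) = 0" "\<exists>x\<in>?S. c x \<noteq> 0"
      by (subst (asm) complex_vector.dependent_finite) auto
    define p where "p = (\<Sum>i\<le>card E. monom (c ((blinfun_apply s ^^ i) u)) i)"
    have coeff: "coeff p i = (if i \<le> card E then c ((blinfun_apply s ^^ i) u) else 0)" for i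
      by (simp add: p_def coeff_sum)
    have "p \<noteq> 0"
    proof
      assume "p = 0"
      then have "c ((blinfun_apply s ^^ i) u) = 0" if "i \<le> card E" for i
        using coeff[of i] that by simp
      then show False
        using c(2) by auto
    qed
    moreover have "degree p \<le> card E"
      by (rule degree_le) (simp add: coeff)
    moreover have "(\<Sum>i\<le>card E. coeff p i *\<^sub>C (blinfun_apply s ^^ i) u) = 0"
      using c(1) True by (simp add: sum.reindex coeff)
    ultimately show ?thesis
      by blast
  qed
  then obtain p where p: "p \<noteq> 0" "degree p \<le> card E" "(\<Sum>i\<le>card E. coeff p i *\<^sub>C (blinfun_apply s ^^ i) u) = 0"
    by blast
  have "u \<noteq> 0"
    using u(2) by auto
  then obtain \<mu> v where "v \<in> V" "v \<noteq> 0" "s v = \<mu> *\<^sub>C v"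
    using eigenvector_exists[OF commutant_bounded_ops[OF s(1)] invariant_subspaceD(1)[OF V'(1)] s(2) p u(1)] by blast
  then show ?thesis
    using irreducible_eigenvalue[OF V s(1)] by blast
qed

end

section \<open>Frames of isotypic components\<close>

lemma norm_orthonormal_family:
  fixes e :: "nat \<Rightarrow> 'a::complex_inner"
  assumes "\<And>i j. i < n \<Longrightarrow> j < n \<Longrightarrow> cinner (e i) (e j) = (if i = j then 1 else 0)"
  shows "(norm (\<Sum>i<n. c i *\<^sub>C e i))\<^sup>2 = (\<Sum>i<n. (cmod (c i))\<^sup>2)"
proof -
  let ?x = "\<Sum>i<n. c i *\<^sub>C e i"
  have x: "cinner ?x (e i) = c i" if i: "i < n" for i
  proof -
    have "cinner ?x (e i) = (\<Sum>j<n. if j = i then c j else 0)"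
      unfolding cinner_sum_left by (intro sum.cong refl) (simp add: cinner_scaleC_left assms i)
    then show ?thesis
      using i by simp
  qed
  have "cinner ?x ?x = (\<Sum>i<n. cnj (c i) * cinner ?x (e i))"
    unfolding cinner_sum_right cinner_scaleC_right ..
  also have "\<dots> = (\<Sum>i<n. complex_of_real ((cmod (c i))\<^sup>2))"
    by (intro sum.cong refl) (simp add: x complex_norm_square mult.commute del: of_real_power)
  finally have "complex_of_real ((norm ?x)\<^sup>2) = complex_of_real (\<Sum>i<n. (cmod (c i))\<^sup>2)"
    by (simp add: cinner_same)
  then show ?thesis
    by (simp only: of_real_eq_iff)
qed

context reductive
begin

text \<open>The vectors b u with b in \<open>B\<close> are fixed by k, so they form a
  finite-dimensional space; the \<phi> i are chosen such that the \<phi> i u are an orthonormal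
  basis of it. If b and a combination of the \<phi> i agree on u, they agree on \<open>V\<close> by
  irreducibility. Thus n is the multiplicity of \<open>V\<close>.\<close>

lemma irreducible_frame:
  assumes V: "minimal_invariant A V"
  shows "\<exists>u\<in>V. \<exists>(n :: nat) \<phi>. norm u = 1 \<and> (\<forall>i<n. \<phi> i \<in> B) \<and>
    (\<forall>i<n. \<forall>j<n. cinner (\<phi> i u) (\<phi> j u) = (if i = j then 1 else 0)) \<and>
    (\<forall>b\<in>B. \<exists>\<beta>. \<forall>v\<in>V. b v = (\<Sum>i<n. \<beta> i *\<^sub>C \<phi> i v))"
proof -
  note V' = minimal_invariantD[OF V]
  obtain k u where k: "k \<in> J" and u: "u \<in> V" "norm u = 1" "k u = u"
    using irreducible_fixed_vector[OF V] by blast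
  define D where "D = {blinfun_apply b u | b. b \<in> B}"
  have csD: "csubspace D"
  proof (rule csubspaceI)
    show "0 \<in> D"
      unfolding D_def by (auto intro!: exI[of _ "0 :: 'a \<Rightarrow>\<^sub>L 'a"])
    show "x + y \<in> D" if xy: "x \<in> D" "y \<in> D" for x y
    proof -
      obtain b b' where "b \<in> B" "b' \<in> B" "x = b u" "y = b' u"
        using xy by (auto simp: D_def)
      then show ?thesis
        unfolding D_def by (auto intro!: exI[of _ "b + b'"] simp: blinfun.add_left)
    qed
    show "c *\<^sub>C x \<in> D" if x: "x \<in> D" for c x
    proof -
      obtain b where "b \<in> B" "x = b u"
        using x by (auto simp: D_def)
      then show ?thesis
        unfolding D_def by (auto intro!: exI[of _ "c *\<^sub>C b"])
    qed
  qed
  have kD: "k x = x" if "x \<in> D" for x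
    using that u(3) k by (auto simp: D_def simp flip: commutantD)
  obtain m where "\<And>E. finite E \<Longrightarrow> orthonormal E \<Longrightarrow> (\<And>e. e \<in> E \<Longrightarrow> k e = e) \<Longrightarrow> card E \<le> m"
    using orthonormal_fixed_bound[of k] k by blast
  then have "card E \<le> m" if "finite E" "E \<subseteq> D" "orthonormal E" for E
    using that kD by blast
  then have "\<exists>E. finite E \<and> E \<subseteq> D \<and> orthonormal E \<and> (\<forall>w\<in>D. w = (\<Sum>e\<in>E. cinner w e *\<^sub>C e))"
    by (rule orthonormal_basis[OF csD])
  then obtain E where E: "finite E" "E \<subseteq> D" "orthonormal E" "\<forall>w\<in>D. w = (\<Sum>e\<in>E. cinner w e *\<^sub>C e)"
    by (elim exE conjE)
  obtain n :: nat and e where e: "E = e ` {i. i < n}" "inj_on e {i. i < n}"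
    using finite_imp_nat_seg_image_inj_on[OF E(1)] by metis
  have "\<exists>b. b \<in> B \<and> e i = b u" if "i < n" for i
    using E(2) e(1) that unfolding D_def by auto
  then obtain \<phi> where \<phi>: "\<And>i. i < n \<Longrightarrow> \<phi> i \<in> B" "\<And>i. i < n \<Longrightarrow> e i = \<phi> i u"
    by metis
  have "cinner (\<phi> i u) (\<phi> j u) = (if i = j then 1 else 0)" if "i < n" "j < n" for i j
  proof -
    have "cinner (e i) (e j) = (if e i = e j then 1 else 0)"
      using that e(1) by (intro cinner_orthonormal[OF E(3)]) auto
    then show ?thesis
      using that e(2) \<phi>(2) by (auto simp: inj_on_def)
  qed
  moreover have "\<exists>\<beta>. \<forall>v\<in>V. b v = (\<Sum>i<n. \<beta> i *\<^sub>C \<phi> i v)" if b: "b \<in> B" for b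
  proof -
    define \<beta> where "\<beta> i = cinner (b u) (e i)" for i
    define r where "r = b - (\<Sum>i<n. \<beta> i *\<^sub>C \<phi> i)"
    have "(\<Sum>i<m. \<beta> i *\<^sub>C \<phi> i) \<in> B" if "m \<le> n" for m
      using that \<phi>(1) by (induction m) auto
    then have rB: "r \<in> B"
      unfolding r_def using b by simp
    have r: "r v = b v - (\<Sum>i<n. \<beta> i *\<^sub>C \<phi> i v)" for v
      by (simp add: r_def blinfun.diff_left blinfun.sum_left)
    have "b u = (\<Sum>e\<in>E. cinner (b u) e *\<^sub>C e)"
      using b by (intro bspec[OF E(4)]) (auto simp: D_def)
    also have "\<dots> = (\<Sum>i<n. \<beta> i *\<^sub>C \<phi> i u)"
      unfolding e(1) using e(2) \<phi>(2) by (subst sum.reindex) (auto simp: \<beta>_def lessThan_def intro!: sum.cong)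
    finally have "r u = 0"
      by (simp add: r)
    moreover have "u \<noteq> 0"
      using u(2) by auto
    ultimately have "r v = 0" if "v \<in> V" for v
      using irreducible_eigenvalue[OF V rB u(1), of 0 v] that by simp
    then show ?thesis
      using r by (intro exI[of _ \<beta>]) simp
  qed
  ultimately show ?thesis
    using u(1,2) \<phi>(1) by blast
qed

text \<open>The entries of a projection onto the graph of \<open>v \<mapsto> t (\<Sum>i. \<phi>\<^sub>i v\<^sub>i)\<close>, which are scalar matrices by
  Schur's lemma.\<close>

lemma frame_graph_projection:
  fixes n :: nat
  assumes V: "minimal_invariant A V" and in_B: "\<forall>i<n. \<phi> i \<in> B" and t: "0 < t"
  shows "\<exists>x y. \<forall>v. (\<forall>i<n. v i \<in> V) \<longrightarrow>
    (\<forall>i<n. v i = (\<Sum>j<n. x i j *\<^sub>C v j) + t *\<^sub>R (\<Sum>j<n. y i j *\<^sub>C v j)) \<and>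
    (norm (t *\<^sub>R (\<Sum>i<n. \<phi> i (\<Sum>j<n. x i j *\<^sub>C v j))))\<^sup>2 \<le> K\<^sup>2 * (\<Sum>j<n. (norm (v j))\<^sup>2) \<and>
    (\<Sum>i<n. (norm (\<Sum>j<n. y i j *\<^sub>C v j))\<^sup>2) \<le> K\<^sup>2 * (norm (\<Sum>j<n. \<phi> j (v j)))\<^sup>2"
proof -
  note \<phi> = in_B[rule_format]
  note V' = minimal_invariantD[OF V]
  note inv = invariant_subspaceD[OF V'(1)]
  define R where "R v = (\<Sum>i<n. blinfun_apply (\<phi> i) (v i))" for v :: "nat \<Rightarrow> 'a"
  \<comment> \<open>Coordinate 0 carries t R v and the coordinates 1 to n carry v, hence the shift
    by \<open>Suc\<close>.\<close>
  define \<Gamma> where "\<Gamma> = {z. ell2_nth z 0 = t *\<^sub>R R (\<lambda>i. ell2_nth z (Suc i)) \<and> (\<forall>i<n. ell2_nth z (Suc i) \<in> V) \<and>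
      (\<forall>i>n. ell2_nth z i = 0)}"
  have "submodule A \<Gamma>"
    unfolding submodule_def
  proof (intro conjI ballI)
    show "csubspace \<Gamma>"
    proof (rule csubspaceI)
      show "0 \<in> \<Gamma>"
        using inv(1) by (simp add: \<Gamma>_def R_def blinfun.zero_right csubspace_0)
      show "z + z' \<in> \<Gamma>" if "z \<in> \<Gamma>" "z' \<in> \<Gamma>" for z z'
        using that inv(1) by (simp add: \<Gamma>_def R_def blinfun.add_right csubspace_add sum.distrib scaleR_add_right)
      show "c *\<^sub>C z \<in> \<Gamma>" if "z \<in> \<Gamma>" for c z
      proof -
        have "R (\<lambda>i. c *\<^sub>C ell2_nth z (Suc i)) = c *\<^sub>C R (\<lambda>i. ell2_nth z (Suc i))"
          unfolding R_def complex_vector.scale_sum_right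
          by (intro sum.cong refl) (simp add: commutant_scaleC_apply[OF \<phi>])
        then show ?thesis
          using that inv(1) by (simp add: \<Gamma>_def csubspace_scale scaleR_scaleC scaleC_scaleC mult.commute)
      qed
    qed
    have "\<Gamma> = {z. ell2_nth z 0 = t *\<^sub>R R (\<lambda>i. ell2_nth z (Suc i))} \<inter>
        (\<Inter>i\<in>{..<n}. (\<lambda>z. ell2_nth z (Suc i)) -` V) \<inter> (\<Inter>i\<in>{n<..}. (\<lambda>z. ell2_nth z i) -` {0})"
      by (auto simp: \<Gamma>_def)
    also have "closed \<dots>"
      unfolding R_def
      by (intro closed_Int closed_INT ballI closed_vimage closed_singleton closed_Collect_eq inv(2))
        (auto intro!: continuous_intros)
    finally show "closed \<Gamma>" .
    fix a z assume a: "a \<in> A" and z: "z \<in> \<Gamma>"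
    have "a (t *\<^sub>R R (\<lambda>i. ell2_nth z (Suc i))) = t *\<^sub>R R (\<lambda>i. a (ell2_nth z (Suc i)))"
      unfolding R_def blinfun.scaleR_right blinfun.sum_right
      by (intro arg_cong[where f = "(*\<^sub>R) t"] sum.cong refl) (simp add: commutantD[OF \<phi> a])
    then show "ampliation a z \<in> \<Gamma>"
      using z inv(3)[OF a] by (simp add: \<Gamma>_def blinfun.zero_right)
  qed
  then obtain P where P: "module_projection A \<Gamma> P" "norm P \<le> K"
    using projections by blast
  have P\<Gamma>: "P z \<in> \<Gamma>" and P_id: "z \<in> \<Gamma> \<Longrightarrow> P z = z" for z
    using P(1) by (auto simp: module_projection_def)
  note EB = entry_commutant[OF P(1)]
  have EV: "entry P (Suc i) j h \<in> V" if "i < n" for i j h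
    using P\<Gamma>[of "at_coord j h"] that by (simp add: entry_apply \<Gamma>_def)
  have "\<exists>\<mu>. \<forall>v\<in>V. entry P (Suc i) (Suc j) v = \<mu> *\<^sub>C v" if "i < n" for i j
    by (rule schur[OF V EB EV[OF that]])
  then obtain x where x: "\<And>i j v. i < n \<Longrightarrow> v \<in> V \<Longrightarrow> entry P (Suc i) (Suc j) v = x i j *\<^sub>C v"
    by metis
  \<comment> \<open>Schur's lemma needs operators that map \<open>V\<close> to itself; the entries
    with column 0 do so after composition with \<phi> j.\<close>
  have "\<exists>\<mu>. \<forall>v\<in>V. entry P (Suc i) 0 (\<phi> j v) = \<mu> *\<^sub>C v" if "i < n" "j < n" for i j
    using schur[OF V, of "entry P (Suc i) 0 o\<^sub>L \<phi> j"] EB \<phi>[OF that(2)] EV[OF that(1)] by simp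
  then obtain y where y: "\<And>i j v. i < n \<Longrightarrow> j < n \<Longrightarrow> v \<in> V \<Longrightarrow> entry P (Suc i) 0 (\<phi> j v) = y i j *\<^sub>C v"
    by metis
  have main: "(\<forall>i<n. v i = (\<Sum>j<n. x i j *\<^sub>C v j) + t *\<^sub>R (\<Sum>j<n. y i j *\<^sub>C v j)) \<and>
    (norm (t *\<^sub>R (\<Sum>i<n. \<phi> i (\<Sum>j<n. x i j *\<^sub>C v j))))\<^sup>2 \<le> K\<^sup>2 * (\<Sum>j<n. (norm (v j))\<^sup>2) \<and>
    (\<Sum>i<n. (norm (\<Sum>j<n. y i j *\<^sub>C v j))\<^sup>2) \<le> K\<^sup>2 * (norm (\<Sum>j<n. \<phi> j (v j)))\<^sup>2"
    if v: "\<forall>i<n. v i \<in> V" for v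
  proof -
    define z where "z = (\<Sum>j<n. at_coord (Suc j) (v j))"
    have z_nth: "ell2_nth z 0 = 0" "ell2_nth z (Suc i) = (if i < n then v i else 0)" for i
      by (simp_all add: z_def)
    have nz: "(norm z)\<^sup>2 = (\<Sum>j<n. (norm (v j))\<^sup>2)"
    proof -
      have "(norm z)\<^sup>2 = (\<Sum>i<Suc n. (norm (ell2_nth z i))\<^sup>2)"
        by (rule norm_ell2_finite) (auto simp: z_def)
      then show ?thesis
        by (simp add: sum.lessThan_Suc_shift z_nth del: sum.lessThan_Suc)
    qed
    have Pz: "ell2_nth (P z) (Suc i) = (\<Sum>j<n. x i j *\<^sub>C v j)" if "i < n" for i
      unfolding z_def blinfun.sum_right ell2_nth_sum using v
      by (intro sum.cong refl) (simp add: x[OF that] flip: entry_apply)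
    define z' where "z' = at_coord 0 (R v)"
    have Pz': "ell2_nth (P z') (Suc i) = (\<Sum>j<n. y i j *\<^sub>C v j)" if "i < n" for i
    proof -
      have "ell2_nth (P z') (Suc i) = entry P (Suc i) 0 (R v)"
        by (simp add: z'_def entry_apply)
      also have "\<dots> = (\<Sum>j<n. y i j *\<^sub>C v j)"
        unfolding R_def blinfun.sum_right using v by (intro sum.cong refl) (simp add: y[OF that])
      finally show ?thesis .
    qed
    have Pbound: "(norm (P w))\<^sup>2 \<le> K\<^sup>2 * (norm w)\<^sup>2" for w
    proof -
      have "norm (P w) \<le> K * norm w"
        by (rule order_trans[OF norm_blinfun mult_right_mono[OF P(2)]]) simp
      from power_mono[OF this, of 2] show ?thesis
        by (simp add: power_mult_distrib)
    qed
    show ?thesis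
    proof (intro conjI allI impI)
      fix i assume i: "i < n"
      have "R (\<lambda>i. ell2_nth (z + t *\<^sub>R z') (Suc i)) = R v"
        unfolding R_def by (intro sum.cong refl) (simp add: z_nth z'_def)
      then have "z + t *\<^sub>R z' \<in> \<Gamma>"
        using v by (auto simp: \<Gamma>_def z_nth z'_def) (simp add: z_def)
      then have "P z + t *\<^sub>R P z' = z + t *\<^sub>R z'"
        using P_id[of "z + t *\<^sub>R z'"] by (simp add: blinfun.add_right blinfun.scaleR_right)
      from arg_cong[OF this, of "\<lambda>z. ell2_nth z (Suc i)"]
      show "v i = (\<Sum>j<n. x i j *\<^sub>C v j) + t *\<^sub>R (\<Sum>j<n. y i j *\<^sub>C v j)"
        using i by (simp add: Pz Pz' z_nth) (simp add: z'_def)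
    next
      have "ell2_nth (P z) 0 = t *\<^sub>R R (\<lambda>i. ell2_nth (P z) (Suc i))"
        using P\<Gamma>[of z] by (simp add: \<Gamma>_def)
      also have "R (\<lambda>i. ell2_nth (P z) (Suc i)) = (\<Sum>i<n. \<phi> i (\<Sum>j<n. x i j *\<^sub>C v j))"
        unfolding R_def by (intro sum.cong refl) (simp add: Pz)
      finally have "(norm (t *\<^sub>R (\<Sum>i<n. \<phi> i (\<Sum>j<n. x i j *\<^sub>C v j))))\<^sup>2 \<le> (norm (P z))\<^sup>2"
        using power_mono[OF norm_ell2_nth_le[of "P z" 0], of 2] by simp
      also have "\<dots> \<le> K\<^sup>2 * (\<Sum>j<n. (norm (v j))\<^sup>2)"
        using Pbound[of z] nz by simp
      finally show "(norm (t *\<^sub>R (\<Sum>i<n. \<phi> i (\<Sum>j<n. x i j *\<^sub>C v j))))\<^sup>2 \<le> K\<^sup>2 * (\<Sum>j<n. (norm (v j))\<^sup>2)" .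
    next
      have "(\<Sum>i<n. (norm (\<Sum>j<n. y i j *\<^sub>C v j))\<^sup>2) = (\<Sum>i<n. (norm (ell2_nth (P z') (Suc i)))\<^sup>2)"
        by (simp add: Pz')
      also have "\<dots> \<le> (\<Sum>i<Suc n. (norm (ell2_nth (P z') i))\<^sup>2)"
        by (simp add: sum.lessThan_Suc_shift del: sum.lessThan_Suc)
      also have "\<dots> \<le> (norm (P z'))\<^sup>2"
        by (rule sum_norm_ell2_le)
      also have "\<dots> \<le> K\<^sup>2 * (norm (R v))\<^sup>2"
        using Pbound[of z'] by (simp add: z'_def)
      finally show "(\<Sum>i<n. (norm (\<Sum>j<n. y i j *\<^sub>C v j))\<^sup>2) \<le> K\<^sup>2 * (norm (\<Sum>j<n. \<phi> j (v j)))\<^sup>2"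
        by (simp add: R_def)
    qed
  qed
  then show ?thesis
    by (intro exI[of _ x] exI[of _ y] allI impI)
qed

text \<open>Taking \<open>t = 2 K\<close> and \<open>t = 1 / (2 K)\<close>, one of the two scalar matrices has norm at most \<open>1 / 2\<close>.\<close>

lemma frame_bounds:
  fixes n :: nat
  assumes V: "minimal_invariant A V" and in_B: "\<forall>i<n. \<phi> i \<in> B"
    and u: "u \<in> V" and orth: "\<And>i j. i < n \<Longrightarrow> j < n \<Longrightarrow> cinner (\<phi> i u) (\<phi> j u) = (if i = j then 1 else 0)"
    and nu: "norm u = 1" and v: "\<And>i. i < n \<Longrightarrow> v i \<in> V"
  shows "(\<Sum>i<n. (norm (v i))\<^sup>2) \<le> (4 * K\<^sup>2)\<^sup>2 * (norm (\<Sum>i<n. \<phi> i (v i)))\<^sup>2"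
    and "(norm (\<Sum>i<n. \<phi> i (v i)))\<^sup>2 \<le> (4 * K\<^sup>2)\<^sup>2 * (\<Sum>i<n. (norm (v i))\<^sup>2)"
proof -
  note \<phi> = in_B[rule_format]
  note V' = minimal_invariantD[OF V]
  note inv = invariant_subspaceD[OF V'(1)]
  define R where "R v = (\<Sum>i<n. blinfun_apply (\<phi> i) (v i))" for v :: "nat \<Rightarrow> 'a"
  define L where "L v = L2_set (\<lambda>i. norm (v i)) {..<n}" for v :: "nat \<Rightarrow> 'a"
  have L2: "(L v)\<^sup>2 = (\<Sum>i<n. (norm (v i))\<^sup>2)" and L0: "0 \<le> L v" for v
    by (simp_all add: L_def L2_set_def sum_nonneg)
  \<comment> \<open>On multiples of u the map R is isometric, because the \<phi> i u are
    orthonormal. So the norms of the scalar matrices can be read off before R is known to be well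
    bounded.\<close>
  have R_u: "(norm (\<Sum>i<n. \<phi> i (w i *\<^sub>C u)))\<^sup>2 = (\<Sum>i<n. (cmod (w i))\<^sup>2)" for w
  proof -
    have "(\<Sum>i<n. \<phi> i (w i *\<^sub>C u)) = (\<Sum>i<n. w i *\<^sub>C \<phi> i u)"
      by (intro sum.cong refl) (simp add: commutant_scaleC_apply[OF \<phi>])
    then show ?thesis
      using norm_orthonormal_family[of n "\<lambda>i. \<phi> i u" w] orth by simp
  qed
  have mu: "(\<Sum>j<n. m i j *\<^sub>C (w j *\<^sub>C u)) = (\<Sum>j<n. m i j * w j) *\<^sub>C u" for m :: "nat \<Rightarrow> nat \<Rightarrow> complex" and i w
    by (simp add: complex_vector.scale_sum_left scaleC_scaleC)
  have mV: "(\<Sum>j<n. m j *\<^sub>C v j) \<in> V" if "\<And>j. j < n \<Longrightarrow> v j \<in> V" for m v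
    by (rule csubspace_sum[OF inv(1)]) (use that in \<open>auto intro: csubspace_scale[OF inv(1)]\<close>)
  have K0: "K > 0"
    using K by simp
  show "(\<Sum>i<n. (norm (v i))\<^sup>2) \<le> (4 * K\<^sup>2)\<^sup>2 * (norm (\<Sum>i<n. \<phi> i (v i)))\<^sup>2"
  proof -
    define t where "t = 2 * K"
    have t: "0 < t"
      using K0 by (simp add: t_def)
    obtain x y where "\<forall>v. (\<forall>i<n. v i \<in> V) \<longrightarrow>
      (\<forall>i<n. v i = (\<Sum>j<n. x i j *\<^sub>C v j) + t *\<^sub>R (\<Sum>j<n. y i j *\<^sub>C v j)) \<and>
      (norm (t *\<^sub>R (\<Sum>i<n. \<phi> i (\<Sum>j<n. x i j *\<^sub>C v j))))\<^sup>2 \<le> K\<^sup>2 * (\<Sum>j<n. (norm (v j))\<^sup>2) \<and>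
      (\<Sum>i<n. (norm (\<Sum>j<n. y i j *\<^sub>C v j))\<^sup>2) \<le> K\<^sup>2 * (norm (\<Sum>j<n. \<phi> j (v j)))\<^sup>2"
      using frame_graph_projection[OF V in_B t] by (elim exE)
    note xy = this[THEN spec, THEN mp]
    note xy1 = xy[THEN conjunct1] and xy2 = xy[THEN conjunct2, THEN conjunct1]
      and xy3 = xy[THEN conjunct2, THEN conjunct2]
    have x_bound: "(\<Sum>i<n. (cmod (\<Sum>j<n. x i j * w j))\<^sup>2) \<le> (1 / 4) * (\<Sum>j<n. (cmod (w j))\<^sup>2)" for w
    proof -
      have "\<forall>i<n. w i *\<^sub>C u \<in> V"
        using u by (simp add: csubspace_scale[OF inv(1)])
      from xy2[OF this]
      have "t\<^sup>2 * (norm (\<Sum>i<n. \<phi> i (\<Sum>j<n. x i j *\<^sub>C (w j *\<^sub>C u))))\<^sup>2 \<le> K\<^sup>2 * (\<Sum>j<n. (norm (w j *\<^sub>C u))\<^sup>2)"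
        by (simp add: power_mult_distrib)
      then have "t\<^sup>2 * (\<Sum>i<n. (cmod (\<Sum>j<n. x i j * w j))\<^sup>2) \<le> K\<^sup>2 * (\<Sum>j<n. (cmod (w j))\<^sup>2)"
        unfolding mu R_u by (simp add: norm_scaleC nu)
      then show ?thesis
        using K0 by (simp add: t_def power_mult_distrib mult.assoc)
    qed
    define xv yv where "xv i = (\<Sum>j<n. x i j *\<^sub>C v j)" and "yv i = (\<Sum>j<n. y i j *\<^sub>C v j)" for i
    have vi: "\<forall>i<n. v i \<in> V"
      using v by blast
    have "(norm (v i))\<^sup>2 \<le> 2 * (norm (xv i))\<^sup>2 + 2 * t\<^sup>2 * (norm (yv i))\<^sup>2" if "i < n" for i
    proof -
      have "v i = xv i + t *\<^sub>R yv i"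
        using xy1[OF vi] that unfolding xv_def yv_def by blast
      then have "norm (v i) \<le> norm (xv i) + t * norm (yv i)"
        using norm_triangle_ineq[of "xv i" "t *\<^sub>R yv i"] t by simp
      then have "(norm (v i))\<^sup>2 \<le> (norm (xv i) + t * norm (yv i))\<^sup>2"
        by (intro power_mono) auto
      also have "\<dots> \<le> 2 * (norm (xv i))\<^sup>2 + 2 * (t * norm (yv i))\<^sup>2"
        using sum_squares_bound[of "norm (xv i)" "t * norm (yv i)"] by (simp add: power2_sum)
      finally show ?thesis
        by (simp add: power_mult_distrib)
    qed
    then have "(\<Sum>i<n. (norm (v i))\<^sup>2) \<le> (\<Sum>i<n. 2 * (norm (xv i))\<^sup>2 + 2 * t\<^sup>2 * (norm (yv i))\<^sup>2)"
      by (intro sum_mono) auto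
    also have "\<dots> = 2 * (\<Sum>i<n. (norm (xv i))\<^sup>2) + 2 * t\<^sup>2 * (\<Sum>i<n. (norm (yv i))\<^sup>2)"
      by (simp add: sum.distrib sum_distrib_left)
    also have "\<dots> \<le> 2 * ((1 / 4) * (\<Sum>i<n. (norm (v i))\<^sup>2)) + 2 * t\<^sup>2 * (K\<^sup>2 * (norm (\<Sum>i<n. \<phi> i (v i)))\<^sup>2)"
      using matrix_norm_vectors[OF x_bound, of v] xy3[OF vi]
      unfolding xv_def yv_def by (intro add_mono mult_left_mono) auto
    finally show ?thesis
      by (simp add: t_def power_mult_distrib power2_eq_square algebra_simps)
  qed
  show "(norm (\<Sum>i<n. \<phi> i (v i)))\<^sup>2 \<le> (4 * K\<^sup>2)\<^sup>2 * (\<Sum>i<n. (norm (v i))\<^sup>2)"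
  proof -
    define t where "t = 1 / (2 * K)"
    have t: "0 < t"
      using K0 by (simp add: t_def)
    obtain x y where "\<forall>v. (\<forall>i<n. v i \<in> V) \<longrightarrow>
      (\<forall>i<n. v i = (\<Sum>j<n. x i j *\<^sub>C v j) + t *\<^sub>R (\<Sum>j<n. y i j *\<^sub>C v j)) \<and>
      (norm (t *\<^sub>R (\<Sum>i<n. \<phi> i (\<Sum>j<n. x i j *\<^sub>C v j))))\<^sup>2 \<le> K\<^sup>2 * (\<Sum>j<n. (norm (v j))\<^sup>2) \<and>
      (\<Sum>i<n. (norm (\<Sum>j<n. y i j *\<^sub>C v j))\<^sup>2) \<le> K\<^sup>2 * (norm (\<Sum>j<n. \<phi> j (v j)))\<^sup>2"
      using frame_graph_projection[OF V in_B t] by (elim exE)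
    note xy = this[THEN spec, THEN mp]
    note xy1 = xy[THEN conjunct1] and xy2 = xy[THEN conjunct2, THEN conjunct1]
      and xy3 = xy[THEN conjunct2, THEN conjunct2]
    have y_bound: "(\<Sum>i<n. (cmod (\<Sum>j<n. y i j * w j))\<^sup>2) \<le> K\<^sup>2 * (\<Sum>j<n. (cmod (w j))\<^sup>2)" for w
    proof -
      have "\<forall>i<n. w i *\<^sub>C u \<in> V"
        using u by (simp add: csubspace_scale[OF inv(1)])
      from xy3[OF this]
      have "(\<Sum>i<n. (norm (\<Sum>j<n. y i j *\<^sub>C (w j *\<^sub>C u)))\<^sup>2) \<le> K\<^sup>2 * (norm (\<Sum>j<n. \<phi> j (w j *\<^sub>C u)))\<^sup>2"
        by blast
      then show ?thesis
        unfolding mu R_u by (simp add: norm_scaleC nu)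
    qed
    \<comment> \<open>A bound \<rho> for R improves to \<open>2 * K\<^sup>2 + \<rho> / 2\<close>,
      whose fixed point is \<open>4 * K\<^sup>2\<close>. The iteration may start from a bound that
      depends on \<phi>, since it is forgotten in the limit.\<close>
    have improve: "norm (R v) \<le> (2 * K\<^sup>2 + \<rho> / 2) * L v"
      if \<rho>: "0 \<le> \<rho>" "\<And>v. \<forall>i<n. v i \<in> V \<Longrightarrow> norm (R v) \<le> \<rho> * L v" and v: "\<forall>i<n. v i \<in> V" for \<rho> v
    proof -
      define xv yv where "xv i = (\<Sum>j<n. x i j *\<^sub>C v j)" and "yv i = (\<Sum>j<n. y i j *\<^sub>C v j)" for i
      have "R v = R xv + t *\<^sub>R R yv"
      proof -
        have "\<phi> i (v i) = \<phi> i (xv i) + t *\<^sub>R \<phi> i (yv i)" if "i < n" for i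
        proof -
          have "v i = xv i + t *\<^sub>R yv i"
            using xy1[OF v] that unfolding xv_def yv_def by blast
          then show ?thesis
            by (simp add: blinfun.add_right blinfun.scaleR_right)
        qed
        then show ?thesis
          by (simp add: R_def sum.distrib scaleR_sum_right)
      qed
      then have "norm (R v) \<le> norm (R xv) + t * norm (R yv)"
        using norm_triangle_ineq[of "R xv" "t *\<^sub>R R yv"] t by simp
      moreover have "norm (R xv) \<le> 2 * K\<^sup>2 * L v"
      proof -
        have "(t * norm (R xv))\<^sup>2 \<le> (K * L v)\<^sup>2"
          using xy2[OF v] t by (simp add: R_def xv_def power_mult_distrib L2)
        then have "t * norm (R xv) \<le> K * L v"
          by (rule power2_le_imp_le) (use L0[of v] K0 in simp)
        then show ?thesis
          using K0 by (simp add: t_def field_simps power2_eq_square)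
      qed
      moreover have "norm (R yv) \<le> \<rho> * (K * L v)"
      proof -
        have "(L yv)\<^sup>2 \<le> (K * L v)\<^sup>2"
          using matrix_norm_vectors[OF y_bound, of v] unfolding L2 yv_def by (simp add: power_mult_distrib L2)
        then have "L yv \<le> K * L v"
          by (rule power2_le_imp_le) (use L0[of v] K0 in simp)
        moreover have "norm (R yv) \<le> \<rho> * L yv"
          using mV v by (intro \<rho>(2)) (simp add: yv_def)
        ultimately show ?thesis
          using \<rho>(1) by (meson mult_left_mono order_trans)
      qed
      then have "t * norm (R yv) \<le> t * (\<rho> * (K * L v))"
        using t by (intro mult_left_mono) auto
      moreover have "t * (\<rho> * (K * L v)) = \<rho> / 2 * L v"
        using K0 by (simp add: t_def)
      ultimately show ?thesis
        by (simp add: distrib_right)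
    qed
    define \<rho>0 where "\<rho>0 = (\<Sum>i<n. norm (\<phi> i))"
    have \<rho>0: "0 \<le> \<rho>0" "norm (R v) \<le> \<rho>0 * L v" for v
    proof -
      show "0 \<le> \<rho>0"
        by (simp add: \<rho>0_def sum_nonneg)
      have "norm (R v) \<le> (\<Sum>i<n. norm (\<phi> i) * L v)"
        unfolding R_def
      proof (rule sum_norm_le)
        fix i assume "i \<in> {..<n}"
        then have "norm (v i) \<le> L v"
          unfolding L_def by (intro member_le_L2_set) auto
        then show "norm (\<phi> i (v i)) \<le> norm (\<phi> i) * L v"
          by (rule order_trans[OF norm_blinfun mult_left_mono]) simp
      qed
      then show "norm (R v) \<le> \<rho>0 * L v"
        by (simp add: \<rho>0_def sum_distrib_right)
    qed
    define r where "r k = 4 * K\<^sup>2 + (1 / 2) ^ k * \<rho>0" for k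
    have r: "norm (R v) \<le> r k * L v" if "\<forall>i<n. v i \<in> V" for k v
      using that
    proof (induction k arbitrary: v)
      case 0
      have "\<rho>0 * L v \<le> r 0 * L v"
        using L0[of v] by (intro mult_right_mono) (auto simp: r_def)
      then show ?case
        using \<rho>0(2)[of v] by linarith
    next
      case (Suc k)
      have "norm (R v) \<le> (2 * K\<^sup>2 + r k / 2) * L v"
        using \<rho>0(1) Suc.IH by (intro improve Suc.prems) (auto simp: r_def)
      also have "2 * K\<^sup>2 + r k / 2 = r (Suc k)"
        by (simp add: r_def)
      finally show ?case .
    qed
    have vi: "\<forall>i<n. v i \<in> V"
      using v by blast
    have "(\<lambda>k. r k * L v) \<longlonglongrightarrow> (4 * K\<^sup>2 + 0 * \<rho>0) * L v"
      unfolding r_def by (intro tendsto_intros LIMSEQ_realpow_zero) auto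
    then have "norm (R v) \<le> (4 * K\<^sup>2 + 0 * \<rho>0) * L v"
      using r[OF vi] by (intro LIMSEQ_le_const[of "\<lambda>k. r k * L v"]) auto
    then have "(norm (R v))\<^sup>2 \<le> (4 * K\<^sup>2 * L v)\<^sup>2"
      by (intro power_mono) auto
    then show ?thesis
      by (simp add: R_def power_mult_distrib L2)
  qed
qed

text \<open>The sum \<open>X\<close> of the images \<phi> i V is closed by the lower frame bound. It
  is invariant under \<open>A\<close>, with which the \<phi> i commute, and under \<open>B\<close>,
  whose elements are combinations of the \<phi> i on \<open>V\<close>. By minimality it is all of
  \<open>N\<close>.\<close>

lemma isotypic_component:
  assumes N: "minimal_invariant (A \<union> B) N"
  shows "\<exists>V u (n :: nat) \<phi>. minimal_invariant A V \<and> V \<subseteq> N \<and> u \<in> V \<and> u \<noteq> 0 \<and> 0 < n \<and> (\<forall>i<n. \<phi> i \<in> B) \<and>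
    (\<forall>v. (\<forall>i<n. v i \<in> V) \<longrightarrow>
      (\<Sum>i<n. (norm (v i))\<^sup>2) \<le> (4 * K\<^sup>2)\<^sup>2 * (norm (\<Sum>i<n. \<phi> i (v i)))\<^sup>2 \<and>
      (norm (\<Sum>i<n. \<phi> i (v i)))\<^sup>2 \<le> (4 * K\<^sup>2)\<^sup>2 * (\<Sum>i<n. (norm (v i))\<^sup>2)) \<and>
    N = {\<Sum>i<n. \<phi> i (v i) | v. \<forall>i<n. v i \<in> V} \<and>
    (\<forall>b\<in>B. \<exists>\<beta>. \<forall>v\<in>V. b v = (\<Sum>i<n. \<beta> i *\<^sub>C \<phi> i v))"
proof -
  note N' = minimal_invariantD[OF N]
  note csN = invariant_subspaceD(1)[OF N'(1)]
  obtain V where V: "V \<subseteq> N" "minimal_invariant A V"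
    using ex_irreducible[OF N] by blast
  note V' = minimal_invariantD[OF V(2)]
  note inv = invariant_subspaceD[OF V'(1)]
  obtain u and n :: nat and \<phi> where u: "u \<in> V" "norm u = 1" and frame: "\<forall>i<n. \<phi> i \<in> B"
    "\<forall>i<n. \<forall>j<n. cinner (\<phi> i u) (\<phi> j u) = (if i = j then 1 else 0)"
    and span: "\<forall>b\<in>B. \<exists>\<beta>. \<forall>v\<in>V. b v = (\<Sum>i<n. \<beta> i *\<^sub>C \<phi> i v)"
    using irreducible_frame[OF V(2)] by (elim bexE exE conjE)
  note \<phi> = frame(1)[rule_format] and orth = frame(2)[rule_format]
  note bounds = frame_bounds[OF V(2) frame(1) u(1) orth u(2)]
  have u0: "u \<noteq> 0"
    using u(2) by auto
  define X where "X = {\<Sum>i<n. \<phi> i (v i) | v. \<forall>i<n. v i \<in> V}"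
  have BX: "blinfun_apply b v \<in> X" if b: "b \<in> B" and v: "v \<in> V" for b v
  proof -
    obtain \<beta> where "b v = (\<Sum>i<n. \<beta> i *\<^sub>C \<phi> i v)"
      using bspec[OF span b] v by blast
    also have "\<dots> = (\<Sum>i<n. \<phi> i (\<beta> i *\<^sub>C v))"
      by (intro sum.cong refl) (simp add: commutant_scaleC_apply[OF \<phi>])
    finally show ?thesis
      unfolding X_def using csubspace_scale[OF inv(1) v] by (intro CollectI exI[of _ "\<lambda>i. \<beta> i *\<^sub>C v"]) simp
  qed
  have csX: "csubspace X"
  proof (rule csubspaceI)
    show "0 \<in> X"
      unfolding X_def using csubspace_0[OF inv(1)]
      by (intro CollectI exI[of _ "\<lambda>_. 0"]) (simp add: blinfun.zero_right)
    show "x + y \<in> X" if xy: "x \<in> X" "y \<in> X" for x y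
    proof -
      obtain v w where "\<forall>i<n. v i \<in> V" "x = (\<Sum>i<n. \<phi> i (v i))" "\<forall>i<n. w i \<in> V" "y = (\<Sum>i<n. \<phi> i (w i))"
        using xy by (auto simp: X_def)
      then show ?thesis
        unfolding X_def using csubspace_add[OF inv(1)]
        by (intro CollectI exI[of _ "\<lambda>i. v i + w i"]) (simp add: blinfun.add_right sum.distrib)
    qed
    show "c *\<^sub>C x \<in> X" if x: "x \<in> X" for c x
    proof -
      obtain v where v: "\<forall>i<n. v i \<in> V" "x = (\<Sum>i<n. \<phi> i (v i))"
        using x by (auto simp: X_def)
      have "c *\<^sub>C x = (\<Sum>i<n. \<phi> i (c *\<^sub>C v i))"
        unfolding v(2) complex_vector.scale_sum_right
        by (intro sum.cong refl) (simp add: commutant_scaleC_apply[OF \<phi>])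
      then show ?thesis
        unfolding X_def using v(1) csubspace_scale[OF inv(1)]
        by (intro CollectI exI[of _ "\<lambda>i. c *\<^sub>C v i"]) simp
    qed
  qed
  have XN: "X \<subseteq> N"
    unfolding X_def using V(1) fully_invariantD(2)[OF N'(1) _ \<phi>] by (auto intro!: csubspace_sum[OF csN])
  have "closed X"
    unfolding closed_sequential_limits
  proof (intro allI impI, elim conjE)
    fix S x assume S: "\<forall>k. S k \<in> X" and lim: "S \<longlonglongrightarrow> x"
    have "\<exists>v. (\<forall>i<n. v i \<in> V) \<and> S k = (\<Sum>i<n. \<phi> i (v i))" for k
      using S by (auto simp: X_def)
    then obtain v where v: "\<And>k i. i < n \<Longrightarrow> v k i \<in> V" "\<And>k. S k = (\<Sum>i<n. \<phi> i (v k i))"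
      by metis
    have diff: "norm (v k i - v l i) \<le> 4 * K\<^sup>2 * norm (S k - S l)" if i: "i < n" for k l i
    proof -
      have "(norm (v k i - v l i))\<^sup>2 \<le> (\<Sum>i<n. (norm (v k i - v l i))\<^sup>2)"
        using i by (intro member_le_sum[where f = "\<lambda>i. (norm (v k i - v l i))\<^sup>2"]) auto
      also have "\<dots> \<le> (4 * K\<^sup>2)\<^sup>2 * (norm (\<Sum>i<n. \<phi> i (v k i - v l i)))\<^sup>2"
        using v(1) by (intro bounds(1)) (auto intro: csubspace_diff[OF inv(1)])
      also have "\<dots> = (4 * K\<^sup>2 * norm (S k - S l))\<^sup>2"
        by (simp add: v(2) blinfun.diff_right sum_subtractf power_mult_distrib)
      finally show ?thesis
        by (intro power2_le_imp_le[of "norm (v k i - v l i)"]) auto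
    qed
    have "\<exists>l. l \<in> V \<and> (\<lambda>k. v k i) \<longlonglongrightarrow> l" if i: "i < n" for i
    proof -
      have "Cauchy (\<lambda>k. v k i)"
      proof (rule metric_CauchyI)
        fix e :: real assume e: "0 < e"
        have K2: "0 < 4 * K\<^sup>2"
          using K by simp
        obtain M where M: "\<And>k l. k \<ge> M \<Longrightarrow> l \<ge> M \<Longrightarrow> dist (S k) (S l) < e / (4 * K\<^sup>2)"
          using metric_CauchyD[OF LIMSEQ_imp_Cauchy[OF lim], of "e / (4 * K\<^sup>2)"] e K2 by auto
        have "dist (v k i) (v l i) < e" if "k \<ge> M" "l \<ge> M" for k l
        proof -
          have "4 * K\<^sup>2 * norm (S k - S l) < 4 * K\<^sup>2 * (e / (4 * K\<^sup>2))"
            using M[OF that] K2 by (intro mult_strict_left_mono) (auto simp: dist_norm)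
          then show ?thesis
            using diff[OF i, of k l] K2 by (simp add: dist_norm)
        qed
        then show "\<exists>M. \<forall>k\<ge>M. \<forall>l\<ge>M. dist (v k i) (v l i) < e"
          by blast
      qed
      then obtain l where l: "(\<lambda>k. v k i) \<longlonglongrightarrow> l"
        using Cauchy_convergent convergent_def by blast
      moreover have "l \<in> V"
        by (rule closed_sequentially[OF inv(2) _ l]) (rule v(1)[OF i])
      ultimately show ?thesis
        by blast
    qed
    then obtain l where l: "\<And>i. i < n \<Longrightarrow> l i \<in> V" "\<And>i. i < n \<Longrightarrow> (\<lambda>k. v k i) \<longlonglongrightarrow> l i"
      by metis
    have "(\<lambda>k. \<Sum>i<n. \<phi> i (v k i)) \<longlonglongrightarrow> (\<Sum>i<n. \<phi> i (l i))"
      using l(2) by (intro tendsto_sum blinfun.tendsto tendsto_const) auto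
    then have "x = (\<Sum>i<n. \<phi> i (l i))"
      unfolding v(2)[symmetric] by (rule LIMSEQ_unique[OF lim])
    then show "x \<in> X"
      unfolding X_def using l(1) by blast
  qed
  have "fully_invariant X"
    unfolding invariant_subspace_def
  proof (intro conjI ballI csX \<open>closed X\<close>)
    fix s x assume s: "s \<in> A \<union> B" and "x \<in> X"
    then obtain v where v: "\<forall>i<n. v i \<in> V" "x = (\<Sum>i<n. \<phi> i (v i))"
      by (auto simp: X_def)
    show "s x \<in> X"
      unfolding v(2) blinfun.sum_right
    proof (rule csubspace_sum[OF csX])
      fix i assume "i \<in> {..<n}"
      then have i: "i < n"
        by simp
      show "s (\<phi> i (v i)) \<in> X"
        using s
      proof
        assume "s \<in> A"
        then have "s (\<phi> i (v i)) = \<phi> i (s (v i))" "s (v i) \<in> V"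
          using commutantD[OF \<phi>[OF i]] inv(3) v(1) i by auto
        then show ?thesis
          using BX[OF \<phi>[OF i]] by simp
      next
        assume "s \<in> B"
        then show ?thesis
          using BX[of "s o\<^sub>L \<phi> i" "v i"] \<phi>[OF i] v(1) i by simp
      qed
    qed
  qed
  moreover have "u \<in> X"
    using BX[of id_blinfun u] u(1) by simp
  ultimately have "X = N"
    using N'(3)[OF XN] u0 by blast
  moreover have "0 < n"
  proof (rule ccontr)
    assume "\<not> 0 < n"
    then show False
      using \<open>u \<in> X\<close> u0 by (simp add: X_def)
  qed
  ultimately show ?thesis
    using V u(1) u0 \<phi> span bounds unfolding X_def by (intro exI[of _ V] exI[of _ u] exI[of _ n] exI[of _ \<phi>]) auto
qed

end

section \<open>Square roots of positive definite operators\<close>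

lemma closed_bounded_ops: "closed (bounded_ops :: ('a::complex_inner \<Rightarrow>\<^sub>L 'a) set)"
proof -
  have eq: "bounded_ops = (\<Inter>c. \<Inter>x. {T :: 'a \<Rightarrow>\<^sub>L 'a. T (c *\<^sub>C x) = c *\<^sub>C T x})"
    by (auto simp: bounded_ops_def)
  show ?thesis
    unfolding eq
    by (intro closed_INT ballI closed_Collect_eq linear_continuous_on
        bounded_linear_compose[OF bounded_linear_scaleC_right] blinfun.bounded_linear_left)
qed

text \<open>Right and left inverses are fixed points of the contractions Z \<mapsto> 1 + Y Z and Z
  \<mapsto> 1 + Z Y, and they coincide. Working inside \<open>bounded_ops\<close> keeps the inverse
  complex linear.\<close>

lemma inverse_one_minus:
  fixes Y :: "'a::chilbert_space \<Rightarrow>\<^sub>L 'a"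
  assumes Y: "Y \<in> bounded_ops" "norm Y < 1"
  shows "\<exists>Z\<in>bounded_ops. (id_blinfun - Y) o\<^sub>L Z = id_blinfun \<and> Z o\<^sub>L (id_blinfun - Y) = id_blinfun"
proof -
  have complete: "complete (bounded_ops :: ('a \<Rightarrow>\<^sub>L 'a) set)"
    using closed_bounded_ops by (simp add: complete_eq_closed)
  have d1: "(id_blinfun + (Y o\<^sub>L Z)) - (id_blinfun + (Y o\<^sub>L W)) = Y o\<^sub>L (Z - W)"
    and d2: "(id_blinfun + (Z o\<^sub>L Y)) - (id_blinfun + (W o\<^sub>L Y)) = (Z - W) o\<^sub>L Y" for Z W
    by (rule blinfun_eqI; simp add: blinfun.bilinear_simps)+
  have "\<exists>!Z\<in>bounded_ops. id_blinfun + (Y o\<^sub>L Z) = Z"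
  proof (rule Banach_fix[OF complete, where c = "norm Y"])
    show "dist (id_blinfun + (Y o\<^sub>L Z)) (id_blinfun + (Y o\<^sub>L W)) \<le> norm Y * dist Z W" for Z W
      unfolding dist_norm d1 by (rule norm_blinfun_compose)
  qed (use Y bounded_ops_simps(1) in auto)
  then obtain Z where Z: "Z \<in> bounded_ops" "id_blinfun + (Y o\<^sub>L Z) = Z"
    by blast
  have "\<exists>!Z\<in>bounded_ops. id_blinfun + (Z o\<^sub>L Y) = Z"
  proof (rule Banach_fix[OF complete, where c = "norm Y"])
    show "dist (id_blinfun + (Z o\<^sub>L Y)) (id_blinfun + (W o\<^sub>L Y)) \<le> norm Y * dist Z W" for Z W
      unfolding dist_norm d2 using norm_blinfun_compose[of "Z - W" Y] by (simp add: mult.commute)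
  qed (use Y bounded_ops_simps(1) in auto)
  then obtain W where W: "W \<in> bounded_ops" "id_blinfun + (W o\<^sub>L Y) = W"
    by blast
  have Zx: "Z x - Y (Z x) = x" for x
    using arg_cong[OF Z(2), of "\<lambda>T. T x"] by (simp add: blinfun.add_left algebra_simps)
  have Wx: "W x - W (Y x) = x" for x
    using arg_cong[OF W(2), of "\<lambda>T. T x"] by (simp add: blinfun.add_left algebra_simps)
  have "Z x = W x" for x
    using Wx[of "Z x"] Zx[of x] by (metis blinfun.diff_right)
  then have "Z = W"
    by (rule blinfun_eqI)
  have "(id_blinfun - Y) o\<^sub>L Z = id_blinfun" "Z o\<^sub>L (id_blinfun - Y) = id_blinfun"
    by (rule blinfun_eqI; simp add: blinfun.bilinear_simps Zx Wx \<open>Z = W\<close>[symmetric])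
      (rule blinfun_eqI; simp add: blinfun.bilinear_simps Wx \<open>Z = W\<close>)
  then show ?thesis
    using Z(1) by blast
qed

text \<open>Polarisation bounds 4 inner (X x) y by the form at x + y alone, as the form at x - y is
  nonnegative. The choice of y as the multiple of X x with the norm of x then bounds norm (X
  x).\<close>

lemma norm_positive_le:
  fixes X :: "'a::real_inner \<Rightarrow>\<^sub>L 'a"
  assumes sym: "\<And>x y. inner (X x) y = inner x (X y)"
    and pos: "\<And>x. 0 \<le> inner (X x) x" and le: "\<And>x. inner (X x) x \<le> r * (norm x)\<^sup>2" and r: "0 \<le> r"
  shows "norm X \<le> r"
proof (rule norm_blinfun_bound[OF r])
  fix x
  have key: "2 * inner (X x) y \<le> r * (norm x)\<^sup>2 + r * (norm y)\<^sup>2" for x y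
  proof -
    have "4 * inner (X x) y = inner (X (x + y)) (x + y) - inner (X (x - y)) (x - y)"
      using sym[of y x] by (simp add: blinfun.bilinear_simps inner_add_left inner_add_right inner_diff_left
          inner_diff_right inner_commute)
    also have "\<dots> \<le> r * (norm (x + y))\<^sup>2"
      using pos[of "x - y"] le[of "x + y"] by linarith
    finally have 1: "4 * inner (X x) y \<le> r * (norm (x + y))\<^sup>2" .
    have "(norm (x + y))\<^sup>2 + (norm (x - y))\<^sup>2 = 2 * (norm x)\<^sup>2 + 2 * (norm y)\<^sup>2"
      by (simp add: power2_norm_eq_inner inner_add_left inner_add_right inner_diff_left inner_diff_right inner_commute)
    then have "(norm (x + y))\<^sup>2 \<le> 2 * (norm x)\<^sup>2 + 2 * (norm y)\<^sup>2"
      using zero_le_power2[of "norm (x - y)"] by linarith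
    then have "r * (norm (x + y))\<^sup>2 \<le> r * (2 * (norm x)\<^sup>2 + 2 * (norm y)\<^sup>2)"
      using r by (rule mult_left_mono)
    then show ?thesis
      using 1 by (simp add: algebra_simps)
  qed
  show "norm (X x) \<le> r * norm x"
  proof (cases "X x = 0 \<or> x = 0")
    case False
    define t where "t = norm x / norm (X x)"
    have t: "t > 0" "t * norm (X x) = norm x"
      using False by (simp_all add: t_def)
    have "2 * (t * (norm (X x) * norm (X x))) \<le> 2 * (r * (norm x * norm x))"
      using key[of x "t *\<^sub>R X x"] t by (simp add: power2_norm_eq_inner power2_eq_square norm_eq_square)
        (simp add: dot_square_norm power2_eq_square algebra_simps)
    then have "norm x * norm (X x) \<le> norm x * (r * norm x)"
      using t(2) by (simp add: mult_ac) (metis mult.assoc mult.commute)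
    then show ?thesis
      using False by simp
  qed (use r in \<open>auto simp: blinfun.zero_right\<close>)
qed

text \<open>The square root of \<open>1 - X\<close> is \<open>1 - Y\<close>, where \<open>Y\<close> is the fixed point of
  \<open>Y \<mapsto> (X + Y\<^sup>2) / 2\<close>.\<close>

lemma positive_square_root:
  fixes G :: "'a::chilbert_space \<Rightarrow>\<^sub>L 'a"
  assumes G: "G \<in> bounded_ops" and sym: "\<And>x y. inner (G x) y = inner x (G y)"
    and m: "0 < m" "\<And>x. m * (norm x)\<^sup>2 \<le> inner (G x) x"
    and M: "0 < M" "\<And>x. inner (G x) x \<le> M * (norm x)\<^sup>2"
  shows "\<exists>S\<in>bounded_ops. \<exists>S'\<in>bounded_ops. S o\<^sub>L S = G \<and> S o\<^sub>L S' = id_blinfun \<and> S' o\<^sub>L S = id_blinfun \<and>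
    (\<forall>x y. inner (S x) y = inner x (S y))"
proof -
  define X where "X = id_blinfun - (1 / M) *\<^sub>R G"
  have X: "X x = x - (1 / M) *\<^sub>R G x" for x
    by (simp add: X_def blinfun.diff_left blinfun.scaleR_left)
  have X_bo: "X \<in> bounded_ops"
    unfolding X_def using G by simp
  have X_sym: "inner (X x) y = inner x (X y)" for x y
    by (simp add: X inner_diff_left inner_diff_right sym)
  define r where "r = max 0 (1 - m / M)"
  have r: "0 \<le> r" "r < 1"
    using m M by (auto simp: r_def)
  have inner_X: "inner (X x) x = (norm x)\<^sup>2 - inner (G x) x / M" for x
    by (simp add: X inner_diff_left power2_norm_eq_inner)
  have X_norm: "norm X \<le> r"
  proof (rule norm_positive_le[OF X_sym _ _ r(1)])
    show "0 \<le> inner (X x) x" for x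
      unfolding inner_X using M(1) M(2)[of x] by (simp add: divide_le_eq mult.commute)
    show "inner (X x) x \<le> r * (norm x)\<^sup>2" for x
    proof -
      have "m / M * (norm x)\<^sup>2 \<le> inner (G x) x / M"
        using m(2)[of x] M(1) by (simp add: divide_right_mono)
      then have "inner (X x) x \<le> (1 - m / M) * (norm x)\<^sup>2"
        unfolding inner_X by (simp add: algebra_simps)
      also have "\<dots> \<le> r * (norm x)\<^sup>2"
        by (rule mult_right_mono) (simp_all add: r_def)
      finally show ?thesis .
    qed
  qed
  \<comment> \<open>\<open>f\<close> preserves this ball because r < 1, and contracts it by r. All
    conditions are closed, so the fixed point is symmetric and complex linear.\<close>
  define \<Y> :: "('a \<Rightarrow>\<^sub>L 'a) set" where "\<Y> = {Y \<in> bounded_ops. norm Y \<le> r \<and> (\<forall>x y. inner (blinfun_apply Y x) y = inner x (Y y))}"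
  define f where "f Y = (1 / 2) *\<^sub>R (X + (Y o\<^sub>L Y))" for Y :: "'a \<Rightarrow>\<^sub>L 'a"
  have "\<exists>!Y\<in>\<Y>. f Y = Y"
  proof (rule Banach_fix[where c = r])
    have "\<Y> = bounded_ops \<inter> {Y. norm Y \<le> r} \<inter> (\<Inter>x. \<Inter>y. {Y. inner (blinfun_apply Y x) y = inner x (Y y)})"
      by (auto simp: \<Y>_def)
    also have "closed \<dots>"
      by (intro closed_Int closed_INT ballI closed_bounded_ops closed_Collect_le closed_Collect_eq continuous_intros
          linear_continuous_on[OF blinfun.bounded_linear_left])
    finally show "complete \<Y>"
      by (simp add: complete_eq_closed)
    show "\<Y> \<noteq> {}"
      using r(1) by (auto simp: \<Y>_def intro!: exI[of _ 0])
    show "f ` \<Y> \<subseteq> \<Y>"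
    proof (rule image_subsetI)
      fix Y assume Y: "Y \<in> \<Y>"
      have "norm (f Y) \<le> (1 / 2) * (norm X + norm Y * norm Y)"
        unfolding f_def using norm_triangle_ineq[of X "Y o\<^sub>L Y"] norm_blinfun_compose[of Y Y] by simp
      also have "norm Y * norm Y \<le> r * 1"
        using Y r by (intro mult_mono) (auto simp: \<Y>_def)
      finally have "norm (f Y) \<le> r"
        using X_norm by simp
      moreover have "f Y \<in> bounded_ops"
        using X_bo Y by (simp add: f_def \<Y>_def)
      moreover have "inner (f Y x) y = inner x (f Y y)" for x y
        using Y by (simp add: f_def \<Y>_def X_sym blinfun.bilinear_simps inner_add_left inner_add_right)
      ultimately show "f Y \<in> \<Y>"
        by (simp add: \<Y>_def)
    qed
    show "dist (f Y) (f Z) \<le> r * dist Y Z" if YZ: "Y \<in> \<Y>" "Z \<in> \<Y>" for Y Z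
    proof -
      have "f Y - f Z = (1 / 2) *\<^sub>R ((Y o\<^sub>L (Y - Z)) + ((Y - Z) o\<^sub>L Z))"
        by (rule blinfun_eqI) (simp add: f_def blinfun.bilinear_simps algebra_simps)
      then have "norm (f Y - f Z) \<le> (1 / 2) * (norm Y * norm (Y - Z) + norm (Y - Z) * norm Z)"
        using norm_triangle_ineq[of "Y o\<^sub>L (Y - Z)" "(Y - Z) o\<^sub>L Z"] norm_blinfun_compose[of Y "Y - Z"]
          norm_blinfun_compose[of "Y - Z" Z] by simp
      also have "\<dots> \<le> (1 / 2) * (r * norm (Y - Z) + norm (Y - Z) * r)"
        using YZ by (intro mult_left_mono add_mono mult_right_mono) (auto simp: \<Y>_def)
      finally show "dist (f Y) (f Z) \<le> r * dist Y Z"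
        by (simp add: dist_norm)
    qed
  qed (use r in auto)
  then obtain Y where Y: "Y \<in> bounded_ops" "norm Y \<le> r" "\<And>x y. inner (blinfun_apply Y x) y = inner x (Y y)" "f Y = Y"
    by (auto simp: \<Y>_def)
  obtain Z where Z: "Z \<in> bounded_ops" "(id_blinfun - Y) o\<^sub>L Z = id_blinfun" "Z o\<^sub>L (id_blinfun - Y) = id_blinfun"
    using inverse_one_minus[OF Y(1)] Y(2) r(2) by auto
  \<comment> \<open>Since 1 - X is G / M, the factor sqrt M turns the root of 1 - X into a root of
    \<open>G\<close>.\<close>
  define S where "S = sqrt M *\<^sub>R (id_blinfun - Y)"
  define S' where "S' = (1 / sqrt M) *\<^sub>R Z"
  have S: "S x = sqrt M *\<^sub>R (x - Y x)" and S': "S' x = (1 / sqrt M) *\<^sub>R Z x" for x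
    by (simp_all add: S_def S'_def blinfun.bilinear_simps)
  have sM: "sqrt M > 0" "sqrt M * sqrt M = M"
    using M(1) by simp_all
  have "S (S x) = G x" for x
  proof -
    have "(1 / 2) *\<^sub>R (X x + Y (Y x)) = Y x"
      using arg_cong[OF Y(4), of "\<lambda>T. T x"] by (simp add: f_def blinfun.bilinear_simps)
    then have "X x + Y (Y x) = 2 *\<^sub>R Y x"
      by (metis (no_types, opaque_lifting) divide_self_if scaleR_one scaleR_scaleR times_divide_eq_left mult.commute mult_1 zero_neq_numeral)
    then have "x - Y x - Y (x - Y x) = x - X x"
      by (simp add: blinfun.diff_right scaleR_2 algebra_simps)
    moreover have "S (S x) = (sqrt M * sqrt M) *\<^sub>R (x - Y x - Y (x - Y x))"
      by (simp add: S blinfun.scaleR_right scaleR_diff_right blinfun.diff_right del: real_sqrt_mult_self)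
    ultimately have "S (S x) = (sqrt M * sqrt M) *\<^sub>R (x - X x)"
      by (simp only:)
    then show ?thesis
      unfolding sM(2) using M(1) by (simp add: X)
  qed
  moreover have "S (S' x) = x" "S' (S x) = x" for x
    using arg_cong[OF Z(2), of "\<lambda>T. T x"] arg_cong[OF Z(3), of "\<lambda>T. T x"] sM(1)
    by (simp_all add: S S' blinfun.bilinear_simps flip: scaleR_diff_right)
  moreover have "inner (S x) y = inner x (S y)" for x y
    by (simp add: S inner_diff_left inner_diff_right Y(3))
  moreover have "S \<in> bounded_ops" "S' \<in> bounded_ops"
    using Y(1) Z(1) by (simp_all add: S_def S'_def)
  ultimately show ?thesis
    by (intro bexI[of _ S] bexI[of _ S']) (auto intro!: blinfun_eqI)
qed

lemma is_adjointI:
  assumes "T \<in> bounded_ops" "T' \<in> bounded_ops" "\<And>x y. inner (blinfun_apply T x) y = inner x (blinfun_apply T' y)"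
  shows "is_adjoint T T'"
  unfolding is_adjoint_def
proof (intro allI complex_eqI)
  fix x y
  show "Re (cinner (T x) y) = Re (cinner x (T' y))"
    by (simp add: Re_cinner assms(3))
  show "Im (cinner (T x) y) = Im (cinner x (T' y))"
    by (simp add: Im_cinner assms(3) bounded_opsD[OF assms(2)])
qed

lemma scaleC_conv_ii: "c *\<^sub>C x = Re c *\<^sub>R x + Im c *\<^sub>R (\<i> *\<^sub>C (x :: 'a::complex_vector))"
proof -
  have "c *\<^sub>C x = (complex_of_real (Re c) + complex_of_real (Im c) * \<i>) *\<^sub>C x"
    by (simp add: complex_eq_iff)
  then show ?thesis
    by (simp add: scaleC_add_left scaleR_scaleC scaleC_scaleC)
qed

lemma bounded_opsI_ii:
  assumes "\<And>x. blinfun_apply T (\<i> *\<^sub>C x) = \<i> *\<^sub>C T x"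
  shows "T \<in> bounded_ops"
  by (rule bounded_opsI) (subst (1 2) scaleC_conv_ii, simp add: blinfun.add_right blinfun.scaleR_right assms)

context reductive
begin

text \<open>The maps \<open>\<phi>\<^sub>i\<close> identify \<open>V\<^sup>n\<close> with \<open>N\<close>, hence \<open>A\<close> acts on \<open>N\<close> as on \<open>V \<otimes> \<complex>\<^sup>n\<close>. The
  bounds depend on \<open>K\<close> only, which is what allows infinitely many \<open>N\<close> to be treated at once.\<close>

definition isotypic_frame :: "'a set \<Rightarrow> 'a set \<Rightarrow> 'a \<Rightarrow> nat \<Rightarrow> (nat \<Rightarrow> 'a \<Rightarrow>\<^sub>L 'a) \<Rightarrow> bool"
  where "isotypic_frame N V u n \<phi> \<longleftrightarrow>
    minimal_invariant A V \<and> V \<subseteq> N \<and> u \<in> V \<and> u \<noteq> 0 \<and> 0 < n \<and> (\<forall>i<n. \<phi> i \<in> B) \<and>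
    (\<forall>v. (\<forall>i<n. v i \<in> V) \<longrightarrow>
      (\<Sum>i<n. (norm (v i))\<^sup>2) \<le> (4 * K\<^sup>2)\<^sup>2 * (norm (\<Sum>i<n. \<phi> i (v i)))\<^sup>2 \<and>
      (norm (\<Sum>i<n. \<phi> i (v i)))\<^sup>2 \<le> (4 * K\<^sup>2)\<^sup>2 * (\<Sum>i<n. (norm (v i))\<^sup>2)) \<and>
    N = {\<Sum>i<n. \<phi> i (v i) | v. \<forall>i<n. v i \<in> V} \<and>
    (\<forall>b\<in>B. \<exists>\<beta>. \<forall>v\<in>V. b v = (\<Sum>i<n. \<beta> i *\<^sub>C \<phi> i v))"

section \<open>The minimal fully invariant subspaces\<close>

definition atoms :: "'a set set"
  where "atoms = {N. minimal_invariant (A \<union> B) N}"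

lemma ex_isotypic_frames:
  "\<exists>V u n \<phi>. \<forall>N\<in>atoms. isotypic_frame N (V N) (u N) (n N) (\<phi> N)"
proof -
  have "\<forall>N\<in>atoms. \<exists>V u n \<phi>. isotypic_frame N V u n \<phi>"
    unfolding atoms_def isotypic_frame_def using isotypic_component by simp
  then show ?thesis
    by metis
qed

lemma atoms_family: "independent_family atoms"
  unfolding independent_family_def
proof (intro conjI ballI impI)
  fix N assume "N \<in> atoms"
  then show "fully_invariant N"
    by (simp add: atoms_def minimal_invariantD)
next
  fix N M assume NM: "N \<in> atoms" "M \<in> atoms" "N \<noteq> M"
  then have N: "minimal_invariant (A \<union> B) N" and M: "minimal_invariant (A \<union> B) M"
    by (auto simp: atoms_def)
  have "fully_invariant (N \<inter> M)"
    using minimal_invariantD(1)[OF N] minimal_invariantD(1)[OF M] by (rule invariant_subspace_Int)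
  then have "N \<inter> M = {0} \<or> N \<inter> M = N" "N \<inter> M = {0} \<or> N \<inter> M = M"
    using minimal_invariantD(3)[OF N, of "N \<inter> M"] minimal_invariantD(3)[OF M, of "N \<inter> M"] by auto
  then show "N \<inter> M = {0}"
    using NM(3) by metis
qed

text \<open>A nonzero complement of the closed sum would contain a further minimal fully invariant
  subspace. Being an atom, it lies in the sum as well, so it would be 0.\<close>

lemma atoms_dense: "closure (algebraic_sum atoms) = UNIV"
proof (rule ccontr)
  let ?X = "closure (algebraic_sum atoms)"
  assume "?X \<noteq> UNIV"
  then obtain y where y: "y \<notin> ?X"
    by blast
  have X: "fully_invariant ?X"
    by (rule algebraic_sum[OF atoms_family])
  define W where "W = {w \<in> UNIV. cproj ?X w = 0}"
  have W: "fully_invariant W"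
    unfolding W_def
    by (rule projection_onto_vanishing[OF invariant_subspace_UNIV cproj(2)[OF X]])
      (auto simp: cproj(4)[OF X] cproj_apply(3)[OF X])
  have "y - cproj ?X y \<in> W"
    using cproj_apply(1,2)[OF X] by (simp add: W_def blinfun.diff_right)
  moreover have "y - cproj ?X y \<noteq> 0"
    using y cproj_apply(1)[OF X, of y] by auto
  ultimately have "W \<noteq> {0}"
    by blast
  then obtain N where N: "N \<subseteq> W" "minimal_invariant (A \<union> B) N"
    using ex_minimal_fully_invariant[OF W] by blast
  obtain x where x: "x \<in> N" "x \<noteq> 0"
    using csubspace_nonzero[OF invariant_subspaceD(1)[OF minimal_invariantD(1)[OF N(2)]] minimal_invariantD(2)[OF N(2)]]
    by blast
  have "x \<in> ?X"
    using algebraic_sum(2)[OF atoms_family, of N] N(2) x(1) closure_subset by (auto simp: atoms_def)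
  then have "cproj ?X x = x"
    by (rule cproj_apply(2)[OF X])
  then show False
    using x N(1) by (auto simp: W_def)
qed

end

section \<open>The equivalent inner product\<close>

text \<open>A simultaneous choice of frames for all atoms, with arbitrary values elsewhere.\<close>

locale reductive_frames = reductive +
  fixes V u n \<phi>
  assumes frames: "\<And>N. N \<in> atoms \<Longrightarrow> isotypic_frame N (V N) (u N) (n N) (\<phi> N)"
begin

lemma frameD:
  assumes "N \<in> atoms"
  shows "minimal_invariant A (V N)" "V N \<subseteq> N" "u N \<in> V N" "u N \<noteq> 0" "0 < n N" "i < n N \<Longrightarrow> \<phi> N i \<in> B"
    "N = {\<Sum>i<n N. \<phi> N i (v i) | v. \<forall>i<n N. v i \<in> V N}"
    "b \<in> B \<Longrightarrow> \<exists>\<beta>. \<forall>v\<in>V N. b v = (\<Sum>i<n N. \<beta> i *\<^sub>C \<phi> N i v)"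
  using frames[OF assms] unfolding isotypic_frame_def by blast+

definition L :: real
  where "L = (4 * K\<^sup>2)\<^sup>2"

lemma frame_norms:
  assumes "N \<in> atoms" "\<forall>i<n N. v i \<in> V N"
  shows "(\<Sum>i<n N. (norm (v i))\<^sup>2) \<le> L * (norm (\<Sum>i<n N. \<phi> N i (v i)))\<^sup>2"
    "(norm (\<Sum>i<n N. \<phi> N i (v i)))\<^sup>2 \<le> L * (\<Sum>i<n N. (norm (v i))\<^sup>2)"
  using frames[OF assms(1)] assms(2) unfolding isotypic_frame_def L_def by blast+

lemma L_pos: "0 < L"
  using K by (simp add: L_def)

lemma atom_fully_invariant: "N \<in> atoms \<Longrightarrow> fully_invariant N"
  using independent_familyD(1)[OF atoms_family] .

lemma V_subspace:
  assumes "N \<in> atoms"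
  shows "csubspace (V N)" "closed (V N)" "a \<in> A \<Longrightarrow> v \<in> V N \<Longrightarrow> a v \<in> V N"
  using invariant_subspaceD[OF minimal_invariantD(1)[OF frameD(1)[OF assms]]] by auto

text \<open>\<open>T (N, i) x\<close> is the \<open>i\<close>-th coordinate in \<open>V N\<close> of the component of \<open>x\<close> in \<open>N\<close>.\<close>

definition T :: "'a set \<times> nat \<Rightarrow> 'a \<Rightarrow> 'a"
  where "T p x = (SOME v. (\<forall>i<n (fst p). v i \<in> V (fst p)) \<and>
    cproj (fst p) x = (\<Sum>i<n (fst p). \<phi> (fst p) i (v i))) (snd p)"

lemma T:
  assumes N: "N \<in> atoms"
  shows "i < n N \<Longrightarrow> T (N, i) x \<in> V N" "cproj N x = (\<Sum>i<n N. \<phi> N i (T (N, i) x))"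
proof -
  have "\<exists>v. (\<forall>i<n N. v i \<in> V N) \<and> cproj N x = (\<Sum>i<n N. \<phi> N i (v i))"
    using cproj_apply(1)[OF atom_fully_invariant[OF N], of x] frameD(7)[OF N] by auto
  from someI_ex[OF this]
  show "i < n N \<Longrightarrow> T (N, i) x \<in> V N" "cproj N x = (\<Sum>i<n N. \<phi> N i (T (N, i) x))"
    by (auto simp: T_def)
qed

text \<open>The lower frame bound makes coordinates unique; linearity of \<open>T\<close> and its
  commutation with \<open>A\<close> follow from this.\<close>

lemma T_unique:
  assumes N: "N \<in> atoms" and v: "\<And>i. i < n N \<Longrightarrow> v i \<in> V N" and eq: "cproj N x = (\<Sum>i<n N. \<phi> N i (v i))"
    and i: "i < n N"
  shows "T (N, i) x = v i"
proof -
  have "\<forall>i<n N. T (N, i) x - v i \<in> V N"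
    using T(1)[OF N] v by (auto intro: csubspace_diff[OF V_subspace(1)[OF N]])
  from frame_norms(1)[OF N this]
  have "(\<Sum>i<n N. (norm (T (N, i) x - v i))\<^sup>2) \<le> 0"
    using T(2)[OF N, of x] eq by (simp add: blinfun.diff_right sum_subtractf)
  then have "(\<Sum>i<n N. (norm (T (N, i) x - v i))\<^sup>2) = 0"
    by (intro order_antisym sum_nonneg) auto
  then have "(norm (T (N, i) x - v i))\<^sup>2 = 0"
    using i by (subst (asm) sum_nonneg_eq_0_iff) auto
  then show ?thesis
    by simp
qed

definition I :: "('a set \<times> nat) set"
  where "I = (SIGMA N:atoms. {..<n N})"

lemma T_add: "p \<in> I \<Longrightarrow> T p (x + y) = T p x + T p y"
  and T_scaleC: "p \<in> I \<Longrightarrow> T p (c *\<^sub>C x) = c *\<^sub>C T p x"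
  and T_A: "p \<in> I \<Longrightarrow> a \<in> A \<Longrightarrow> T p (a x) = a (T p x)"
proof -
  have *: "T (N, i) (x + y) = T (N, i) x + T (N, i) y \<and> T (N, i) (c *\<^sub>C x) = c *\<^sub>C T (N, i) x \<and>
      (a \<in> A \<longrightarrow> T (N, i) (a x) = a (T (N, i) x))" if N: "N \<in> atoms" and i: "i < n N" for N i
  proof (intro conjI impI)
    note Vs = V_subspace[OF N] and fi = atom_fully_invariant[OF N]
    show "T (N, i) (x + y) = T (N, i) x + T (N, i) y"
      using T(2)[OF N, of x] T(2)[OF N, of y]
      by (intro T_unique[OF N _ _ i]) (auto simp: blinfun.add_right sum.distrib intro: csubspace_add Vs T(1)[OF N])
    show "T (N, i) (c *\<^sub>C x) = c *\<^sub>C T (N, i) x"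
    proof (rule T_unique[OF N _ _ i])
      have "cproj N (c *\<^sub>C x) = c *\<^sub>C (\<Sum>i<n N. \<phi> N i (T (N, i) x))"
        using T(2)[OF N, of x] by (simp add: commutant_scaleC_apply[OF cproj(1)[OF fi]])
      also have "\<dots> = (\<Sum>i<n N. \<phi> N i (c *\<^sub>C T (N, i) x))"
        unfolding complex_vector.scale_sum_right
        by (intro sum.cong refl) (simp add: commutant_scaleC_apply[OF frameD(6)[OF N]])
      finally show "cproj N (c *\<^sub>C x) = (\<Sum>i<n N. \<phi> N i (c *\<^sub>C T (N, i) x))" .
    qed (auto intro: csubspace_scale Vs T(1)[OF N])
    show "T (N, i) (a x) = a (T (N, i) x)" if a: "a \<in> A"
    proof (rule T_unique[OF N _ _ i])
      have "cproj N (a x) = a (\<Sum>i<n N. \<phi> N i (T (N, i) x))"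
        using T(2)[OF N, of x] by (simp add: cproj_apply(3)[OF fi a])
      also have "\<dots> = (\<Sum>i<n N. \<phi> N i (a (T (N, i) x)))"
        unfolding blinfun.sum_right by (intro sum.cong refl) (simp add: commutantD[OF frameD(6)[OF N] a])
      finally show "cproj N (a x) = (\<Sum>i<n N. \<phi> N i (a (T (N, i) x)))" .
    qed (auto intro: Vs a T(1)[OF N])
  qed
  show "p \<in> I \<Longrightarrow> T p (x + y) = T p x + T p y" "p \<in> I \<Longrightarrow> T p (c *\<^sub>C x) = c *\<^sub>C T p x"
    "p \<in> I \<Longrightarrow> a \<in> A \<Longrightarrow> T p (a x) = a (T p x)"
    using * by (auto simp: I_def)
qed

lemma T_scaleR: "p \<in> I \<Longrightarrow> T p (r *\<^sub>R x) = r *\<^sub>R T p x"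
  by (simp add: scaleR_scaleC T_scaleC)

lemma T_frame:
  assumes N: "N \<in> atoms" and j: "j < n N" and v: "v \<in> V N" and p: "p \<in> I"
  shows "T p (\<phi> N j v) = (if p = (N, j) then v else 0)"
proof -
  obtain M i where M: "p = (M, i)" "M \<in> atoms" "i < n M"
    using p by (auto simp: I_def)
  have "\<phi> N j v \<in> N"
    using v fully_invariantD(2)[OF atom_fully_invariant[OF N] _ frameD(6)[OF N j]] frameD(2)[OF N] by blast
  then have cp: "cproj M (\<phi> N j v) = (if M = N then \<phi> N j v else 0)"
    using cproj_family(2)[OF atoms_family M(2) N] by simp
  show ?thesis
    unfolding M(1)
  proof (rule T_unique[OF M(2) _ _ M(3), where v = "\<lambda>i. if (M, i) = (N, j) then v else 0"])
    show "(if (M, i) = (N, j) then v else 0) \<in> V M" if "i < n M" for i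
      using v csubspace_0[OF V_subspace(1)[OF M(2)]] by auto
    have "(\<Sum>i<n N. \<phi> N i (if i = j then v else 0)) = (\<Sum>i<n N. if i = j then \<phi> N i v else 0)"
      by (intro sum.cong refl) (simp add: blinfun.zero_right)
    then show "cproj M (\<phi> N j v) = (\<Sum>i<n M. \<phi> M i (if (M, i) = (N, j) then v else 0))"
      using j by (simp add: cp blinfun.zero_right)
  qed
qed

text \<open>In coordinates \<open>B\<close> acts by scalar matrices, because b composed with \<phi>
  j is a combination of the \<phi> i on \<open>V N\<close>.\<close>

lemma T_commutant:
  assumes N: "N \<in> atoms" and i: "i < n N" and b: "b \<in> B"
  shows "\<exists>\<beta>. \<forall>x. T (N, i) (b x) = (\<Sum>j<n N. \<beta> j *\<^sub>C T (N, j) x)"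
proof -
  have "\<exists>\<beta>. \<forall>v\<in>V N. b (\<phi> N j v) = (\<Sum>i<n N. \<beta> i *\<^sub>C \<phi> N i v)" if "j < n N" for j
    using frameD(8)[OF N, of "b o\<^sub>L \<phi> N j"] frameD(6)[OF N that] b by simp
  then obtain \<beta> where \<beta>: "\<And>j v. j < n N \<Longrightarrow> v \<in> V N \<Longrightarrow> b (\<phi> N j v) = (\<Sum>i<n N. \<beta> j i *\<^sub>C \<phi> N i v)"
    by metis
  have "T (N, i) (b x) = (\<Sum>j<n N. \<beta> j i *\<^sub>C T (N, j) x)" for x
  proof (rule T_unique[OF N _ _ i, where v = "\<lambda>i. \<Sum>j<n N. \<beta> j i *\<^sub>C T (N, j) x"])
    show "(\<Sum>j<n N. \<beta> j i *\<^sub>C T (N, j) x) \<in> V N" for i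
      by (rule csubspace_sum[OF V_subspace(1)[OF N]])
        (auto intro: csubspace_scale[OF V_subspace(1)[OF N]] T(1)[OF N])
    have "cproj N (b x) = b (\<Sum>j<n N. \<phi> N j (T (N, j) x))"
      using T(2)[OF N, of x] by (simp add: cproj(4)[OF atom_fully_invariant[OF N] b])
    also have "\<dots> = (\<Sum>j<n N. \<Sum>i<n N. \<beta> j i *\<^sub>C \<phi> N i (T (N, j) x))"
      unfolding blinfun.sum_right by (intro sum.cong refl) (simp add: \<beta> T(1)[OF N])
    also have "\<dots> = (\<Sum>i<n N. \<Sum>j<n N. \<beta> j i *\<^sub>C \<phi> N i (T (N, j) x))"
      by (rule sum.swap)
    also have "\<dots> = (\<Sum>i<n N. \<phi> N i (\<Sum>j<n N. \<beta> j i *\<^sub>C T (N, j) x))"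
      unfolding blinfun.sum_right by (intro sum.cong refl) (simp add: commutant_scaleC_apply[OF frameD(6)[OF N]])
    finally show "cproj N (b x) = (\<Sum>i<n N. \<phi> N i (\<Sum>j<n N. \<beta> j i *\<^sub>C T (N, j) x))" .
  qed
  then show ?thesis
    by (intro exI[of _ "\<lambda>j. \<beta> j i"]) blast
qed

text \<open>\<open>L\<close> compares a component with its coordinates, and the square of 2 K
  compares a vector with its components.\<close>

definition C :: real
  where "C = L * (2 * K)\<^sup>2"

lemma C_pos: "0 < C"
  using K L_pos by (simp add: C_def)

lemma sum_T_le:
  assumes "finite F" "F \<subseteq> I"
  shows "(\<Sum>p\<in>F. (norm (T p x))\<^sup>2) \<le> C * (norm x)\<^sup>2"
proof -
  let ?F = "fst ` F"
  have F: "finite ?F" "?F \<subseteq> atoms"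
    using assms by (auto simp: I_def)
  have fam: "independent_family ?F"
    by (rule independent_familyD(3)[OF atoms_family F(2)])
  have "(\<Sum>p\<in>F. (norm (T p x))\<^sup>2) \<le> (\<Sum>p\<in>(SIGMA N:?F. {..<n N}). (norm (T p x))\<^sup>2)"
    using assms F(1) by (intro sum_mono2) (auto simp: I_def, force)
  also have "\<dots> = (\<Sum>N\<in>?F. \<Sum>i<n N. (norm (T (N, i) x))\<^sup>2)"
    using F(1) by (subst sum.Sigma) (auto intro!: sum.cong)
  also have "\<dots> \<le> (\<Sum>N\<in>?F. L * (norm (cproj N x))\<^sup>2)"
  proof (rule sum_mono)
    fix N assume "N \<in> ?F"
    then have N: "N \<in> atoms"
      using F(2) by blast
    show "(\<Sum>i<n N. (norm (T (N, i) x))\<^sup>2) \<le> L * (norm (cproj N x))\<^sup>2"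
      using frame_norms(1)[OF N, of "\<lambda>i. T (N, i) x"] T(1)[OF N] T(2)[OF N, of x] by simp
  qed
  also have "\<dots> = L * (\<Sum>N\<in>?F. (norm (cproj N x))\<^sup>2)"
    by (simp add: sum_distrib_left)
  also have "\<dots> \<le> L * (2 * K * norm x)\<^sup>2"
    using L_pos sum_norm_cproj_le[OF fam F(1), of x] by (intro mult_left_mono) auto
  finally show ?thesis
    by (simp add: C_def power_mult_distrib mult.assoc)
qed

lemma T_summable: "(\<lambda>p. (norm (T p x))\<^sup>2) summable_on I"
  by (rule nonneg_bdd_above_summable_on) (auto intro!: bdd_aboveI[of _ "C * (norm x)\<^sup>2"] sum_T_le)

lemma infsum_T_le: "(\<Sum>\<^sub>\<infinity>p\<in>I. (norm (T p x))\<^sup>2) \<le> C * (norm x)\<^sup>2"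
  by (rule infsum_le_finite_sums[OF T_summable sum_T_le])

text \<open>These families represent the elements of the l-infinity sum, with m as the uniform
  bound; values off \<open>V N\<close> are unconstrained.\<close>

definition admissible :: "real \<Rightarrow> ('a set \<Rightarrow> 'a \<Rightarrow> 'a) \<Rightarrow> bool"
  where "admissible m \<tau> \<longleftrightarrow> 0 \<le> m \<and> (\<forall>N\<in>atoms. (\<forall>v\<in>V N. \<tau> N v \<in> V N \<and> norm (\<tau> N v) \<le> m * norm v \<and>
    (\<forall>w\<in>V N. \<tau> N (v + w) = \<tau> N v + \<tau> N w) \<and> (\<forall>c. \<tau> N (c *\<^sub>C v) = c *\<^sub>C \<tau> N v)))"

lemma admissibleD:
  assumes "admissible m \<tau>"
  shows "0 \<le> m" "N \<in> atoms \<Longrightarrow> v \<in> V N \<Longrightarrow> \<tau> N v \<in> V N" "N \<in> atoms \<Longrightarrow> v \<in> V N \<Longrightarrow> norm (\<tau> N v) \<le> m * norm v"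
    "N \<in> atoms \<Longrightarrow> v \<in> V N \<Longrightarrow> w \<in> V N \<Longrightarrow> \<tau> N (v + w) = \<tau> N v + \<tau> N w"
    "N \<in> atoms \<Longrightarrow> v \<in> V N \<Longrightarrow> \<tau> N (c *\<^sub>C v) = c *\<^sub>C \<tau> N v"
  using assms unfolding admissible_def by blast+

lemma admissible_id: "admissible 1 (\<lambda>_ v. v)"
  by (simp add: admissible_def)

lemma T_in: "p \<in> I \<Longrightarrow> T p x \<in> V (fst p)" "p \<in> I \<Longrightarrow> fst p \<in> atoms"
  using T(1) by (auto simp: I_def)

text \<open>For \<open>\<tau> N v = v\<close> this is the equivalent inner product; for general \<open>\<tau>\<close> it is the form
  \<open>[a x, y]\<close> of the operator \<open>a\<close> that acts on \<open>N\<close> as \<open>\<tau> N \<otimes> 1\<close>.\<close>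

definition form :: "('a set \<Rightarrow> 'a \<Rightarrow> 'a) \<Rightarrow> 'a \<Rightarrow> 'a \<Rightarrow> real"
  where "form \<tau> x y = (\<Sum>\<^sub>\<infinity>p\<in>I. inner (\<tau> (fst p) (T p x)) (T p y))"

text \<open>The inequality 2 s t \<le> s^2 + t^2 is applied termwise, which gives a bound by a sum
  of squares. \<open>form_represented\<close> recovers the product of norms by normalising x and
  y.\<close>

lemma form_summable:
  assumes "admissible m \<tau>"
  shows "(\<lambda>p. inner (\<tau> (fst p) (T p x)) (T p y)) summable_on I"
    and "\<bar>form \<tau> x y\<bar> \<le> m * C * ((norm x)\<^sup>2 + (norm y)\<^sup>2) / 2"
proof -
  let ?f = "\<lambda>p. inner (\<tau> (fst p) (T p x)) (T p y)"
  let ?g = "\<lambda>p. m / 2 * ((norm (T p x))\<^sup>2 + (norm (T p y))\<^sup>2)"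
  note m = admissibleD(1)[OF assms]
  have le: "norm (?f p) \<le> ?g p" if p: "p \<in> I" for p
  proof -
    have "norm (?f p) \<le> norm (\<tau> (fst p) (T p x)) * norm (T p y)"
      by (simp add: Cauchy_Schwarz_ineq2)
    also have "\<dots> \<le> (m * norm (T p x)) * norm (T p y)"
      by (intro mult_right_mono admissibleD(3)[OF assms] T_in p) simp
    also have "\<dots> \<le> ?g p"
      using mult_left_mono[OF sum_squares_bound[of "norm (T p x)" "norm (T p y)"] m] by (simp add: algebra_simps)
    finally show ?thesis .
  qed
  have g: "?g summable_on I"
    by (intro summable_on_cmult_right summable_on_add T_summable)
  have g0: "0 \<le> ?g p" for p
    using m by simp
  have abs: "(\<lambda>p. norm (?f p)) summable_on I"
    by (rule nonneg_bdd_above_summable_on)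
      (use g le g0 in \<open>auto intro!: bdd_aboveI[of _ "infsum ?g I"] order_trans[OF sum_mono finite_sum_le_infsum[OF g]]\<close>)
  then show "?f summable_on I"
    by (rule abs_summable_summable)
  have "\<bar>form \<tau> x y\<bar> \<le> (\<Sum>\<^sub>\<infinity>p\<in>I. norm (?f p))"
    unfolding form_def using norm_infsum_bound[OF abs] by simp
  also have "\<dots> \<le> infsum ?g I"
    by (intro infsum_mono abs g le)
  also have "\<dots> = m / 2 * ((\<Sum>\<^sub>\<infinity>p\<in>I. (norm (T p x))\<^sup>2) + (\<Sum>\<^sub>\<infinity>p\<in>I. (norm (T p y))\<^sup>2))"
    unfolding infsum_cmult_right' by (simp add: infsum_add T_summable)
  also have "\<dots> \<le> m / 2 * (C * (norm x)\<^sup>2 + C * (norm y)\<^sup>2)"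
    using m by (intro mult_left_mono add_mono infsum_T_le) auto
  finally show "\<bar>form \<tau> x y\<bar> \<le> m * C * ((norm x)\<^sup>2 + (norm y)\<^sup>2) / 2"
    by (simp add: algebra_simps)
qed

lemma form_represented:
  assumes adm: "admissible m \<tau>"
  shows "\<exists>Q :: 'a \<Rightarrow>\<^sub>L 'a. \<forall>x y. inner (Q x) y = form \<tau> x y"
proof -
  note sm = form_summable(1)[OF adm]
  have add_left: "form \<tau> (x + x') y = form \<tau> x y + form \<tau> x' y" for x x' y
  proof -
    have "form \<tau> (x + x') y = (\<Sum>\<^sub>\<infinity>p\<in>I. inner (\<tau> (fst p) (T p x)) (T p y) + inner (\<tau> (fst p) (T p x')) (T p y))"
      unfolding form_def
      by (intro infsum_cong) (simp add: T_add admissibleD(4)[OF adm] T_in inner_add_left)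
    then show ?thesis
      by (simp add: form_def infsum_add sm)
  qed
  have add_right: "form \<tau> x (y + y') = form \<tau> x y + form \<tau> x y'" for x y y'
  proof -
    have "form \<tau> x (y + y') = (\<Sum>\<^sub>\<infinity>p\<in>I. inner (\<tau> (fst p) (T p x)) (T p y) + inner (\<tau> (fst p) (T p x)) (T p y'))"
      unfolding form_def by (intro infsum_cong) (simp add: T_add inner_add_right)
    then show ?thesis
      by (simp add: form_def infsum_add sm)
  qed
  have \<tau>_scaleR: "\<tau> N (r *\<^sub>R v) = r *\<^sub>R \<tau> N v" if "N \<in> atoms" "v \<in> V N" for N r v
    unfolding scaleR_scaleC using that by (rule admissibleD(5)[OF adm])
  have scale_left: "form \<tau> (r *\<^sub>R x) y = r * form \<tau> x y" for r x y
  proof -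
    have "form \<tau> (r *\<^sub>R x) y = (\<Sum>\<^sub>\<infinity>p\<in>I. r * inner (\<tau> (fst p) (T p x)) (T p y))"
      unfolding form_def by (intro infsum_cong) (simp add: T_scaleR \<tau>_scaleR T_in)
    then show ?thesis
      by (simp add: form_def infsum_cmult_right')
  qed
  have scale_right: "form \<tau> x (r *\<^sub>R y) = r * form \<tau> x y" for r x y
  proof -
    have "form \<tau> x (r *\<^sub>R y) = (\<Sum>\<^sub>\<infinity>p\<in>I. r * inner (\<tau> (fst p) (T p x)) (T p y))"
      unfolding form_def by (intro infsum_cong) (simp add: T_scaleR)
    then show ?thesis
      by (simp add: form_def infsum_cmult_right')
  qed
  have "\<bar>form \<tau> x y\<bar> \<le> m * C * norm x * norm y" for x y
  proof (cases "x = 0 \<or> y = 0")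
    case True
    then have "form \<tau> x y = 0"
      using scale_left[of 0 x y] scale_right[of x 0 y] by auto
    then show ?thesis
      using admissibleD(1)[OF adm] C_pos by simp
  next
    case False
    define x' y' where "x' = (1 / norm x) *\<^sub>R x" and "y' = (1 / norm y) *\<^sub>R y"
    have xy: "norm x' = 1" "norm y' = 1" "x = norm x *\<^sub>R x'" "y = norm y *\<^sub>R y'"
      using False by (simp_all add: x'_def y'_def)
    have "form \<tau> x y = norm x * (norm y * form \<tau> x' y')"
      by (subst xy(3), subst xy(4)) (simp only: scale_left scale_right mult.left_commute)
    moreover have "\<bar>form \<tau> x' y'\<bar> \<le> m * C"
      using form_summable(2)[OF adm, of x' y'] xy(1,2) by simp
    then have "norm x * (norm y * \<bar>form \<tau> x' y'\<bar>) \<le> norm x * (norm y * (m * C))"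
      by (intro mult_left_mono) auto
    ultimately show ?thesis
      by (simp add: abs_mult mult_ac)
  qed
  then show ?thesis
    by (intro bilinear_form_represented[of "form \<tau>" "m * C"] add_left add_right scale_left scale_right)
qed

definition G :: "'a \<Rightarrow>\<^sub>L 'a"
  where "G = (SOME G. \<forall>x y. inner (blinfun_apply G x) y = form (\<lambda>_ v. v) x y)"

lemma inner_G: "inner (G x) y = form (\<lambda>_ v. v) x y"
  using someI_ex[OF form_represented[OF admissible_id], folded G_def] by simp

lemma G_symmetric: "inner (G x) y = inner x (G y)"
  unfolding inner_commute[of x] inner_G form_def by (simp add: inner_commute)

lemma inner_G_same: "inner (G x) x = (\<Sum>\<^sub>\<infinity>p\<in>I. (norm (T p x))\<^sup>2)"
  unfolding inner_G form_def by (simp add: power2_norm_eq_inner)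

lemma G_bounded_ops: "G \<in> bounded_ops"
proof (rule bounded_opsI_ii)
  fix x
  have "inner (G (\<i> *\<^sub>C x)) y = inner (\<i> *\<^sub>C G x) y" for y
  proof -
    have "inner (G (\<i> *\<^sub>C x)) y = (\<Sum>\<^sub>\<infinity>p\<in>I. - inner (T p x) (T p (\<i> *\<^sub>C y)))"
      unfolding inner_G form_def by (intro infsum_cong) (simp add: T_scaleC inner_i_left)
    also have "\<dots> = - inner (G x) (\<i> *\<^sub>C y)"
      unfolding inner_G form_def by (rule infsum_uminus)
    finally show ?thesis
      by (simp add: inner_i_left)
  qed
  then show "G (\<i> *\<^sub>C x) = \<i> *\<^sub>C G x"
    by (meson vector_eq_rdot)
qed

lemma G_upper: "inner (G x) x \<le> C * (norm x)\<^sup>2"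
  unfolding inner_G_same by (rule infsum_T_le)

text \<open>On the algebraic sum only finitely many components matter, and frame bounds and sign
  estimates apply. The inequality is closed and the algebraic sum is dense.\<close>

lemma G_lower: "(norm x)\<^sup>2 \<le> C * inner (G x) x"
proof -
  let ?S = "{x. (norm x)\<^sup>2 \<le> C * inner (G x) x}"
  have "algebraic_sum atoms \<subseteq> ?S"
  proof
    fix x assume "x \<in> algebraic_sum atoms"
    then obtain \<F> where F: "finite \<F>" "\<F> \<subseteq> atoms" "x = (\<Sum>N\<in>\<F>. cproj N x)"
      by (auto simp: algebraic_sum_def)
    have "(norm x)\<^sup>2 = (norm (\<Sum>N\<in>\<F>. cproj N x))\<^sup>2"
      using F(3) by simp
    also have "\<dots> \<le> (2 * K)\<^sup>2 * (\<Sum>N\<in>\<F>. (norm (cproj N x))\<^sup>2)"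
      using F(2) cproj_apply(1)[OF atom_fully_invariant]
      by (intro norm_sum_le_family independent_familyD(3)[OF atoms_family F(2)] F(1)) auto
    also have "\<dots> \<le> (2 * K)\<^sup>2 * (\<Sum>N\<in>\<F>. L * (\<Sum>i<n N. (norm (T (N, i) x))\<^sup>2))"
    proof (intro mult_left_mono sum_mono)
      fix N assume "N \<in> \<F>"
      then have N: "N \<in> atoms"
        using F(2) by blast
      show "(norm (cproj N x))\<^sup>2 \<le> L * (\<Sum>i<n N. (norm (T (N, i) x))\<^sup>2)"
        using frame_norms(2)[OF N, of "\<lambda>i. T (N, i) x"] T(1)[OF N] T(2)[OF N, of x] by simp
    qed simp
    also have "\<dots> = C * (\<Sum>N\<in>\<F>. \<Sum>i<n N. (norm (T (N, i) x))\<^sup>2)"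
      by (simp add: C_def mult_ac flip: sum_distrib_left)
    also have "(\<Sum>N\<in>\<F>. \<Sum>i<n N. (norm (T (N, i) x))\<^sup>2) = (\<Sum>p\<in>(SIGMA N:\<F>. {..<n N}). (norm (T p x))\<^sup>2)"
      using F(1) by (subst sum.Sigma) (auto intro!: sum.cong)
    also have "C * \<dots> \<le> C * inner (G x) x"
      unfolding inner_G_same using F(1,2) C_pos
      by (intro mult_left_mono finite_sum_le_infsum T_summable) (auto simp: I_def)
    finally show "x \<in> ?S"
      by simp
  qed
  moreover have "closed ?S"
    by (intro closed_Collect_le continuous_intros)
  ultimately have "closure (algebraic_sum atoms) \<subseteq> ?S"
    by (rule closure_minimal)
  then show ?thesis
    using atoms_dense by auto
qed

lemma T_separating:
  assumes "\<And>p. p \<in> I \<Longrightarrow> T p x = T p y"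
  shows "x = y"
proof -
  have "T p (x - y) = 0" if "p \<in> I" for p
    using T_add[OF that, of "x - y" y] assms[OF that] by simp
  then have "inner (G (x - y)) (x - y) = 0"
    unfolding inner_G_same by (simp add: infsum_0)
  then show ?thesis
    using G_lower[of "x - y"] by simp
qed

section \<open>Realising bounded families of operators in \<open>A\<close>\<close>

lemma G_square_root:
  "\<exists>S\<in>bounded_ops. \<exists>S'\<in>bounded_ops. S o\<^sub>L S = G \<and> S o\<^sub>L S' = id_blinfun \<and> S' o\<^sub>L S = id_blinfun \<and>
    (\<forall>x y. inner (S x) y = inner x (S y))"
proof (rule positive_square_root[OF G_bounded_ops G_symmetric, of "1 / C" C])
  show "1 / C * (norm x)\<^sup>2 \<le> inner (G x) x" for x
    using G_lower[of x] C_pos by (simp add: divide_le_eq mult.commute)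
qed (use C_pos G_upper in auto)

text \<open>The test vectors \<phi> N j v have a single nonzero coordinate, so the form determines
  the coordinates of a x. They are transformed by the same \<tau> N for all i, while
  \<open>B\<close> mixes them by scalars; hence a commutes with \<open>B\<close> and lies in
  \<open>A\<close> by \<open>double_commutant\<close>.\<close>

lemma realize:
  assumes closed: "closedin sigma_weak_topology A" and adm: "admissible m \<tau>"
  shows "\<exists>a\<in>A. \<forall>p\<in>I. \<forall>x. T p (a x) = \<tau> (fst p) (T p x)"
proof -
  obtain Q :: "'a \<Rightarrow>\<^sub>L 'a" where Q: "\<And>x y. inner (Q x) y = form \<tau> x y"
    using form_represented[OF adm] by blast
  obtain S S' :: "'a \<Rightarrow>\<^sub>L 'a" where S: "S o\<^sub>L S = G" "S o\<^sub>L S' = id_blinfun"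
    using G_square_root by blast
  \<comment> \<open>\<open>S'\<close> inverts the square root of \<open>G\<close>, so this is the
    inverse of \<open>G\<close> after \<open>Q\<close>: the operator that has the form of \<tau>
    with respect to the new inner product.\<close>
  define a where "a = S' o\<^sub>L S' o\<^sub>L Q"
  have SS': "S (S' x) = x" for x
    using arg_cong[OF S(2), of "\<lambda>T. T x"] by simp
  have "G (a x) = Q x" for x
    by (simp add: a_def SS' flip: S(1))
  then have form: "form (\<lambda>_ v. v) (a x) y = form \<tau> x y" for x y
    by (metis inner_G Q)
  have T_a: "T p (a x) = \<tau> (fst p) (T p x)" if p: "p \<in> I" for p x
  proof -
    obtain N j where N: "p = (N, j)" "N \<in> atoms" "j < n N"
      using p by (auto simp: I_def)
    note fs = T_frame[OF N(2,3)]
    have single: "(\<Sum>\<^sub>\<infinity>q\<in>I. inner (f q) (T q (\<phi> N j v))) = inner (f p) v" if v: "v \<in> V N" for f v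
    proof -
      have "(\<Sum>\<^sub>\<infinity>q\<in>I. inner (f q) (T q (\<phi> N j v))) = (\<Sum>\<^sub>\<infinity>q\<in>{p}. inner (f q) v)"
        using p fs[OF v] N(1) by (intro infsum_cong_neutral) auto
      then show ?thesis
        by simp
    qed
    define d where "d = T p (a x) - \<tau> N (T p x)"
    have dV: "d \<in> V N"
      unfolding d_def using T_in[OF p] N(1) admissibleD(2)[OF adm N(2)] csubspace_diff[OF V_subspace(1)[OF N(2)]] by auto
    have "inner (T p (a x)) d = inner (\<tau> N (T p x)) d"
      using form[of x "\<phi> N j d"] single[OF dV, of "\<lambda>q. T q (a x)"] single[OF dV, of "\<lambda>q. \<tau> (fst q) (T q x)"] N(1)
      by (simp add: form_def)
    then have "inner d d = 0"
      by (simp add: d_def inner_diff_left)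
    then show ?thesis
      using N(1) by (simp add: d_def)
  qed
  have a_bo: "a \<in> bounded_ops"
    by (rule bounded_opsI, rule T_separating)
      (simp add: T_a T_scaleC admissibleD(5)[OF adm T_in(2) T_in(1)])
  have \<tau>_sum: "\<tau> N (\<Sum>j\<in>F. \<beta> j *\<^sub>C w j) = (\<Sum>j\<in>F. \<beta> j *\<^sub>C \<tau> N (w j))"
    if N: "N \<in> atoms" and F: "finite F" "\<And>j. j \<in> F \<Longrightarrow> w j \<in> V N" for N and F :: "nat set" and \<beta> w
    using F
  proof (induction F rule: finite_induct)
    case empty
    show ?case
      using admissibleD(5)[OF adm N, of 0 0] csubspace_0[OF V_subspace(1)[OF N]] by simp
  next
    case (insert j F)
    have "(\<Sum>j\<in>F. \<beta> j *\<^sub>C w j) \<in> V N"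
      by (rule csubspace_sum[OF V_subspace(1)[OF N]]) (use insert in \<open>auto intro: csubspace_scale[OF V_subspace(1)[OF N]]\<close>)
    then show ?case
      using insert admissibleD(4,5)[OF adm N] csubspace_scale[OF V_subspace(1)[OF N]] by simp
  qed
  have "a (b x) = b (a x)" if b: "b \<in> B" for b x
  proof (rule T_separating)
    fix p assume p: "p \<in> I"
    then obtain N i where N: "p = (N, i)" "N \<in> atoms" "i < n N"
      by (auto simp: I_def)
    obtain \<beta> where \<beta>: "\<And>x. T (N, i) (b x) = (\<Sum>j<n N. \<beta> j *\<^sub>C T (N, j) x)"
      using T_commutant[OF N(2,3) b] by blast
    have mem: "(N, j) \<in> I" if "j < n N" for j
      using that N(2) by (simp add: I_def)
    have "T p (a (b x)) = \<tau> N (\<Sum>j<n N. \<beta> j *\<^sub>C T (N, j) x)"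
      using T_a[OF p] by (simp add: N(1) \<beta>)
    also have "\<dots> = (\<Sum>j<n N. \<beta> j *\<^sub>C \<tau> N (T (N, j) x))"
      by (rule \<tau>_sum[OF N(2)]) (auto intro: T(1)[OF N(2)])
    also have "\<dots> = (\<Sum>j<n N. \<beta> j *\<^sub>C T (N, j) (a x))"
      by (intro sum.cong refl) (simp add: T_a[OF mem])
    finally show "T p (a (b x)) = T p (b (a x))"
      by (simp add: N(1) \<beta>)
  qed
  then have "a \<in> A"
    by (intro double_commutant[OF closed a_bo])
  then show ?thesis
    using T_a by blast
qed

text \<open>\<open>V N\<close> sits in \<open>N\<close> as some irreducible submodule, not
  necessarily as a coordinate copy. Expanding the identity, an element of \<open>B\<close>, in the
  frame shows that v has the coordinates \<beta> i v.\<close>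

lemma T_coefficient:
  assumes N: "N \<in> atoms"
  shows "\<exists>\<beta>. \<forall>p\<in>I. \<forall>v\<in>V N. T p v = (if fst p = N then \<beta> (snd p) *\<^sub>C v else 0)"
proof -
  obtain \<beta> where \<beta>: "\<forall>v\<in>V N. v = (\<Sum>i<n N. \<beta> i *\<^sub>C \<phi> N i v)"
    using frameD(8)[OF N, of id_blinfun] by auto
  have "T p v = (if fst p = N then \<beta> (snd p) *\<^sub>C v else 0)" if p: "p \<in> I" and v: "v \<in> V N" for p v
  proof -
    obtain M i where M: "p = (M, i)" "M \<in> atoms" "i < n M"
      using p by (auto simp: I_def)
    have "v \<in> N"
      using v frameD(2)[OF N] by blast
    then have cp: "cproj M v = (if M = N then v else 0)"
      using cproj_family(2)[OF atoms_family M(2) N] by simp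
    have "v = (\<Sum>i<n N. \<phi> N i (\<beta> i *\<^sub>C v))"
    proof -
      have "v = (\<Sum>i<n N. \<beta> i *\<^sub>C \<phi> N i v)"
        using \<beta> v by blast
      also have "\<dots> = (\<Sum>i<n N. \<phi> N i (\<beta> i *\<^sub>C v))"
        by (intro sum.cong refl) (simp add: commutant_scaleC_apply[OF frameD(6)[OF N]])
      finally show ?thesis .
    qed
    then have "cproj M v = (\<Sum>i<n M. \<phi> M i (if M = N then \<beta> i *\<^sub>C v else 0))"
      by (auto simp: cp blinfun.zero_right)
    then have "T (M, i) v = (if M = N then \<beta> i *\<^sub>C v else 0)"
      by (rule T_unique[OF M(2) _ _ M(3), rotated])
        (use v csubspace_scale[OF V_subspace(1)[OF N]] csubspace_0[OF V_subspace(1)[OF M(2)]] in auto)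
    then show ?thesis
      by (simp add: M(1))
  qed
  then show ?thesis
    by (intro exI[of _ \<beta>] ballI)
qed

text \<open>The coordinates of v in \<open>V N\<close> are multiples of v and \<tau> N commutes with
  scalars, so acting by \<tau> N in coordinates means acting by \<tau> N on \<open>V N\<close>
  itself.\<close>

lemma realize_on_V:
  assumes closed: "closedin sigma_weak_topology A" and adm: "admissible m \<tau>"
  shows "\<exists>a\<in>A. \<forall>N\<in>atoms. \<forall>v\<in>V N. a v = \<tau> N v"
proof -
  obtain a where a: "a \<in> A" "\<And>p x. p \<in> I \<Longrightarrow> T p (a x) = \<tau> (fst p) (T p x)"
    using realize[OF assms] by blast
  have "a v = \<tau> N v" if N: "N \<in> atoms" and v: "v \<in> V N" for N v
  proof (rule T_separating)
    fix p assume p: "p \<in> I"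
    obtain \<beta> where \<beta>: "\<And>p v. p \<in> I \<Longrightarrow> v \<in> V N \<Longrightarrow> T p v = (if fst p = N then \<beta> (snd p) *\<^sub>C v else 0)"
      using T_coefficient[OF N] by blast
    have "\<tau> M 0 = 0" if "M \<in> atoms" for M
      using admissibleD(5)[OF adm that, of 0 0] csubspace_0[OF V_subspace(1)[OF that]] by simp
    then show "T p (a v) = T p (\<tau> N v)"
      using a(2)[OF p] \<beta>[OF p v] \<beta>[OF p admissibleD(2)[OF adm N v]] admissibleD(5)[OF adm N v] T_in(2)[OF p] by simp
  qed
  then show ?thesis
    using a(1) by blast
qed

text \<open>In coordinates \<open>a\<close> acts entrywise, so m bounds it for the new norm. Passing
  to that norm and back costs sqrt C each time.\<close>

lemma norm_le_on_V:
  assumes a: "a \<in> A" and m: "0 \<le> m" "\<And>N v. N \<in> atoms \<Longrightarrow> v \<in> V N \<Longrightarrow> norm (a v) \<le> m * norm v"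
  shows "norm a \<le> C * m"
proof (rule norm_blinfun_bound)
  show "0 \<le> C * m"
    using C_pos m(1) by simp
  fix x
  have "(norm (a x))\<^sup>2 \<le> C * (\<Sum>\<^sub>\<infinity>p\<in>I. (norm (T p (a x)))\<^sup>2)"
    using G_lower unfolding inner_G_same .
  also have "(\<Sum>\<^sub>\<infinity>p\<in>I. (norm (T p (a x)))\<^sup>2) \<le> (\<Sum>\<^sub>\<infinity>p\<in>I. m\<^sup>2 * (norm (T p x))\<^sup>2)"
  proof (intro infsum_mono T_summable summable_on_cmult_right)
    fix p assume p: "p \<in> I"
    have "norm (T p (a x)) \<le> m * norm (T p x)"
      using m(2)[OF T_in(2)[OF p] T_in(1)[OF p]] by (simp add: T_A[OF p a])
    from power_mono[OF this, of 2] show "(norm (T p (a x)))\<^sup>2 \<le> m\<^sup>2 * (norm (T p x))\<^sup>2"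
      by (simp add: power_mult_distrib)
  qed
  also have "\<dots> \<le> m\<^sup>2 * (C * (norm x)\<^sup>2)"
    unfolding infsum_cmult_right' by (intro mult_left_mono infsum_T_le) simp
  finally have "(norm (a x))\<^sup>2 \<le> C * (m\<^sup>2 * (C * (norm x)\<^sup>2))"
    using C_pos by simp
  also have "\<dots> = (C * m * norm x)\<^sup>2"
    by (simp add: power_mult_distrib power2_eq_square)
  finally show "norm (a x) \<le> C * m * norm x"
    by (rule power2_le_imp_le) (use C_pos m(1) in simp)
qed

text \<open>Adjoints are taken in each \<open>V N\<close> separately, by the Riesz theorem. Their
  norms are at most norm a, so they form an admissible family, and \<open>realize\<close> yields the
  adjoint of \<open>a\<close> for the new inner product inside \<open>A\<close>.\<close>

lemma adjoint_for_form:
  assumes closed: "closedin sigma_weak_topology A" and a: "a \<in> A"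
  shows "\<exists>a'\<in>A. \<forall>x y. inner (G (a x)) y = inner (G x) (a' y)"
proof -
  have "\<exists>z. z \<in> V N \<and> (\<forall>v\<in>V N. inner (a v) w = inner z v)" if N: "N \<in> atoms" for N w
  proof -
    have "\<exists>z\<in>V N. \<forall>v\<in>V N. inner (a v) w = inner z v"
    proof (rule riesz_subspace[OF csubspace_imp_subspace[OF V_subspace(1)[OF N]] V_subspace(2)[OF N]])
      fix v
      have "\<bar>inner (a v) w\<bar> \<le> norm (a v) * norm w"
        by (rule Cauchy_Schwarz_ineq2)
      also have "\<dots> \<le> (norm a * norm v) * norm w"
        by (intro mult_right_mono norm_blinfun) simp
      finally show "\<bar>inner (a v) w\<bar> \<le> (norm a * norm w) * norm v"
        by (simp add: mult_ac)
    qed (simp_all add: blinfun.bilinear_simps inner_add_left)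
    then show ?thesis
      by blast
  qed
  then obtain \<tau> where \<tau>: "\<And>N w. N \<in> atoms \<Longrightarrow> \<tau> N w \<in> V N"
    "\<And>N w v. N \<in> atoms \<Longrightarrow> v \<in> V N \<Longrightarrow> inner (a v) w = inner (\<tau> N w) v"
    by metis
  have eqI: "z = z'" if N: "N \<in> atoms" and z: "z \<in> V N" "z' \<in> V N" "\<And>v. v \<in> V N \<Longrightarrow> inner z v = inner z' v" for N z z'
  proof -
    have "inner (z - z') (z - z') = 0"
      using z(3)[OF csubspace_diff[OF V_subspace(1)[OF N] z(1,2)]] by (simp add: inner_diff_left)
    then show ?thesis
      by simp
  qed
  have adm: "admissible (norm a) \<tau>"
    unfolding admissible_def
  proof (intro conjI ballI allI)
    fix N v w and c :: complex assume N: "N \<in> atoms" and v: "v \<in> V N"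
    note Vs = V_subspace(1)[OF N]
    show "\<tau> N v \<in> V N"
      by (rule \<tau>(1)[OF N])
    have "norm (\<tau> N v) * norm (\<tau> N v) = inner (a (\<tau> N v)) v"
      using \<tau>(2)[OF N \<tau>(1)[OF N], of v v] by (simp add: power2_norm_eq_inner flip: power2_eq_square)
    also have "\<dots> \<le> norm (a (\<tau> N v)) * norm v"
      by (rule norm_cauchy_schwarz)
    also have "\<dots> \<le> (norm a * norm (\<tau> N v)) * norm v"
      by (intro mult_right_mono norm_blinfun) simp
    finally show "norm (\<tau> N v) \<le> norm a * norm v"
      by (cases "\<tau> N v = 0") (simp_all add: mult_ac)
    show "\<tau> N (v + w) = \<tau> N v + \<tau> N w"
      by (rule eqI[OF N]) (simp_all add: \<tau>(1)[OF N] csubspace_add[OF Vs] inner_add_left inner_add_right flip: \<tau>(2)[OF N])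
    show "\<tau> N (c *\<^sub>C v) = c *\<^sub>C \<tau> N v"
    proof (rule eqI[OF N])
      fix x assume x: "x \<in> V N"
      have ix: "\<i> *\<^sub>C x \<in> V N"
        using x by (rule csubspace_scale[OF Vs])
      have "inner (\<tau> N (c *\<^sub>C v)) x = inner (a x) (c *\<^sub>C v)"
        using \<tau>(2)[OF N x] by simp
      also have "\<dots> = Re c * inner (a x) v + Im c * inner (a x) (\<i> *\<^sub>C v)"
        by (subst scaleC_conv_ii) (simp add: inner_add_right)
      also have "inner (a x) (\<i> *\<^sub>C v) = - inner (a (\<i> *\<^sub>C x)) v"
        using inner_i_left[of "a x" v] by (simp add: A_scaleC[OF a])
      also have "\<dots> = - inner (\<tau> N v) (\<i> *\<^sub>C x)"
        by (simp add: \<tau>(2)[OF N ix])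
      also have "\<dots> = inner (\<i> *\<^sub>C \<tau> N v) x"
        by (simp add: inner_i_left)
      also have "Re c * inner (a x) v + Im c * inner (\<i> *\<^sub>C \<tau> N v) x = inner (c *\<^sub>C \<tau> N v) x"
        by (subst scaleC_conv_ii[of c]) (simp add: inner_add_left \<tau>(2)[OF N x])
      finally show "inner (\<tau> N (c *\<^sub>C v)) x = inner (c *\<^sub>C \<tau> N v) x" .
    qed (simp_all add: \<tau>(1)[OF N] csubspace_scale[OF Vs])
  qed simp
  obtain a' where a': "a' \<in> A" "\<And>p x. p \<in> I \<Longrightarrow> T p (a' x) = \<tau> (fst p) (T p x)"
    using realize[OF closed adm] by blast
  have "inner (T p (a x)) (T p y) = inner (T p x) (T p (a' y))" if p: "p \<in> I" for p x y
    using \<tau>(2)[OF T_in(2)[OF p] T_in(1)[OF p], of x "T p y"] by (simp add: T_A[OF p a] a'(2)[OF p] inner_commute)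
  then have "inner (G (a x)) y = inner (G x) (a' y)" for x y
    unfolding inner_G form_def by (intro infsum_cong)
  then show ?thesis
    using a'(1) by blast
qed

text \<open>As S S = G, the operator \<open>S\<close> is isometric from the new inner product to the
  old one and so carries adjoints to adjoints.\<close>

lemma similar_to_self_adjoint:
  assumes closed: "closedin sigma_weak_topology A"
  shows "\<exists>S\<in>bounded_ops. \<exists>S'\<in>bounded_ops. S o\<^sub>L S' = id_blinfun \<and> S' o\<^sub>L S = id_blinfun \<and>
      self_adjoint ((\<lambda>a. S o\<^sub>L a o\<^sub>L S') ` A)"
proof -
  obtain S S' :: "'a \<Rightarrow>\<^sub>L 'a" where S: "S \<in> bounded_ops" "S' \<in> bounded_ops" "S o\<^sub>L S = G" "S o\<^sub>L S' = id_blinfun"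
    "S' o\<^sub>L S = id_blinfun" and sym: "\<And>x y. inner (S x) y = inner x (S y)"
    using G_square_root by blast
  have SS': "S (S' x) = x" for x
    using arg_cong[OF S(4), of "\<lambda>T. T x"] by simp
  have "self_adjoint ((\<lambda>a. S o\<^sub>L a o\<^sub>L S') ` A)"
    unfolding self_adjoint_def
  proof
    fix R assume "R \<in> (\<lambda>a. S o\<^sub>L a o\<^sub>L S') ` A"
    then obtain a where a: "a \<in> A" "R = S o\<^sub>L a o\<^sub>L S'"
      by blast
    obtain a' where a': "a' \<in> A" "\<And>x y. inner (G (a x)) y = inner (G x) (a' y)"
      using adjoint_for_form[OF closed a(1)] by blast
    have "is_adjoint (S o\<^sub>L a o\<^sub>L S') (S o\<^sub>L a' o\<^sub>L S')"
    proof (rule is_adjointI)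
      show "S o\<^sub>L a o\<^sub>L S' \<in> bounded_ops" "S o\<^sub>L a' o\<^sub>L S' \<in> bounded_ops"
        using S(1,2) a(1) a'(1) A_bounded_ops by auto
      fix x y
      have "inner (S (a (S' x))) y = inner (S (a (S' x))) (S (S' y))"
        by (simp add: SS')
      also have "\<dots> = inner (G (a (S' x))) (S' y)"
        by (simp add: sym flip: S(3))
      also have "\<dots> = inner (G (S' x)) (a' (S' y))"
        by (rule a'(2))
      also have "\<dots> = inner x (S (a' (S' y)))"
        by (simp add: sym SS' flip: S(3))
      finally show "inner ((S o\<^sub>L a o\<^sub>L S') x) y = inner x ((S o\<^sub>L a' o\<^sub>L S') y)"
        by simp
    qed
    then show "\<exists>T'\<in>(\<lambda>a. S o\<^sub>L a o\<^sub>L S') ` A. is_adjoint R T'"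
      using a a'(1) by blast
  qed
  then show ?thesis
    using S by blast
qed

end

section \<open>Algebras of the form \<open>\<B>(V) \<otimes> 1\<close>\<close>

lemma tensor_id_nth:
  assumes "x \<in> tensor_space V n"
  shows "ell2_nth (tensor_id V n T x) i = (if i < n then T (ell2_nth x i) else 0)"
proof -
  have "summable (\<lambda>i. (norm (if i < n then T (ell2_nth x i) else 0))\<^sup>2)"
    by (rule summable_finite[of "{..<n}"]) auto
  then show ?thesis
    using assms by (simp add: tensor_id_def Abs_ell2_inverse)
qed

lemma tensor_space_nth: "x \<in> tensor_space V n \<Longrightarrow> i < n \<Longrightarrow> ell2_nth x i \<in> V"
  by (simp add: tensor_space_def)

lemma at_coord_0_in_tensor_space: "csubspace V \<Longrightarrow> v \<in> V \<Longrightarrow> 0 < n \<Longrightarrow> at_coord 0 v \<in> tensor_space V n"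
  by (auto simp: tensor_space_def csubspace_0)

lemma tensor_id_at_coord:
  assumes "csubspace V" "v \<in> V" "0 < n" "T 0 = 0"
  shows "tensor_id V n T (at_coord 0 v) = at_coord 0 (T v)"
  by (rule ell2_eqI) (use assms in \<open>simp add: tensor_id_nth[OF at_coord_0_in_tensor_space]\<close>)

lemma norm_tensor_id_le:
  assumes x: "x \<in> tensor_space V n" and T: "\<And>v. v \<in> V \<Longrightarrow> norm (T v) \<le> m * norm v" and m: "0 \<le> m"
  shows "norm (tensor_id V n T x) \<le> m * norm x"
proof (rule power2_le_imp_le)
  have "(norm (tensor_id V n T x))\<^sup>2 = (\<Sum>i<n. (norm (T (ell2_nth x i)))\<^sup>2)"
    by (subst norm_ell2_finite[of n]) (simp_all add: tensor_id_nth[OF x])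
  also have "\<dots> \<le> (\<Sum>i<n. m\<^sup>2 * (norm (ell2_nth x i))\<^sup>2)"
    using T tensor_space_nth[OF x] by (intro sum_mono) (auto simp flip: power_mult_distrib intro!: power_mono)
  also have "\<dots> = (m * norm x)\<^sup>2"
    using x by (simp add: norm_ell2_finite[of n x] tensor_space_def power_mult_distrib sum_distrib_left)
  finally show "(norm (tensor_id V n T x))\<^sup>2 \<le> (m * norm x)\<^sup>2" .
qed (use m in simp)

lemma op_norm_tensor_id_le:
  assumes V: "csubspace V" and T: "\<And>v. v \<in> V \<Longrightarrow> norm (T v) \<le> m * norm v" and m: "0 \<le> m"
  shows "op_norm_on (tensor_space V n) (tensor_id V n T) \<le> m"
  unfolding op_norm_on_def
proof (rule cSUP_least)
  have "0 \<in> {x \<in> tensor_space V n. norm x \<le> 1}"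
    using csubspace_0[OF V] by (simp add: tensor_space_def)
  then show "{x \<in> tensor_space V n. norm x \<le> 1} \<noteq> {}"
    by blast
  fix x assume "x \<in> {x \<in> tensor_space V n. norm x \<le> 1}"
  then show "norm (tensor_id V n T x) \<le> m"
    using norm_tensor_id_le[of x V n T m] T m mult_left_mono[of "norm x" 1 m] by fastforce
qed

text \<open>The supremum is tested on the unit multiple of v in coordinate 0. The constant m makes
  the set bounded, so that its supremum is an upper bound.\<close>

lemma norm_le_op_norm_tensor_id:
  assumes V: "csubspace V" and n: "0 < n" and v: "v \<in> V"
    and T: "\<And>v. v \<in> V \<Longrightarrow> norm (T v) \<le> m * norm v" and m: "0 \<le> m"
    and scale: "\<And>c v. v \<in> V \<Longrightarrow> T (c *\<^sub>C v) = c *\<^sub>C T v"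
  shows "norm (T v) \<le> op_norm_on (tensor_space V n) (tensor_id V n T) * norm v"
proof -
  let ?X = "{x \<in> tensor_space V n. norm x \<le> 1}"
  have T0: "T 0 = 0"
    using scale[OF csubspace_0[OF V], of 0] by simp
  have bdd: "bdd_above ((\<lambda>x. norm (tensor_id V n T x)) ` ?X)"
    using norm_tensor_id_le[of _ V n T m] T m mult_left_mono[of _ 1 m]
    by (intro bdd_aboveI2[where M = m]) fastforce
  show ?thesis
  proof (cases "v = 0")
    case True
    then show ?thesis
      by (simp add: T0)
  next
    case False
    define w where "w = complex_of_real (1 / norm v) *\<^sub>C v"
    have w: "w \<in> V" "norm w = 1"
      using v False by (simp_all add: w_def csubspace_scale[OF V] norm_scaleC norm_divide)
    have "norm (T w) = norm (tensor_id V n T (at_coord 0 w))"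
      by (simp add: tensor_id_at_coord[OF V w(1) n] T0)
    also have "\<dots> \<le> op_norm_on (tensor_space V n) (tensor_id V n T)"
      unfolding op_norm_on_def using w at_coord_0_in_tensor_space[OF V w(1) n]
      by (intro cSUP_upper[OF _ bdd]) simp
    also have "norm (T w) = norm (T v) / norm v"
      using v by (simp add: w_def scale norm_scaleC norm_divide)
    finally show ?thesis
      using False by (simp add: divide_le_eq)
  qed
qed

context reductive_frames
begin

text \<open>The index set has to consist of vectors, so \<open>u N\<close> serves as the index of \<open>N\<close>.\<close>

lemma inj_on_u: "inj_on u atoms"
proof (rule inj_onI, rule ccontr)
  fix N M assume NM: "N \<in> atoms" "M \<in> atoms" "u N = u M" "N \<noteq> M"
  then have "u N \<in> N \<inter> M"
    using frameD(2,3)[OF NM(1)] frameD(2,3)[OF NM(2)] by auto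
  then show False
    using independent_familyD(2)[OF atoms_family NM(1,2,4)] frameD(4)[OF NM(1)] by auto
qed

text \<open>The isomorphism restricts \<open>a\<close> to each \<open>V N\<close> and lets it act on
  n-tuples. Injectivity and the lower norm bound come from \<open>norm_le_on_V\<close>, surjectivity
  from \<open>realize_on_V\<close>.\<close>

lemma isomorphic_to_linf_sum:
  assumes closed: "closedin sigma_weak_topology A"
  shows "\<exists>(\<Lambda> :: 'a set) V n. (\<forall>l\<in>\<Lambda>. csubspace (V l :: 'a set) \<and> closed (V l) \<and> 0 < n l) \<and>
    (\<exists>\<Phi>. linf_sum_isomorphism A \<Lambda> (\<lambda>l. tensor_space (V l) (n l)) (\<lambda>l. tensor_algebra (V l) (n l)) \<Phi>)"
proof -
  define \<Lambda> where "\<Lambda> = u ` atoms"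
  define N where "N l = inv_into atoms u l" for l
  define W k where "W l = V (N l)" and "k l = n (N l)" for l
  have N: "N l \<in> atoms" "u (N l) = l" if "l \<in> \<Lambda>" for l
    using that inv_into_into[of l u atoms] f_inv_into_f[of l u atoms] by (auto simp: \<Lambda>_def N_def)
  have Nu: "u M \<in> \<Lambda>" "N (u M) = M" if "M \<in> atoms" for M
    using that by (auto simp: \<Lambda>_def N_def inv_into_f_f[OF inj_on_u])
  have W: "csubspace (W l)" "closed (W l)" "0 < k l" "a \<in> A \<Longrightarrow> w \<in> W l \<Longrightarrow> a w \<in> W l" if "l \<in> \<Lambda>" for l a w
    using V_subspace[OF N(1)[OF that]] frameD(5)[OF N(1)[OF that]] by (auto simp: W_def k_def)
  define t where "t a l = restrict (blinfun_apply a) (W l)" for a :: "'a \<Rightarrow>\<^sub>L 'a" and l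
  define \<Phi> where "\<Phi> a = restrict (\<lambda>l. tensor_id (W l) (k l) (t a l)) \<Lambda>" for a :: "'a \<Rightarrow>\<^sub>L 'a"
  define q where "q a l = op_norm_on (tensor_space (W l) (k l)) (\<Phi> a l)" for a :: "'a \<Rightarrow>\<^sub>L 'a" and l
  let ?X = "\<lambda>l. tensor_space (W l) (k l)" and ?B = "\<lambda>l. tensor_algebra (W l) (k l)"
  have \<Phi>_nth: "ell2_nth (\<Phi> a l x) i = (if i < k l then a (ell2_nth x i) else 0)" if "l \<in> \<Lambda>" "x \<in> ?X l" for a l x i
    using that tensor_space_nth[of x] by (simp add: \<Phi>_def t_def tensor_id_nth)
  have t_bound: "norm (t a l v) \<le> norm a * norm v" if "v \<in> W l" for a l v
    using that norm_blinfun by (simp add: t_def)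
  have t_ops: "t a l \<in> bounded_ops_on (W l)" if a: "a \<in> A" and l: "l \<in> \<Lambda>" for a l
    using W[OF l] a
    by (auto simp: bounded_ops_on_def t_def csubspace_add csubspace_scale blinfun.add_right A_scaleC
        intro!: exI[of _ "norm a"] norm_blinfun)
  have q_le: "q a l \<le> norm a" if l: "l \<in> \<Lambda>" for a l
    using l t_bound by (auto simp: q_def \<Phi>_def intro!: op_norm_tensor_id_le[OF W(1)])
  have le_q: "norm (a v) \<le> q a l * norm v" if a: "a \<in> A" and l: "l \<in> \<Lambda>" and v: "v \<in> W l" for a l v
  proof -
    have "norm (t a l v) \<le> op_norm_on (?X l) (tensor_id (W l) (k l) (t a l)) * norm v"
    proof (rule norm_le_op_norm_tensor_id[OF W(1,3)[OF l] v t_bound])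
      show "t a l (c *\<^sub>C w) = c *\<^sub>C t a l w" if "w \<in> W l" for c w
        using that a csubspace_scale[OF W(1)[OF l]] by (simp add: t_def A_scaleC)
    qed auto
    then show ?thesis
      using v l by (simp add: q_def \<Phi>_def t_def)
  qed
  have \<Phi>_in: "\<Phi> a \<in> linf_sum \<Lambda> ?X ?B" if a: "a \<in> A" for a
  proof -
    have "\<Phi> a l \<in> ?B l" if "l \<in> \<Lambda>" for l
      using t_ops[OF a that] that by (simp add: \<Phi>_def tensor_algebra_def)
    moreover have "bdd_above ((\<lambda>l. q a l) ` \<Lambda>)"
      using q_le by (intro bdd_aboveI2[where M = "norm a"])
    ultimately show ?thesis
      by (auto simp: linf_sum_def \<Phi>_def q_def cong: image_cong)
  qed
  have q_linf: "q a l \<le> linf_norm \<Lambda> ?X (\<Phi> a)" if "l \<in> \<Lambda>" for a l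
    unfolding linf_norm_def
    using that q_le by (intro cSup_upper) (auto simp: q_def intro!: bdd_aboveI[of _ "norm a"])
  have linf_nonneg: "0 \<le> linf_norm \<Lambda> ?X (\<Phi> a)" for a
    unfolding linf_norm_def using q_le by (intro cSup_upper) (auto simp: q_def intro!: bdd_aboveI[of _ "norm a"])
  have norm_le: "norm a \<le> C * linf_norm \<Lambda> ?X (\<Phi> a)" if a: "a \<in> A" for a
  proof (rule norm_le_on_V[OF a linf_nonneg])
    fix M v assume M: "M \<in> atoms" and v: "v \<in> V M"
    have "norm (a v) \<le> q a (u M) * norm v"
      using v by (intro le_q[OF a Nu(1)[OF M]]) (simp add: W_def Nu(2)[OF M])
    also have "\<dots> \<le> linf_norm \<Lambda> ?X (\<Phi> a) * norm v"
      by (intro mult_right_mono q_linf Nu(1)[OF M]) simp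
    finally show "norm (a v) \<le> linf_norm \<Lambda> ?X (\<Phi> a) * norm v" .
  qed
  have eq_on_V: "a v = b v" if l: "l \<in> \<Lambda>" and eq: "\<Phi> a l = \<Phi> b l" and v: "v \<in> W l" for a b l v
    using \<Phi>_nth[OF l at_coord_0_in_tensor_space[OF W(1)[OF l] v W(3)[OF l]], of a 0]
      \<Phi>_nth[OF l at_coord_0_in_tensor_space[OF W(1)[OF l] v W(3)[OF l]], of b 0] W(3)[OF l] eq by simp
  have inj: "inj_on \<Phi> A"
  proof (rule inj_onI)
    fix a b assume a: "a \<in> A" and b: "b \<in> A" and eq: "\<Phi> a = \<Phi> b"
    have "norm (a - b) \<le> C * 0"
    proof (rule norm_le_on_V)
      show "a - b \<in> A"
        using csubspace_diff[OF A_subspace a b] .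
      fix M v assume M: "M \<in> atoms" and v: "v \<in> V M"
      show "norm ((a - b) v) \<le> 0 * norm v"
        using eq_on_V[OF Nu(1)[OF M] fun_cong[OF eq], of v] v by (simp add: W_def Nu(2)[OF M] blinfun.diff_left)
    qed simp
    then show "a = b"
      by simp
  qed
  have surj: "\<exists>a\<in>A. \<Phi> a = f" if f: "f \<in> linf_sum \<Lambda> ?X ?B" for f
  proof -
    have "\<exists>s. s \<in> bounded_ops_on (W l) \<and> f l = tensor_id (W l) (k l) s" if "l \<in> \<Lambda>" for l
      using f that by (auto simp: linf_sum_def tensor_algebra_def PiE_def Pi_def)
    then obtain s where s: "\<And>l. l \<in> \<Lambda> \<Longrightarrow> s l \<in> bounded_ops_on (W l)"
      "\<And>l. l \<in> \<Lambda> \<Longrightarrow> f l = tensor_id (W l) (k l) (s l)"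
      by metis
    obtain m0 where m0: "\<And>l. l \<in> \<Lambda> \<Longrightarrow> op_norm_on (?X l) (f l) \<le> m0"
      using f by (auto simp: linf_sum_def bdd_above_def)
    \<comment> \<open>\<open>m0\<close> bounds a possibly empty set, so it may be negative.\<close>
    have adm: "admissible (max m0 0) (\<lambda>M. s (u M))"
      unfolding admissible_def
    proof (intro conjI ballI allI)
      fix M v w and c :: complex assume M: "M \<in> atoms" and v: "v \<in> V M"
      note l = Nu(1)[OF M] and sM = s(1)[OF Nu(1)[OF M], unfolded bounded_ops_on_def W_def Nu(2)[OF M]]
      show "s (u M) v \<in> V M"
        using sM v by auto
      show "s (u M) (c *\<^sub>C v) = c *\<^sub>C s (u M) v"
        using sM v by simp
      show "s (u M) (v + w) = s (u M) v + s (u M) w" if "w \<in> V M"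
        using sM v that by simp
      \<comment> \<open>This bound depends on \<open>M\<close> and ensures that the operator norm is
        the supremum of a bounded set; the uniform bound is \<open>m0\<close>.\<close>
      obtain m1 where m1: "\<forall>v\<in>V M. norm (s (u M) v) \<le> m1 * norm v"
        using sM by auto
      have "norm (s (u M) v) \<le> op_norm_on (?X (u M)) (f (u M)) * norm v"
        unfolding s(2)[OF l] W_def Nu(2)[OF M]
      proof (rule norm_le_op_norm_tensor_id[OF V_subspace(1)[OF M] _ v, of _ _ "max m1 0"])
        show "0 < k (u M)"
          by (rule W(3)[OF l])
        show "norm (s (u M) v) \<le> max m1 0 * norm v" if "v \<in> V M" for v
          using bspec[OF m1 that] by (rule order_trans) (simp add: mult_right_mono)
        show "s (u M) (c *\<^sub>C v) = c *\<^sub>C s (u M) v" if "v \<in> V M" for c v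
          using sM that by simp
      qed simp
      also have "\<dots> \<le> max m0 0 * norm v"
        using m0[OF l] by (intro mult_right_mono) auto
      finally show "norm (s (u M) v) \<le> max m0 0 * norm v" .
    qed simp
    obtain a where a: "a \<in> A" "\<And>M v. M \<in> atoms \<Longrightarrow> v \<in> V M \<Longrightarrow> a v = s (u M) v"
      using realize_on_V[OF closed adm] by blast
    have "\<Phi> a = f"
    proof (rule ext)
      fix l
      show "\<Phi> a l = f l"
      proof (cases "l \<in> \<Lambda>")
        case True
        have "t a l = s l"
        proof (rule ext)
          fix v
          show "t a l v = s l v"
            using s(1)[OF True] a(2)[OF N(1)[OF True], of v] N(2)[OF True]
            by (cases "v \<in> W l") (auto simp: t_def W_def bounded_ops_on_def PiE_def extensional_def)
        qed
        then show ?thesis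
          using True by (simp add: \<Phi>_def s(2))
      next
        case False
        then show ?thesis
          using f by (auto simp: \<Phi>_def linf_sum_def PiE_def extensional_def)
      qed
    qed
    then show ?thesis
      using a(1) by blast
  qed
  have "linf_sum_isomorphism A \<Lambda> ?X ?B \<Phi>"
    unfolding linf_sum_isomorphism_def
  proof (intro conjI ballI allI)
    show "bij_betw \<Phi> A (linf_sum \<Lambda> ?X ?B)"
      unfolding bij_betw_def using inj \<Phi>_in surj by blast
    fix a b and c :: complex assume a: "a \<in> A"
    fix l x assume l: "l \<in> \<Lambda>" and x: "x \<in> ?X l"
    show "\<Phi> (a + b) l x = \<Phi> a l x + \<Phi> b l x"
      by (rule ell2_eqI) (simp add: \<Phi>_nth[OF l x] blinfun.add_left)
    show "\<Phi> (c *\<^sub>C a) l x = c *\<^sub>C \<Phi> a l x"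
      by (rule ell2_eqI) (simp add: \<Phi>_nth[OF l x])
    show "\<Phi> (a o\<^sub>L b) l x = \<Phi> a l (\<Phi> b l x)" if b: "b \<in> A"
    proof (rule ell2_eqI)
      fix i
      have "\<Phi> b l x \<in> ?X l"
        using W(4)[OF l b] tensor_space_nth[OF x] by (simp add: tensor_space_def \<Phi>_nth[OF l x])
      from \<Phi>_nth[OF l this] show "ell2_nth (\<Phi> (a o\<^sub>L b) l x) i = ell2_nth (\<Phi> a l (\<Phi> b l x)) i"
        by (simp add: \<Phi>_nth[OF l x])
    qed
  next
    have "linf_norm \<Lambda> ?X (\<Phi> a) \<le> 1 * norm a" for a
      unfolding linf_norm_def using q_le by (intro cSup_least) (auto simp: q_def)
    then show "\<exists>K. \<forall>a\<in>A. linf_norm \<Lambda> ?X (\<Phi> a) \<le> K * norm a"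
      by blast
    show "\<exists>K. \<forall>a\<in>A. norm a \<le> K * linf_norm \<Lambda> ?X (\<Phi> a)"
      using norm_le by blast
  qed
  then show ?thesis
    using W by (intro exI[of _ \<Lambda>] exI[of _ W] exI[of _ k]) blast
qed

end

theorem theorem4p3p14:
  fixes A :: "('a::chilbert_space \<Rightarrow>\<^sub>L 'a) set"
  assumes "subalgebra A"
    and "closedin sigma_weak_topology A"
    and "complete_reduction_property A"
    and "nondegenerate (A \<inter> compact_ops)"
  shows "(\<exists>S\<in>bounded_ops. \<exists>S'\<in>bounded_ops. S o\<^sub>L S' = id_blinfun \<and> S' o\<^sub>L S = id_blinfun \<and>
      self_adjoint ((\<lambda>a. S o\<^sub>L a o\<^sub>L S') ` A)) \<and>
    (\<exists>(\<Lambda> :: 'a set) V n.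
      (\<forall>l\<in>\<Lambda>. csubspace (V l :: 'a set) \<and> closed (V l) \<and> 0 < n l) \<and>
      (\<exists>\<Phi>. linf_sum_isomorphism A \<Lambda> (\<lambda>l. tensor_space (V l) (n l))
        (\<lambda>l. tensor_algebra (V l) (n l)) \<Phi>))"
proof -
  obtain K where K: "1 \<le> K" "\<And>V. submodule A V \<Longrightarrow> \<exists>P. module_projection A V P \<and> norm P \<le> K"
    using uniform_module_projections[OF assms(3)] by blast
  interpret reductive A K
    by unfold_locales (fact assms K)+
  obtain V u n \<phi> where "\<forall>N\<in>atoms. isotypic_frame N (V N) (u N) (n N) (\<phi> N)"
    using ex_isotypic_frames by blast
  then interpret reductive_frames A K V u n \<phi>
    by unfold_locales blast
  show ?thesis
    using similar_to_self_adjoint[OF assms(2)] isomorphic_to_linf_sum[OF assms(2)] by (rule conjI)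
qed

end
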